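(* Let $c\in\mathbb{R}_{>1}$, let $m$ be a positive integer, let $r\in\{2,3\}$, and let $r<p<q$ be distinct primes with $q\le cp$. (1) Let $G=C_{p^m}\oplus C_p$. If $\frac1r+\frac{p^m-1}{p^{m+1}-p^m}+\frac1p\ge\frac{\log_2(rp^{m+1})}{p}$, then $K_1(C_r\oplus C_{p^m}\oplus C_p)=K_1^*(C_r\oplus C_{p^m}\oplus C_p)$. (2) Let $G=C_{p^mq}$. If $\frac1r+\frac{p^m-1}{p^{m+1}-p^m}+\frac1{cp}\ge\frac{\log_2(rcp^{m+1})}{p}$, then $K_1(C_{rp^mq})=K_1^*(C_{rp^mq})$. (3) Let $G=C_{pq^m}$. If $\frac1r+\frac1p+\frac{(cp)^m-1}{(cp)^{m+1}-(cp)^m}\ge\frac{\log_2(rc^mp^{m+1})}{p}$, then $K_1(C_{rpq^m})=K_1^*(C_{rpq^m})$. (4) Let $G=C_{p^m}\oplus C_q^2$. If $\frac1r+\frac{p^m-1}{p^{m+1}-p^m}+\frac2{cp}\ge\frac{\log_2(rc^2p^{m+2})}{p}$, then $K_1(C_r\oplus C_{p^m}\oplus C_q^2)=K_1^*(C_r\oplus C_{p^m}\oplus C_q^2)$. (5) Let $G=C_p^2\oplus C_{q^m}$. If $\frac1r+\frac2p+\frac{(cp)^m-1}{(cp)^{m+1}-(cp)^m}\ge\frac{\log_2(rc^mp^{m+2})}{p}$, then $K_1(C_r\oplus C_p^2\oplus C_{q^m})=K_1^*(C_r\oplus C_p^2\oplus C_{q^m})$. Moreover, in each of the cases (1)–(5),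 if the corresponding inequality holds and equality does not hold in it, then any UFIM $S$ over $(C_r\oplus G)\setminus\{0\}$ with $k(S)=K_1(C_r\oplus G)$ has a decomposition $S=S_r\sqcup S_G$ such that $S_r$ is a UFIM over $C_r\setminus\{0\}$ and $S_G$ is a UFIM over $G\setminus\{0\}$ (with $C_r$ and $G$ regarded as subgroups of $C_r\oplus G$).
   Context: Groups are finite abelian, written additively; $C_n$ is the cyclic group of order $n$. An indexed multiset $S=\{g_1,\ldots,g_\ell\}$ over a set $X\subseteq G$ is a finite (possibly empty) indexed family of elements of $X$; for $I\subseteq[\ell]$ put $S(I)=\{g_i : i\in I\}$; submultisets of $S$ are the $S(I)$, and disjoint unions $\sqcup$ are taken with respect to indices. Put $\sigma(S)=\sum_{g\in S}g$ (with multiplicity), $\sigma(\emptyset)=0$. $S$ is zero-sum if $\sigma(S)=0$; minimal zero-sum if $\sigma(S)=0$ and $\sigma(S')\ne0$ for every $\emptyset\subsetneq S'\subsetneq S$. An irreducible factorization of $S$ over $G\setminus\{0\}$ is a partition $[\ell]=\bigsqcup_{i=1}^m I_i$ into nonempty sets with each $S(I_i)$ minimal zero-sum; two factorizations are equivalent iff they are the same set of blocks $\{I_1,\ldots,I_m\}$. A unique factorization indexed multiset (UFIM) over $G\setminus\{0\}$ is a zero-sum indexed multiset over $G\setminus\{0\}$ with exactly one irreducible factorization up to equivalence. The cross number of $S$ is $k(S)=\sum_{g\in S}\frac1{\mathrm{ord}(g)}$ (with multiplicity; $k(\emptyset)=0$), and $K_1(G)=\max\{k(S): S\text{ is a UFIM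 over }G\setminus\{0\}\}$. For $G=\bigoplus_{i=1}^n\bigoplus_{j=1}^{n_i}C_{p_i^{e_{ij}}}$ with distinct primes $p_i$ and $e_{ij}\ge1$, put $K_1^*(G)=\sum_{i=1}^n\sum_{j=1}^{n_i}\frac{p_i^{e_{ij}}-1}{p_i^{e_{ij}}-p_i^{e_{ij}-1}}$. *)

theory Defs
  imports
    Complex_Main
    "HOL-Library.Disjoint_Sets"
    "HOL-Computational_Algebra.Primes"
    "HOL-Algebra.Multiplicative_Group"
    "HOL-Algebra.Product_Groups"
begin

text \<open>
  An indexed multiset \<open>{g_1, ..., g_l}\<close> is a list \<open>S\<close> of length \<open>l\<close>, with index set
  \<open>{..<length S}\<close>; for a set \<open>I\<close> of indices, the submultiset \<open>S(I)\<close> is \<open>nths S I\<close>.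
  HOL-Algebra writes groups multiplicatively, so the neutral element, called \<open>0\<close> in the additive
  notation of the subject, is \<open>\<one>\<^bsub>G\<^esub>\<close> here, and the sum \<open>\<sigma>(S)\<close> is a \<^const>\<open>finprod\<close>.
\<close>

definition seq_sum :: "('a, 'b) monoid_scheme \<Rightarrow> 'a list \<Rightarrow> 'a" where
  "seq_sum G S = finprod G (\<lambda>i. S ! i) {..<length S}"

definition zero_sum :: "('a, 'b) monoid_scheme \<Rightarrow> 'a list \<Rightarrow> bool" where
  "zero_sum G S \<longleftrightarrow> seq_sum G S = \<one>\<^bsub>G\<^esub>"

definition minimal_zero_sum :: "('a, 'b) monoid_scheme \<Rightarrow> 'a list \<Rightarrow> bool" where
  "minimal_zero_sum G S \<longleftrightarrow>
     zero_sum G S \<and> (\<forall>I. I \<noteq> {} \<and> I \<subset> {..<length S} \<longrightarrow> \<not> zero_sum G (nths S I))"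

text \<open>The blocks are nonempty by the definition of \<^const>\<open>partition_on\<close>.\<close>

definition irreducible_factorization ::
    "('a, 'b) monoid_scheme \<Rightarrow> 'a list \<Rightarrow> nat set set \<Rightarrow> bool" where
  "irreducible_factorization G S P \<longleftrightarrow>
     partition_on {..<length S} P \<and> (\<forall>I\<in>P. minimal_zero_sum G (nths S I))"

definition UFIM :: "('a, 'b) monoid_scheme \<Rightarrow> 'a set \<Rightarrow> 'a list \<Rightarrow> bool" where
  "UFIM G X S \<longleftrightarrow>
     set S \<subseteq> X \<and> zero_sum G S \<and> (\<exists>!P. irreducible_factorization G S P)"

definition cross_number :: "('a, 'b) monoid_scheme \<Rightarrow> 'a list \<Rightarrow> real" where
  "cross_number G S = (\<Sum>g\<leftarrow>S. 1 / real (group.ord G g))"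

text \<open>
  For finite \<open>G\<close> the maximum exists: the length of a UFIM over the nonzero elements is bounded in
  terms of the order of \<open>G\<close>, so there are only finitely many of them.
\<close>

definition K1 :: "('a, 'b) monoid_scheme \<Rightarrow> real" where
  "K1 G = Max {cross_number G S |S. UFIM G (carrier G - {\<one>\<^bsub>G\<^esub>}) S}"

text \<open>
  A list of pairs \<open>(p, e)\<close> encodes a decomposition into cyclic groups of prime power order
  \<open>p ^ e\<close>; the same prime may occur several times, so no separate grouping by primes is needed.
\<close>

definition primary_decomposition :: "('a, 'b) monoid_scheme \<Rightarrow> (nat \<times> nat) list \<Rightarrow> bool" where
  "primary_decomposition G ps \<longleftrightarrow>
     (\<forall>(p, e)\<in>set ps. prime p \<and> 1 \<le> e) \<and>
     G \<cong> product_group {..<length ps} (\<lambda>i. integer_mod_group (fst (ps ! i) ^ snd (ps ! i)))"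

text \<open>
  Well-defined for every finite abelian group: a primary decomposition exists, and it is unique
  up to the order of the list.
\<close>

definition K1_star :: "('a, 'b) monoid_scheme \<Rightarrow> real" where
  "K1_star G = (THE x. \<exists>ps. primary_decomposition G ps \<and>
     x = (\<Sum>(p, e)\<leftarrow>ps. (real p ^ e - 1) / (real p ^ e - real p ^ (e - 1))))"

text \<open>
  The extremal UFIMs over the nonzero elements of \<open>A \<oplus> B\<close> decompose, \<open>A\<close> and \<open>B\<close> being regarded
  as the subgroups \<open>A \<times> {0}\<close> and \<open>{0} \<times> B\<close>.
\<close>

definition extremal_UFIMs_split ::
    "('a, 'b) monoid_scheme \<Rightarrow> ('c, 'd) monoid_scheme \<Rightarrow> bool" where
  "extremal_UFIMs_split A B \<longleftrightarrow>
     (\<forall>S. UFIM (A \<times>\<times> B) (carrier (A \<times>\<times> B) - {\<one>\<^bsub>A \<times>\<times> B\<^esub>}) S \<and>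
          cross_number (A \<times>\<times> B) S = K1 (A \<times>\<times> B) \<longrightarrow>
        (\<exists>I \<subseteq> {..<length S}.
           UFIM (A \<times>\<times> B) (carrier A \<times> {\<one>\<^bsub>B\<^esub>} - {\<one>\<^bsub>A \<times>\<times> B\<^esub>}) (nths S I) \<and>
           UFIM (A \<times>\<times> B) ({\<one>\<^bsub>A\<^esub>} \<times> carrier B - {\<one>\<^bsub>A \<times>\<times> B\<^esub>}) (nths S ({..<length S} - I))))"

abbreviation Cyc :: "nat \<Rightarrow> int monoid" where
  "Cyc \<equiv> integer_mod_group"

end

theory Submission
  imports
    Defs
    "HOL-Library.Product_Plus"
    "HOL-Number_Theory.Residues"
begin

text \<open>
  A zero-sum family is a unique factorization family iff its zero-sum index sets are closed under
  intersection. This property survives merging several elements into their sum, and merging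
  elements of equal order until nothing more can be gained reduces the cross number of a mixed
  group to those of its primary parts. If the indices lying in one direct summand realize all of
  its elements as subset sums, they absorb the components of the other elements there, so that the
  latter project to a unique factorization family over the complement; otherwise two further
  indices could be added, so their number stays two below the maximal length, which outweighs
  the cross number of the mixed elements that remain after merging. The base case is a group of type
  \<open>(p, p)\<close>, where families have length at most \<open>2 * p\<close>: there, combinations of translations along
  blocks of even size and along pairs of blocks of odd size lower the degree of polynomial
  functions modulo \<open>p\<close> by the total size of the blocks.
\<close>

section \<open>Zero-sum index sets modulo a subgroup\<close>

text \<open>Elements of mixed order are the obstacle, since they lie in no direct summand. A part of
  exponent q or r that is not exhausted by subset sums falls two elements short of its length bound,
  hence 2/q or 2/r short in cross number, and the mixed elements must be worth no more than that.
  Merging leaves at most p elements of order p^(k+1) q, worth 1/(p^k q), and the sum over k is at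
  most 2/q. For the summand C_r at most r elements of order r d remain for each divisor d > 1 of e,
  worth 1/d; as the primes dividing e exceed r, these values add up to less than (1 + 1/r)(1 +
  1/(r+1)) - 1 = 2/r. This inequality is strict, so equality forces the exhausted case, where orders
  survive the projection and the family splits. In type (p, p), counting subset sums only bounds the
  product of the block sizes by p^2, while a length of 2p is needed; hence the polynomial method.
  Everything is stated modulo a subgroup \<open>Z\<close> of an ambient additive group, so that the
  same lemmas serve the group itself and the layers of its torsion filtration.\<close>

definition sg :: "'a::ab_group_add set \<Rightarrow> bool" where
  "sg Z \<longleftrightarrow> 0 \<in> Z \<and> (\<forall>x\<in>Z. \<forall>y\<in>Z. x + y \<in> Z) \<and> (\<forall>x\<in>Z. - x \<in> Z)"

lemma sg_zero: "sg Z \<Longrightarrow> 0 \<in> Z"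
  by (simp add: sg_def)

lemma sg_add: "sg Z \<Longrightarrow> x \<in> Z \<Longrightarrow> y \<in> Z \<Longrightarrow> x + y \<in> Z"
  by (simp add: sg_def)

lemma sg_minus: "sg Z \<Longrightarrow> x \<in> Z \<Longrightarrow> - x \<in> Z"
  by (simp add: sg_def)

lemma sg_diff: "sg Z \<Longrightarrow> x \<in> Z \<Longrightarrow> y \<in> Z \<Longrightarrow> x - y \<in> Z"
  by (metis sg_add sg_minus ab_group_add_class.ab_diff_conv_add_uminus)

lemma sg_minus_iff: "sg Z \<Longrightarrow> - x \<in> Z \<longleftrightarrow> x \<in> Z"
  by (metis sg_minus minus_minus)

lemma sg_add_iff1: "sg Z \<Longrightarrow> x \<in> Z \<Longrightarrow> x + y \<in> Z \<longleftrightarrow> y \<in> Z"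
  by (metis add_diff_cancel_left' sg_add sg_diff)

lemma sg_add_iff2: "sg Z \<Longrightarrow> y \<in> Z \<Longrightarrow> x + y \<in> Z \<longleftrightarrow> x \<in> Z"
  by (metis add.commute sg_add_iff1)

lemma sg_diff_commute: "sg Z \<Longrightarrow> x - y \<in> Z \<longleftrightarrow> y - x \<in> Z"
  by (metis minus_diff_eq sg_minus_iff)

lemma sg_sum: "sg Z \<Longrightarrow> (\<And>i. i \<in> K \<Longrightarrow> g i \<in> Z) \<Longrightarrow> sum g K \<in> Z"
  by (induction K rule: infinite_finite_induct) (auto simp: sg_zero sg_add)

lemma sg_Int: "sg A \<Longrightarrow> sg B \<Longrightarrow> sg (A \<inter> B)"
  by (auto simp: sg_def)

text \<open>The total is left free, so that the notion passes to every subfamily; \<open>UF\<close>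
  adds that the total is zero. Sums are tested for membership in \<open>Z\<close> instead of being
  taken in a quotient, so that \<open>Z\<close> can be enlarged to a torsion subgroup.\<close>

definition ucl :: "'a::ab_group_add set \<Rightarrow> ('i \<Rightarrow> 'a) \<Rightarrow> 'i set \<Rightarrow> bool" where
  "ucl Z g I \<longleftrightarrow> finite I \<and>
     (\<forall>K L. K \<subseteq> I \<longrightarrow> L \<subseteq> I \<longrightarrow> sum g K \<in> Z \<longrightarrow> sum g L \<in> Z \<longrightarrow> sum g (K \<inter> L) \<in> Z)"

definition UF :: "'a::ab_group_add set \<Rightarrow> ('i \<Rightarrow> 'a) \<Rightarrow> 'i set \<Rightarrow> bool" where
  "UF Z g I \<longleftrightarrow> ucl Z g I \<and> sum g I \<in> Z"

lemma ucl_Int: "ucl Z g I \<Longrightarrow> K \<subseteq> I \<Longrightarrow> L \<subseteq> I \<Longrightarrow> sum g K \<in> Z \<Longrightarrow> sum g L \<in> Z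
    \<Longrightarrow> sum g (K \<inter> L) \<in> Z"
  by (auto simp: ucl_def)

lemma ucl_finite: "ucl Z g I \<Longrightarrow> finite I"
  by (auto simp: ucl_def)

lemma ucl_subset: "ucl Z g I \<Longrightarrow> J \<subseteq> I \<Longrightarrow> ucl Z g J"
  unfolding ucl_def using finite_subset by (metis subset_trans)

lemma sum_Diff_sg:
  assumes "sg Z" "finite K" "sum g K \<in> Z" "sum g (K \<inter> L) \<in> Z"
  shows "sum g (K - L) \<in> Z"
proof -
  have "sum g (K - L) = sum g K - sum g (K \<inter> L)"
    using sum.Int_Diff[OF assms(2), of g L] by simp
  then show ?thesis
    using assms sg_diff by metis
qed

lemma ucl_Diff:
  assumes "sg Z" "ucl Z g I" "K \<subseteq> I" "L \<subseteq> I" "sum g K \<in> Z" "sum g L \<in> Z"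
  shows "sum g (K - L) \<in> Z"
  using assms sum_Diff_sg[of Z K g L] ucl_Int[of Z g I K L] ucl_finite finite_subset by metis

lemma sum_Un_sg:
  assumes "sg Z" "finite K" "finite L" "sum g K \<in> Z" "sum g L \<in> Z" "sum g (K \<inter> L) \<in> Z"
  shows "sum g (K \<union> L) \<in> Z"
proof -
  have "sum g (K \<union> L) = sum g K + sum g L - sum g (K \<inter> L)"
    by (rule sum_Un) (use assms in auto)
  then show ?thesis
    using assms sg_diff sg_add by metis
qed

lemma ucl_Un:
  assumes "sg Z" "ucl Z g I" "K \<subseteq> I" "L \<subseteq> I" "sum g K \<in> Z" "sum g L \<in> Z"
  shows "sum g (K \<union> L) \<in> Z"
  using assms sum_Un_sg[of Z K L g] ucl_Int[of Z g I K L] ucl_finite finite_subset by metis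

lemma UF_subset: "UF Z g I \<Longrightarrow> K \<subseteq> I \<Longrightarrow> sum g K \<in> Z \<Longrightarrow> UF Z g K"
  using ucl_subset by (auto simp: UF_def)

section \<open>Reindexing, completing and merging families\<close>

lemma UF_reindex:
  assumes "inj_on f J"
  shows "UF Z g (f ` J) \<longleftrightarrow> UF Z (g \<circ> f) J"
proof -
  have s: "sum g (f ` K) = sum (g \<circ> f) K" if "K \<subseteq> J" for K
    using sum.reindex[of f K g] assms inj_on_subset that by blast
  have fin: "finite (f ` J) \<longleftrightarrow> finite J"
    using assms finite_image_iff by blast
  have Int: "sum g (f ` K \<inter> f ` L) = sum (g \<circ> f) (K \<inter> L)" if "K \<subseteq> J" "L \<subseteq> J" for K L
  proof -
    have "f ` (K \<inter> L) = f ` K \<inter> f ` L"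
      using that assms by (meson inj_on_image_Int)
    moreover have "K \<inter> L \<subseteq> J" using that by auto
    ultimately show ?thesis using s by metis
  qed
  have "ucl Z g (f ` J) \<longleftrightarrow> ucl Z (g \<circ> f) J"
  proof
    assume L: "ucl Z g (f ` J)"
    then have "finite J" using fin ucl_finite by blast
    moreover have "sum (g \<circ> f) (K \<inter> L) \<in> Z"
      if K: "K \<subseteq> J" "L \<subseteq> J" "sum (g \<circ> f) K \<in> Z" "sum (g \<circ> f) L \<in> Z" for K L
      using ucl_Int[OF L, of "f ` K" "f ` L"] K s Int by (simp add: image_mono)
    ultimately show "ucl Z (g \<circ> f) J" unfolding ucl_def by blast
  next
    assume R: "ucl Z (g \<circ> f) J"
    then have "finite (f ` J)" using fin ucl_finite by blast
    moreover have "sum g (K \<inter> L) \<in> Z"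
      if K: "K \<subseteq> f ` J" "L \<subseteq> f ` J" "sum g K \<in> Z" "sum g L \<in> Z" for K L
    proof -
      obtain K' L' where "K' \<subseteq> J" "L' \<subseteq> J" "K = f ` K'" "L = f ` L'"
        using K by (meson subset_imageE)
      then show ?thesis using ucl_Int[OF R, of K' L'] K s Int by simp
    qed
    ultimately show "ucl Z g (f ` J)" unfolding ucl_def by blast
  qed
  then show ?thesis
    using s[of J] by (simp add: UF_def)
qed

text \<open>The added index carries the element that makes the total sum zero.\<close>

lemma ucl_complete:
  assumes Z: "sg Z" and u: "ucl Z g I" and z: "z \<notin> I" and y: "y + sum g I \<in> Z"
  shows "UF Z (g(z := y)) (insert z I)"
proof -
  let ?g = "g(z := y)"
  have fin: "finite I" using u by (rule ucl_finite)
  have s0: "sum ?g K = sum g K" if "K \<subseteq> I" for K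
    using that z by (intro sum.cong) auto
  have s1: "sum ?g (insert z K) = y + sum g K" if "K \<subseteq> I" for K
    using that z fin s0[OF that] by (subst sum.insert) (auto intro: finite_subset)
  \<comment> \<open>Complements in \<open>I\<close> eliminate the new index: the intersection of two
    sets containing \<open>z\<close> becomes a union, and that of a set containing \<open>z\<close>
    with one avoiding it becomes a difference.\<close>
  have compl: "y + sum g K \<in> Z \<longleftrightarrow> sum g (I - K) \<in> Z" if "K \<subseteq> I" for K
  proof -
    have "y + sum g I = (y + sum g K) + sum g (I - K)"
      using sum.subset_diff[OF that fin, of g] by (simp add: algebra_simps)
    then show ?thesis
      using Z y sg_add_iff1 sg_add_iff2 by metis
  qed
  have "ucl Z ?g (insert z I)"
    unfolding ucl_def
  proof (intro conjI allI impI)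
    show "finite (insert z I)" using fin by simp
    fix K L assume KL: "K \<subseteq> insert z I" "L \<subseteq> insert z I" "sum ?g K \<in> Z" "sum ?g L \<in> Z"
    have main: "sum ?g (K \<inter> L) \<in> Z"
      if "K \<subseteq> insert z I" "L \<subseteq> I" "z \<in> K" "sum ?g K \<in> Z" "sum ?g L \<in> Z" for K L
    proof -
      define K' where "K' = K - {z}"
      have K': "K = insert z K'" "K' \<subseteq> I" "z \<notin> K'"
        using that by (auto simp: K'_def)
      have "sum g (I - K') \<in> Z" using that K' s1 compl by simp
      then have "sum g (L - (I - K')) \<in> Z"
        using ucl_Diff[OF Z u] that s0 by simp
      moreover have "L - (I - K') = K \<inter> L" using that K' z by auto
      moreover have "K \<inter> L \<subseteq> I" using that by auto
      ultimately show ?thesis using s0 by simp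
    qed
    consider "z \<in> K" "z \<in> L" | "z \<in> K" "z \<notin> L" | "z \<notin> K" "z \<in> L" | "z \<notin> K" "z \<notin> L" by auto
    then show "sum ?g (K \<inter> L) \<in> Z"
    proof cases
      case 1
      define K' where "K' = K - {z}"
      have K': "K = insert z K'" "K' \<subseteq> I" "z \<notin> K'"
        using KL 1 by (auto simp: K'_def)
      define L' where "L' = L - {z}"
      have L': "L = insert z L'" "L' \<subseteq> I" "z \<notin> L'"
        using KL 1 by (auto simp: L'_def)
      have "sum g (I - K') \<in> Z" "sum g (I - L') \<in> Z" using KL K' L' s1 compl by simp_all
      then have "sum g ((I - K') \<union> (I - L')) \<in> Z"
        using ucl_Un[OF Z u] by simp
      moreover have "(I - K') \<union> (I - L') = I - (K' \<inter> L')" by auto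
      ultimately have "y + sum g (K' \<inter> L') \<in> Z" using compl[of "K' \<inter> L'"] K' by auto
      moreover have "K \<inter> L = insert z (K' \<inter> L')" using K' L' by auto
      moreover have "K' \<inter> L' \<subseteq> I" using K' by auto
      ultimately show ?thesis using s1 by simp
    next
      case 2
      then show ?thesis using main[of K L] KL by auto
    next
      case 3
      then show ?thesis using main[of L K] KL by (auto simp: Int_commute)
    next
      case 4
      then have "K \<subseteq> I" "L \<subseteq> I" "K \<inter> L \<subseteq> I" using KL by auto
      then show ?thesis using ucl_Int[OF u] KL s0 by metis
    qed
  qed
  moreover have "sum ?g (insert z I) \<in> Z"
    using s1[of I] y by simp
  ultimately show ?thesis by (simp add: UF_def)
qed

text \<open>Restoring \<open>W\<close> wherever the merged index occurs gives a map \<open>f\<close>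
  on index sets that preserves sums and commutes with intersections. The merged element is stored at
  an old index \<open>w\<close>, so the index type does not change.\<close>

lemma UF_merge:
  assumes u: "UF Z g I" and W: "W \<subseteq> I" "w \<in> W"
  shows "UF Z (g(w := sum g W)) (insert w (I - W))"
proof -
  let ?g = "g(w := sum g W)" and ?I = "insert w (I - W)"
  define f where "f K = (if w \<in> K then K \<union> W else K)" for K
  have fin: "finite I" using u ucl_finite by (auto simp: UF_def)
  have s: "sum ?g K = sum g (f K)" and fI: "f K \<subseteq> I" if "K \<subseteq> ?I" for K
  proof -
    show "f K \<subseteq> I" using that W by (auto simp: f_def)
    show "sum ?g K = sum g (f K)"
    proof (cases "w \<in> K")
      case False
      then show ?thesis by (auto simp: f_def intro!: sum.cong)
    next
      case True
      have fK: "finite K" "finite W" using that fin W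
        by (meson finite_Diff finite_insert finite_subset)+
      have "sum ?g K = sum g W + sum ?g (K - {w})"
        using sum.remove[OF fK(1) True, of ?g] by simp
      also have "sum ?g (K - {w}) = sum g (K - {w})" by (auto intro!: sum.cong)
      also have "sum g W + sum g (K - {w}) = sum g (W \<union> (K - {w}))"
        by (rule sum.union_disjoint[symmetric]) (use fK that W in auto)
      also have "W \<union> (K - {w}) = f K" using True W by (auto simp: f_def)
      finally show ?thesis .
    qed
  qed
  have fInt: "f (K \<inter> L) = f K \<inter> f L" if "K \<subseteq> ?I" "L \<subseteq> ?I" for K L
    using that W by (auto simp: f_def)
  have "ucl Z ?g ?I"
    unfolding ucl_def
  proof (intro conjI allI impI)
    show "finite ?I" using fin by simp
    fix K L assume KL: "K \<subseteq> ?I" "L \<subseteq> ?I" "sum ?g K \<in> Z" "sum ?g L \<in> Z"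
    have "K \<inter> L \<subseteq> ?I" using KL by auto
    then have "sum ?g (K \<inter> L) = sum g (f K \<inter> f L)" using s fInt KL by simp
    moreover have "sum g (f K \<inter> f L) \<in> Z"
      using ucl_Int[of Z g I "f K" "f L"] u KL s fI by (simp add: UF_def)
    ultimately show "sum ?g (K \<inter> L) \<in> Z" by simp
  qed
  moreover have "sum ?g ?I \<in> Z"
  proof -
    have "f ?I = I" using W by (auto simp: f_def)
    then show ?thesis using s[of ?I] u by (simp add: UF_def)
  qed
  ultimately show ?thesis by (simp add: UF_def)
qed

subsection \<open>Blocks\<close>

text \<open>The empty family passes the test \<open>minimal_zero_sum\<close>, but blocks of a
  partition are nonempty; hence the first conjunct.\<close>

definition minz :: "'a::ab_group_add set \<Rightarrow> ('i \<Rightarrow> 'a) \<Rightarrow> 'i set \<Rightarrow> bool" where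
  "minz Z g B \<longleftrightarrow> B \<noteq> {} \<and> sum g B \<in> Z \<and> (\<forall>K. K \<noteq> {} \<longrightarrow> K \<subset> B \<longrightarrow> sum g K \<notin> Z)"

lemma minz_subset: "minz Z g B \<Longrightarrow> K \<subseteq> B \<Longrightarrow> sum g K \<in> Z \<Longrightarrow> K = {} \<or> K = B"
  by (auto simp: minz_def)

lemma ex_minz:
  assumes "finite K" "K \<noteq> {}" "sum g K \<in> Z"
  shows "\<exists>B\<subseteq>K. minz Z g B"
proof -
  let ?S = "{B. B \<subseteq> K \<and> B \<noteq> {} \<and> sum g B \<in> Z}"
  have "finite ?S" "?S \<noteq> {}" using assms by auto
  then obtain B where B: "B \<in> ?S" "\<forall>C\<in>?S. C \<subseteq> B \<longrightarrow> B = C"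
    using finite_has_minimal[of ?S] by meson
  then have "minz Z g B" "B \<subseteq> K" unfolding minz_def by auto
  then show ?thesis by blast
qed

lemma ex_minz_partition:
  assumes "sg Z" "finite K" "sum g K \<in> Z"
  shows "\<exists>P. partition_on K P \<and> (\<forall>B\<in>P. minz Z g B)"
  using assms(2,3)
proof (induction "card K" arbitrary: K rule: less_induct)
  case less
  show ?case
  proof (cases "K = {}")
    case True
    then show ?thesis by (intro exI[of _ "{}"]) (simp add: partition_on_def)
  next
    case False
    obtain B where B: "B \<subseteq> K" "minz Z g B" using ex_minz less False by meson
    have ne: "B \<noteq> {}" "sum g B \<in> Z" using B by (auto simp: minz_def)
    have "sum g (K - B) \<in> Z"
      using sum_Diff_sg[OF assms(1) less.prems, of B] ne(2) B(1) by (simp add: Int_absorb1)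
    moreover have "card (K - B) < card K"
      using B ne less.prems by (intro psubset_card_mono) auto
    ultimately obtain P where P: "partition_on (K - B) P" "\<forall>B\<in>P. minz Z g B"
      using less.hyps[of "K - B"] less.prems by auto
    have "partition_on K (insert B P)"
      using P ne B by (auto simp: partition_on_def disjoint_def)
    then show ?thesis using P B by auto
  qed
qed

text \<open>No factorization is chosen: closure under intersection makes the minimal zero-sum sets
  pairwise disjoint, so all of them together are the only candidate.\<close>

definition blk :: "'a::ab_group_add set \<Rightarrow> ('i \<Rightarrow> 'a) \<Rightarrow> 'i set \<Rightarrow> 'i set set" where
  "blk Z g I = {B. B \<subseteq> I \<and> minz Z g B}"

lemma partition_on_disjoint_union:
  assumes "partition_on A P" "partition_on B Q" "A \<inter> B = {}"
  shows "partition_on (A \<union> B) (P \<union> Q)"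
proof -
  have "a \<inter> b = {}" if "a \<in> P" "b \<in> Q" for a b
    using assms that by (auto simp: partition_on_def)
  then have "disjoint (P \<union> Q)"
    using assms by (intro disjoint_union) (auto simp: partition_on_def)
  then show ?thesis
    using assms by (auto simp: partition_on_def)
qed

lemma blk_sum: "B \<in> blk Z g I \<Longrightarrow> sum g B \<in> Z"
  and blk_sub: "B \<in> blk Z g I \<Longrightarrow> B \<subseteq> I"
  and blk_ne: "B \<in> blk Z g I \<Longrightarrow> B \<noteq> {}"
  by (auto simp: blk_def minz_def)

lemma blk_disjoint:
  assumes "ucl Z g I" "B \<in> blk Z g I" "C \<in> blk Z g I" "B \<noteq> C"
  shows "B \<inter> C = {}"
proof -
  have "sum g (B \<inter> C) \<in> Z"
    using assms ucl_Int blk_sum blk_sub by metis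
  then have "B \<inter> C = {} \<or> B \<inter> C = B" "B \<inter> C = {} \<or> B \<inter> C = C"
    using assms minz_subset[of Z g B "B \<inter> C"] minz_subset[of Z g C "B \<inter> C"] by (auto simp: blk_def)
  then show ?thesis using assms by auto
qed

text \<open>A factorization covers \<open>I\<close> by minimal zero-sum sets. Any further minimal
  zero-sum set would meet one of them, and then coincides with it by disjointness.\<close>

lemma blk_partition:
  assumes "sg Z" "UF Z g I"
  shows "partition_on I (blk Z g I)" and "\<And>P. partition_on I P \<Longrightarrow> \<forall>B\<in>P. minz Z g B \<Longrightarrow> P = blk Z g I"
proof -
  have u: "ucl Z g I" using assms(2) by (simp add: UF_def)
  have un: "P = blk Z g I" if P: "partition_on I P" "\<forall>B\<in>P. minz Z g B" for P
  proof
    show PB: "P \<subseteq> blk Z g I" using P by (auto simp: blk_def partition_on_def)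
    show "blk Z g I \<subseteq> P"
    proof
      fix B assume B: "B \<in> blk Z g I"
      obtain i where "i \<in> B" "i \<in> I" using blk_ne[OF B] blk_sub[OF B] by auto
      then obtain C where "C \<in> P" "i \<in> C" using P by (auto simp: partition_on_def)
      then have "B = C" using blk_disjoint[OF u B, of C] PB \<open>i \<in> B\<close> by auto
      then show "B \<in> P" using \<open>C \<in> P\<close> by simp
    qed
  qed
  obtain P where "partition_on I P" "\<forall>B\<in>P. minz Z g B"
    using ex_minz_partition[of Z I g] assms ucl_finite[OF u] by (auto simp: UF_def)
  then show "partition_on I (blk Z g I)" using un by metis
  show "\<And>P. partition_on I P \<Longrightarrow> \<forall>B\<in>P. minz Z g B \<Longrightarrow> P = blk Z g I"
    using un by blast
qed

text \<open>For the converse, factor a zero-sum set and its complement separately. Together they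
  factor \<open>I\<close>, so by uniqueness the set is a union of blocks of the one factorization,
  and unions of blocks are closed under intersection.\<close>

lemma UF_iff_unique_partition:
  assumes Z: "sg Z" and fin: "finite I"
  shows "UF Z g I \<longleftrightarrow> sum g I \<in> Z \<and> (\<exists>!P. partition_on I P \<and> (\<forall>B\<in>P. minz Z g B))"
    (is "?L \<longleftrightarrow> ?R")
proof
  assume ?L
  moreover have "\<forall>B\<in>blk Z g I. minz Z g B" by (auto simp: blk_def)
  ultimately show ?R using blk_partition[OF Z] by (metis UF_def)
next
  assume R: ?R
  then obtain P where P: "partition_on I P" "\<forall>B\<in>P. minz Z g B"
    by (blast elim: ex1E)
  have un: "Q = P" if "partition_on I Q" "\<forall>B\<in>Q. minz Z g B" for Q
    using R P that by (blast elim: ex1E)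
  have *: "\<exists>Q\<subseteq>P. K = \<Union>Q" if K: "K \<subseteq> I" "sum g K \<in> Z" for K
  proof -
    have "sum g (I - K) \<in> Z"
      using sum_Diff_sg[OF Z fin, of g K] R K by (simp add: Int_absorb1)
    then obtain Q1 Q2 where Q: "partition_on K Q1" "\<forall>B\<in>Q1. minz Z g B"
      "partition_on (I - K) Q2" "\<forall>B\<in>Q2. minz Z g B"
      using ex_minz_partition[OF Z] K fin by (metis finite_Diff finite_subset)
    have "partition_on (K \<union> (I - K)) (Q1 \<union> Q2)"
      using partition_on_disjoint_union[OF Q(1,3)] by blast
    then have "Q1 \<union> Q2 = P" using un Q K by (metis Diff_partition Un_iff)
    then show ?thesis using Q by (auto simp: partition_on_def)
  qed
  have **: "sum g (\<Union>Q) \<in> Z" if "Q \<subseteq> P" for Q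
  proof -
    have "A \<subseteq> I" if "A \<in> Q" for A using that \<open>Q \<subseteq> P\<close> P(1) by (auto simp: partition_on_def)
    then have "\<forall>A\<in>Q. finite A" using fin finite_subset by blast
    moreover have "\<forall>A\<in>Q. \<forall>B\<in>Q. A \<noteq> B \<longrightarrow> A \<inter> B = {}"
      using that P(1) unfolding partition_on_def disjoint_def by blast
    ultimately have "sum g (\<Union>Q) = (sum \<circ> sum) g Q" by (rule sum.Union_disjoint)
    also have "\<dots> \<in> Z" unfolding comp_def
      by (rule sg_sum[OF Z]) (use that P(2) in \<open>auto simp: minz_def\<close>)
    finally show ?thesis .
  qed
  have "ucl Z g I" unfolding ucl_def
  proof (intro conjI allI impI)
    fix K L assume "K \<subseteq> I" "L \<subseteq> I" "sum g K \<in> Z" "sum g L \<in> Z"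
    then obtain Q1 Q2 where Q: "Q1 \<subseteq> P" "K = \<Union>Q1" "Q2 \<subseteq> P" "L = \<Union>Q2" using * by metis
    have "K \<inter> L = \<Union>(Q1 \<inter> Q2)"
    proof
      show "K \<inter> L \<subseteq> \<Union>(Q1 \<inter> Q2)"
      proof
        fix i assume "i \<in> K \<inter> L"
        then obtain A B where "A \<in> Q1" "i \<in> A" "B \<in> Q2" "i \<in> B" using Q by auto
        moreover from this have "A = B" using P(1) Q unfolding partition_on_def disjoint_def by blast
        ultimately show "i \<in> \<Union>(Q1 \<inter> Q2)" by auto
      qed
    qed (use Q in auto)
    then show "sum g (K \<inter> L) \<in> Z" using **[of "Q1 \<inter> Q2"] Q by auto
  qed (use fin in auto)
  then show ?L using R by (simp add: UF_def)
qed

section \<open>Length bounds\<close>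

text \<open>For subgroups \<open>Z \<subseteq> D\<close>, \<open>idx Z D l\<close> says that \<open>Z\<close> has index at most \<open>l\<close> in \<open>D\<close>.\<close>

definition idx :: "'a::ab_group_add set \<Rightarrow> 'a set \<Rightarrow> nat \<Rightarrow> bool" where
  "idx Z D l \<longleftrightarrow> (\<exists>\<phi>::'a \<Rightarrow> nat. (\<forall>x\<in>D. \<phi> x < l) \<and> (\<forall>x\<in>D. \<forall>y\<in>D. \<phi> x = \<phi> y \<longrightarrow> x - y \<in> Z))"

lemma idx_card:
  assumes "idx Z D l" "finite A" "f ` A \<subseteq> D" "\<And>a b. a \<in> A \<Longrightarrow> b \<in> A \<Longrightarrow> f a - f b \<in> Z \<Longrightarrow> a = b"
  shows "card A \<le> l"
proof -
  obtain \<phi> :: "'a \<Rightarrow> nat" where \<phi>: "\<forall>x\<in>D. \<phi> x < l" "\<forall>x\<in>D. \<forall>y\<in>D. \<phi> x = \<phi> y \<longrightarrow> x - y \<in> Z"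
    using assms(1) unfolding idx_def by blast
  have "inj_on (\<phi> \<circ> f) A"
  proof (rule inj_onI)
    fix a b assume "a \<in> A" "b \<in> A" "(\<phi> \<circ> f) a = (\<phi> \<circ> f) b"
    moreover from this have "f a \<in> D" "f b \<in> D" using assms(3) by auto
    ultimately show "a = b" using assms(4) \<phi>(2) by simp
  qed
  moreover have "(\<phi> \<circ> f) ` A \<subseteq> {..<l}" using assms(3) \<phi>(1) by auto
  ultimately have "card A \<le> card {..<l}" by (metis card_inj_on_le finite_lessThan)
  then show ?thesis by simp
qed

text \<open>Fix an enumeration of every block. The sums over unions of proper initial segments of the
  blocks are pairwise incongruent, since a coincidence would give a zero-sum set that cuts a block.\<close>

lemma prod_blocks_le:
  fixes g :: "'i \<Rightarrow> 'a::ab_group_add"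
  assumes Z: "sg Z" and D: "sg D" and ix: "idx Z D l" and u: "ucl Z g I"
    and gD: "g ` I \<subseteq> D" and Bs: "Bs \<subseteq> blk Z g I"
  shows "(\<Prod>B\<in>Bs. card B) \<le> l"
proof -
  have finI: "finite I" using u by (rule ucl_finite)
  have finB: "finite B" if "B \<in> Bs" for B
    using finite_subset[OF blk_sub[OF subsetD[OF Bs that]] finI] .
  have finBs: "finite Bs"
  proof (rule finite_subset)
    show "Bs \<subseteq> Pow I" using Bs by (auto dest: blk_sub)
  qed (use finI in simp)
  have dis: "B \<inter> C = {}" if "B \<in> Bs" "C \<in> Bs" "B \<noteq> C" for B C
    using blk_disjoint[OF u] that Bs by blast
  have "\<forall>B\<in>Bs. \<exists>e. bij_betw e {..<card B} B"
  proof
    fix B assume "B \<in> Bs"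
    then show "\<exists>e. bij_betw e {..<card B} B"
      using ex_bij_betw_nat_finite[OF finB] by (simp add: atLeast0LessThan)
  qed
  then obtain e where e: "\<And>B. B \<in> Bs \<Longrightarrow> bij_betw (e B) {..<card B} B" by metis
  define seg where "seg f B = e B ` {..<f B}" for f :: "'i set \<Rightarrow> nat" and B
  define K where "K f = (\<Union>B\<in>Bs. seg f B)" for f
  \<comment> \<open>The full segment is excluded because it is congruent to the empty one.\<close>
  let ?F = "Pi\<^sub>E Bs (\<lambda>B. {..<card B})"
  have fB: "f B < card B" if "f \<in> ?F" "B \<in> Bs" for f B using that by (auto simp: PiE_iff)
  have seg_sub: "seg f B \<subset> B" if "f \<in> ?F" "B \<in> Bs" for f B
  proof -
    have "inj_on (e B) {..<card B}" "e B ` {..<card B} = B" using e[OF that(2)] by (auto simp: bij_betw_def)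
    moreover have "{..<f B} \<subset> {..<card B}" using fB[OF that] by auto
    ultimately show ?thesis unfolding seg_def by (metis inj_on_image_eq_iff psubset_eq image_mono order_refl)
  qed
  have seg_card: "card (seg f B) = f B" if "f \<in> ?F" "B \<in> Bs" for f B
  proof -
    have "inj_on (e B) {..<f B}" using e[OF that(2)] fB[OF that]
      by (auto simp: bij_betw_def intro: inj_on_subset)
    then show ?thesis unfolding seg_def by (simp add: card_image)
  qed
  have KB: "K f \<inter> B = seg f B" if "f \<in> ?F" "B \<in> Bs" for f B
    using seg_sub[OF that(1)] that(2) dis unfolding K_def by fast
  have KI: "K f \<subseteq> I" if "f \<in> ?F" for f
    using seg_sub[OF that] Bs blk_sub unfolding K_def by fast
  have inj: "f = f'" if f: "f \<in> ?F" "f' \<in> ?F" and Zd: "sum g (K f) - sum g (K f') \<in> Z" for f f'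
  proof -
    define X where "X = K f - K f'"
    define Y where "Y = K f' - K f"
    have XI: "X \<subseteq> I" "Y \<subseteq> I" using KI f by (auto simp: X_def Y_def)
    have finX: "finite X" "finite Y" using XI finI finite_subset by auto
    have "sum g (K f) - sum g (K f') = sum g X - sum g Y"
    proof -
      have "finite (K f)" "finite (K f')" using KI f finI finite_subset by blast+
      then have "sum g (K f) = sum g (K f \<inter> K f') + sum g X" "sum g (K f') = sum g (K f' \<inter> K f) + sum g Y"
        unfolding X_def Y_def by (simp_all add: sum.Int_Diff)
      then show ?thesis by (simp add: Int_commute)
    qed
    then have XY: "sum g X - sum g Y \<in> Z" using Zd by simp
    have nest: "seg f B \<subseteq> seg f' B \<or> seg f' B \<subseteq> seg f B" for B
      unfolding seg_def by (metis image_mono lessThan_subset_iff nle_le)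
    define Cs where "Cs = {B\<in>Bs. Y \<inter> B \<noteq> {}}"
    have XC: "X \<inter> B = {}" if "B \<in> Cs" for B
    proof -
      have "B \<in> Bs" "Y \<inter> B \<noteq> {}" using that by (auto simp: Cs_def)
      moreover have "X \<inter> B = K f \<inter> B - K f' \<inter> B" "Y \<inter> B = K f' \<inter> B - K f \<inter> B"
        by (auto simp: X_def Y_def)
      ultimately show ?thesis using KB[OF f(1)] KB[OF f(2)] nest[of B] by auto
    qed
    have Ysub: "Y \<subseteq> \<Union>Cs"
    proof
      fix i assume "i \<in> Y"
      then have "i \<in> K f'" by (auto simp: Y_def)
      then obtain B where "B \<in> Bs" "i \<in> seg f' B" by (auto simp: K_def)
      then show "i \<in> \<Union>Cs" using seg_sub[OF f(2)] \<open>i \<in> Y\<close> by (auto simp: Cs_def)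
    qed
    have finCs: "finite Cs" using finBs by (simp add: Cs_def)
    have "sum g (\<Union>Cs) = (sum \<circ> sum) g Cs"
      by (rule sum.Union_disjoint) (use finB dis in \<open>auto simp: Cs_def\<close>)
    also have "\<dots> \<in> Z" unfolding comp_def
      by (rule sg_sum[OF Z], rule blk_sum[of _ Z g I]) (use Bs in \<open>auto simp: Cs_def\<close>)
    finally have UC: "sum g (\<Union>Cs) \<in> Z" .
    \<comment> \<open>Subtracting \<open>Y\<close> is replaced by adding its complement in the
      blocks that it meets. Segments of one block are nested, so \<open>X\<close> avoids these
      blocks; thus \<open>W\<close> is a zero-sum set and cannot cut a block.\<close>
    define W where "W = X \<union> (\<Union>Cs - Y)"
    have UCI: "\<Union>Cs \<subseteq> I" using Bs blk_sub by (fastforce simp: Cs_def)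
    have finU: "finite (\<Union>Cs)" using UCI finI finite_subset by blast
    have "sum g W = sum g X + sum g (\<Union>Cs - Y)"
      unfolding W_def by (rule sum.union_disjoint) (use finX finU XC in auto)
    also have "sum g (\<Union>Cs - Y) = sum g (\<Union>Cs) - sum g Y"
      using sum_diff[OF finU Ysub] .
    finally have "sum g W = (sum g X - sum g Y) + sum g (\<Union>Cs)" by simp
    then have WZ: "sum g W \<in> Z" using XY UC sg_add[OF Z] by metis
    have WI: "W \<subseteq> I" using XI UCI by (auto simp: W_def)
    have WB: "W \<inter> B = {} \<or> W \<inter> B = B" if B: "B \<in> Bs" for B
    proof -
      have "B \<in> blk Z g I" using B Bs by auto
      then have "sum g (W \<inter> B) \<in> Z" by (intro ucl_Int[OF u WI _ WZ] blk_sum blk_sub)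
      then show ?thesis using minz_subset[of Z g B "W \<inter> B"] B Bs by (auto simp: blk_def)
    qed
    have Cempty: "Cs = {}"
    proof (rule ccontr)
      assume "Cs \<noteq> {}"
      then obtain B where B: "B \<in> Cs" by auto
      then have BB: "B \<in> Bs" "Y \<inter> B \<noteq> {}" by (auto simp: Cs_def)
      have "W \<inter> B = B - Y"
        using B XC[OF B] by (auto simp: W_def)
      then have "B \<subseteq> Y" using WB[OF BB(1)] BB(2) by auto
      then have "B \<subseteq> seg f' B" using KB[OF f(2) BB(1)] by (auto simp: Y_def)
      then show False using seg_sub[OF f(2) BB(1)] by auto
    qed
    then have Y0: "Y = {}" using Ysub by auto
    have X0: "X = {}"
    proof (rule ccontr)
      assume "X \<noteq> {}"
      then obtain i where i: "i \<in> X" by auto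
      then have "i \<in> K f" by (auto simp: X_def)
      then obtain B where B: "B \<in> Bs" "i \<in> seg f B" by (auto simp: K_def)
      have "i \<in> B" using B seg_sub[OF f(1)] by auto
      then have "W \<inter> B \<noteq> {}" using i by (auto simp: W_def)
      then have "B \<subseteq> X" using WB[OF B(1)] Cempty by (auto simp: W_def)
      then have "B \<subseteq> seg f B" using KB[OF f(1) B(1)] by (auto simp: X_def)
      then show False using seg_sub[OF f(1) B(1)] by auto
    qed
    have "K f = K f'" using X0 Y0 by (auto simp: X_def Y_def)
    then have "f B = f' B" if "B \<in> Bs" for B
      using KB f that seg_card by metis
    then show "f = f'" using f by (auto intro: PiE_ext)
  qed
  have "card ?F \<le> l"
  proof (rule idx_card[OF ix])
    show "finite ?F" using finBs by (simp add: finite_PiE)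
    show "(\<lambda>f. sum g (K f)) ` ?F \<subseteq> D"
      using KI gD by (auto intro!: sg_sum[OF D])
  qed (use inj in auto)
  then show ?thesis using finBs by (simp add: card_PiE)
qed

section \<open>From block sizes to the length\<close>

lemma sum_le_prod_ge2:
  fixes f :: "'b \<Rightarrow> nat"
  assumes "finite A" "\<And>a. a \<in> A \<Longrightarrow> 2 \<le> f a"
  shows "sum f A \<le> prod f A"
  using assms
proof (induction A rule: finite_induct)
  case (insert x F)
  show ?case
  proof (cases "F = {}")
    case False
    have "2 \<le> prod f F"
    proof -
      obtain y where "y \<in> F" using False by auto
      have "1 \<le> prod f (F - {y})" using insert by (intro prod_ge_1) force
      moreover have "2 \<le> f y" using insert \<open>y \<in> F\<close> by auto
      ultimately have "2 * 1 \<le> f y * prod f (F - {y})" by (intro mult_mono) auto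
      then show ?thesis using prod.remove[of F y f] insert \<open>y \<in> F\<close> by simp
    qed
    moreover have "2 \<le> f x" "sum f F \<le> prod f F" using insert by auto
    ultimately have "f x + prod f F \<le> f x * prod f F"
    proof -
      obtain a b where ab: "f x = a + 2" "prod f F = b + 2"
        using \<open>2 \<le> f x\<close> \<open>2 \<le> prod f F\<close> by (metis add.commute le_Suc_ex)
      show ?thesis unfolding ab by (simp add: algebra_simps)
    qed
    then show ?thesis using insert \<open>sum f F \<le> prod f F\<close> by simp
  qed simp
qed simp

lemma blk_card_ge2:
  assumes "ucl Z g I" "g ` I \<inter> Z = {}" "B \<in> blk Z g I"
  shows "2 \<le> card B"
proof -
  have "finite B" "B \<noteq> {}" using assms blk_sub[OF assms(3)] blk_ne[OF assms(3)] ucl_finite finite_subset by blast+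
  moreover have "card B \<noteq> 1"
  proof
    assume "card B = 1"
    then obtain i where "B = {i}" by (auto simp: card_1_singleton_iff)
    then have "g i \<in> Z" "i \<in> I" using blk_sum[OF assms(3)] blk_sub[OF assms(3)] by auto
    then show False using assms(2) by auto
  qed
  moreover have "card B \<noteq> 0" using calculation by simp
  ultimately show ?thesis by linarith
qed

text \<open>Families indexed by naturals suffice: \<open>bndD\<close> transfers the bound to all index types.\<close>

definition bnd :: "'a::ab_group_add set \<Rightarrow> 'a set \<Rightarrow> ('a \<Rightarrow> real) \<Rightarrow> real \<Rightarrow> bool" where
  "bnd Z D w \<kappa> \<longleftrightarrow> (\<forall>(I::nat set) g. UF Z g I \<longrightarrow> g ` I \<subseteq> D - Z \<longrightarrow> (\<Sum>i\<in>I. w (g i)) \<le> \<kappa>)"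

lemma bndD:
  fixes g :: "'i \<Rightarrow> 'a::ab_group_add"
  assumes "bnd Z D w \<kappa>" "UF Z g I" "g ` I \<subseteq> D - Z"
  shows "(\<Sum>i\<in>I. w (g i)) \<le> \<kappa>"
proof -
  have "finite I" using assms ucl_finite by (auto simp: UF_def)
  then obtain f where f: "bij_betw f {..<card I} I"
    using ex_bij_betw_nat_finite[of I] by (auto simp: atLeast0LessThan)
  then have inj: "inj_on f {..<card I}" and im: "f ` {..<card I} = I" by (auto simp: bij_betw_def)
  have "UF Z (g \<circ> f) {..<card I}" using UF_reindex[OF inj, of Z g] im assms by simp
  moreover have "(g \<circ> f) ` {..<card I} \<subseteq> D - Z" using assms im by (metis image_comp)
  ultimately have "(\<Sum>i<card I. w ((g \<circ> f) i)) \<le> \<kappa>" using assms(1) unfolding bnd_def by blast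
  then show ?thesis using sum.reindex[OF inj, of "\<lambda>i. w (g i)"] im by simp
qed

lemma bnd_card:
  assumes "bnd Z D (\<lambda>_. 1) (real N)" "UF Z g I" "g ` I \<subseteq> D - Z"
  shows "card I \<le> N"
  using bndD[OF assms] by simp

text \<open>The length is the sum of the block sizes. These are at least 2, as no element lies in
  \<open>Z\<close>, so their sum is at most their product, which is bounded by the index.\<close>

lemma bnd_length_idx:
  assumes Z: "sg Z" and D: "sg D" and ix: "idx Z D l"
  shows "bnd Z D (\<lambda>_. 1) (real l)"
  unfolding bnd_def
proof (intro allI impI)
  fix I :: "nat set" and g assume u: "UF Z g I" and gD: "g ` I \<subseteq> D - Z"
  have uc: "ucl Z g I" using u by (simp add: UF_def)
  have part: "partition_on I (blk Z g I)" by (rule blk_partition(1)[OF Z u])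
  have fin: "finite I" using uc by (rule ucl_finite)
  have fB: "finite (blk Z g I)" using part fin finite_elements by blast
  have "card I = sum card (blk Z g I)"
  proof -
    have "pairwise disjnt (blk Z g I)" "\<Union>(blk Z g I) = I"
      using part by (auto simp: partition_on_def disjoint_def pairwise_def disjnt_def)
    moreover have "finite B" if "B \<in> blk Z g I" for B
      using blk_sub[OF that] fin finite_subset by blast
    ultimately show ?thesis using card_Union_disjoint[of "blk Z g I"] by simp
  qed
  also have "\<dots> \<le> prod card (blk Z g I)"
    using fB blk_card_ge2[OF uc] gD by (intro sum_le_prod_ge2) auto
  also have "\<dots> \<le> l"
    using prod_blocks_le[OF Z D ix uc] gD by blast
  finally show "(\<Sum>i\<in>I. (1::real)) \<le> real l" by simp
qed

text \<open>Completing a family with nonzero total costs one index.\<close>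

lemma bnd_ucl:
  fixes g :: "'i \<Rightarrow> 'a::ab_group_add"
  assumes Z: "sg Z" and D: "sg D" "Z \<subseteq> D" and b: "bnd Z D w \<kappa>" and w: "\<And>x. 0 \<le> w x"
    and u: "ucl Z g I" and gD: "g ` I \<subseteq> D - Z"
  shows "(\<Sum>i\<in>I. w (g i)) \<le> \<kappa>"
proof (cases "sum g I \<in> Z")
  case True
  then show ?thesis using bndD[OF b _ gD] u by (simp add: UF_def)
next
  case False
  \<comment> \<open>The value at \<open>None\<close> is a placeholder, overwritten below by the
    completing element.\<close>
  define h :: "'i option \<Rightarrow> 'a" where "h = case_option 0 g"
  have u': "ucl Z h (Some ` I)"
  proof -
    have "sum h (Some ` K) = sum g K" for K
      by (subst sum.reindex) (auto simp: h_def)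
    then show ?thesis
      using u unfolding ucl_def
      by (smt (verit) finite_imageI image_Int inj_Some subset_image_iff)
  qed
  have "UF Z (h(None := - sum g I)) (insert None (Some ` I))"
    by (rule ucl_complete[OF Z u']) (auto simp: sum.reindex h_def sg_zero[OF Z])
  moreover have "(h(None := - sum g I)) ` insert None (Some ` I) \<subseteq> D - Z"
  proof -
    have "sum g I \<in> D" using gD by (intro sg_sum[OF D(1)]) auto
    then show ?thesis using gD False sg_minus[OF D(1)] sg_minus_iff[OF Z] by (auto simp: h_def)
  qed
  ultimately have "(\<Sum>i\<in>insert None (Some ` I). w ((h(None := - sum g I)) i)) \<le> \<kappa>"
    by (rule bndD[OF b])
  moreover have "(\<Sum>i\<in>Some ` I. w ((h(None := - sum g I)) i)) = (\<Sum>i\<in>I. w (g i))"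
    by (subst sum.reindex) (auto simp: h_def)
  ultimately show ?thesis using w[of "- sum g I"] ucl_finite[OF u] by (simp add: image_iff)
qed

text \<open>If some \<open>x\<close> is not congruent to a subset sum, the family extends by two indices: one carries
  \<open>-x\<close>, the other the element completing the total to zero.\<close>

lemma subset_sums_or_short:
  fixes g :: "'i \<Rightarrow> 'a::ab_group_add"
  assumes Z: "sg Z" and D: "sg D" "Z \<subseteq> D" and b: "bnd Z D (\<lambda>_. 1) (real N)"
    and u: "ucl Z g I" and gD: "g ` I \<subseteq> D - Z"
    and x: "x \<in> D" "\<And>K. K \<subseteq> I \<Longrightarrow> x - sum g K \<notin> Z"
  shows "card I + 2 \<le> N"
proof -
  define h :: "'i + unit \<Rightarrow> 'a" where "h = case_sum g (\<lambda>_. - x)"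
  let ?J = "insert (Inr ()) (Inl ` I)"
  have fin: "finite I" using u by (rule ucl_finite)
  have s0: "sum h (Inl ` K) = sum g K" for K
    by (subst sum.reindex) (auto simp: h_def)
  \<comment> \<open>A zero-sum set using the index of \<open>-x\<close> would exhibit
    \<open>x\<close> as a subset sum; so the zero-sum sets are the old ones.\<close>
  have Inl: "\<exists>K'\<subseteq>I. K = Inl ` K' \<and> sum h K = sum g K'" if K: "K \<subseteq> ?J" "sum h K \<in> Z" for K
  proof -
    have "Inr () \<notin> K"
    proof
      assume "Inr () \<in> K"
      then obtain K' where K': "K' \<subseteq> I" "K = insert (Inr ()) (Inl ` K')"
        using K by (metis Diff_insert_absorb insert_Diff subset_imageE subset_insert_iff)
      then have "sum h K = - x + sum g K'"
        using fin s0 finite_subset[of K' I] by (simp add: image_iff h_def)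
      then have "- (x - sum g K') \<in> Z" using K by simp
      then show False using x(2)[OF K'(1)] sg_minus_iff[OF Z] by blast
    qed
    then have "K \<subseteq> Inl ` I" using K by auto
    then obtain K' where "K' \<subseteq> I" "K = Inl ` K'" by (meson subset_imageE)
    then show ?thesis using s0 by blast
  qed
  have uh: "ucl Z h ?J" unfolding ucl_def
  proof (intro conjI allI impI)
    fix K L assume "K \<subseteq> ?J" "L \<subseteq> ?J" "sum h K \<in> Z" "sum h L \<in> Z"
    then obtain K' L' where KL: "K' \<subseteq> I" "K = Inl ` K'" "sum g K' \<in> Z" "L' \<subseteq> I" "L = Inl ` L'" "sum g L' \<in> Z"
      using Inl by metis
    then have "K \<inter> L = Inl ` (K' \<inter> L')" by auto
    then show "sum h (K \<inter> L) \<in> Z" using KL s0 ucl_Int[OF u, of K' L'] by simp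
  qed (use fin in simp)
  have tot: "sum h ?J = sum g I - x"
    using fin s0[of I] by (simp add: image_iff h_def)
  \<comment> \<open>The empty and the full index set in the hypothesis on \<open>x\<close> show that
    neither of the two new elements lies in \<open>Z\<close>.\<close>
  have xZ: "x \<notin> Z" using x(2)[of "{}"] by simp
  have "sum h ?J \<notin> Z"
    using tot x(2)[of I] sg_diff_commute[OF Z, of "sum g I" x] by simp
  have sSome: "sum (case_option 0 h) (Some ` K) = sum h K" for K
    by (subst sum.reindex) auto
  have u': "ucl Z (case_option 0 h) (Some ` ?J)"
    using uh sSome unfolding ucl_def
    by (smt (verit) finite_imageI image_Int inj_Some subset_image_iff)
  have "UF Z ((case_option 0 h)(None := - sum h ?J)) (insert None (Some ` ?J))"
    by (rule ucl_complete[OF Z u']) (simp_all add: sSome sg_zero[OF Z] image_iff del: image_insert)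
  moreover have "((case_option 0 h)(None := - sum h ?J)) ` insert None (Some ` ?J) \<subseteq> D - Z"
  proof -
    have "sum g I \<in> D" using gD by (intro sg_sum[OF D(1)]) auto
    then have "sum h ?J \<in> D" using tot x(1) sg_diff[OF D(1)] by simp
    moreover have "h j \<in> D - Z" if "j \<in> ?J" for j
      using that gD x(1) xZ sg_minus[OF D(1)] sg_minus_iff[OF Z] by (auto simp: h_def)
    ultimately show ?thesis using \<open>sum h ?J \<notin> Z\<close> sg_minus[OF D(1)] sg_minus_iff[OF Z] by auto
  qed
  ultimately have "card (insert None (Some ` ?J)) \<le> N" by (rule bnd_card[OF b])
  moreover have "card (insert None (Some ` ?J)) = card I + 2"
    using fin by (simp add: image_iff card_image del: image_insert)
  ultimately show ?thesis by simp
qed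

section \<open>Orders modulo a subgroup\<close>

definition nmul :: "nat \<Rightarrow> 'a::ab_group_add \<Rightarrow> 'a" where
  "nmul n x = (\<Sum>i<n. x)"

lemma nmul_0 [simp]: "nmul 0 x = 0"
  and nmul_Suc: "nmul (Suc n) x = x + nmul n x"
  by (simp_all add: nmul_def)

lemma nmul_1 [simp]: "nmul (Suc 0) x = x"
  by (simp add: nmul_def)

lemma nmul_add: "nmul (m + n) x = nmul m x + nmul n x"
  by (induction m) (simp_all add: nmul_Suc algebra_simps)

lemma nmul_mult: "nmul (m * n) x = nmul m (nmul n x)"
  by (induction m) (simp_all add: nmul_Suc nmul_add)

lemma nmul_plus: "nmul n (x + y) = nmul n x + nmul n y"
  by (simp add: nmul_def sum.distrib)

lemma nmul_minus: "nmul n (- x) = - nmul n x"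
  by (simp add: nmul_def sum_negf)

lemma nmul_zero [simp]: "nmul n 0 = 0"
  by (simp add: nmul_def)

lemma nmul_diff: "nmul n (x - y) = nmul n x - nmul n y"
  by (metis nmul_plus nmul_minus ab_group_add_class.ab_diff_conv_add_uminus)

lemma nmul_sum: "nmul n (sum g K) = (\<Sum>i\<in>K. nmul n (g i))"
  unfolding nmul_def by (rule sum.swap)

lemma sg_nmul: "sg Z \<Longrightarrow> x \<in> Z \<Longrightarrow> nmul n x \<in> Z"
  by (induction n) (simp_all add: nmul_Suc sg_zero sg_add)

definition tor :: "'a::ab_group_add set \<Rightarrow> nat \<Rightarrow> 'a set" where
  "tor Z n = {x. nmul n x \<in> Z}"

lemma sg_tor: "sg Z \<Longrightarrow> sg (tor Z n)"
  unfolding tor_def sg_def by (auto simp: nmul_plus nmul_minus)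

lemma tor_1 [simp]: "tor Z (Suc 0) = Z"
  by (simp add: tor_def)

lemma tor_dvd: "sg Z \<Longrightarrow> m dvd n \<Longrightarrow> tor Z m \<subseteq> tor Z n"
  unfolding tor_def by (auto elim!: dvdE simp: nmul_mult[of _ m] mult.commute sg_nmul)

lemma sub_tor: "sg Z \<Longrightarrow> Z \<subseteq> tor Z n"
  by (auto simp: tor_def sg_nmul)

text \<open>The order of the coset of \<open>x\<close>. It is meaningful only if some positive
  multiple lies in \<open>Z\<close>, which membership in some \<open>tor Z N\<close> with
  \<open>0 < N\<close> provides.\<close>

definition oz :: "'a::ab_group_add set \<Rightarrow> 'a \<Rightarrow> nat" where
  "oz Z x = (LEAST n. 0 < n \<and> nmul n x \<in> Z)"

lemma oz_pos:
  assumes "x \<in> tor Z N" "0 < N"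
  shows "0 < oz Z x" and "nmul (oz Z x) x \<in> Z"
  using LeastI[of "\<lambda>n. 0 < n \<and> nmul n x \<in> Z" N] assms by (auto simp: oz_def tor_def)

lemma oz_dvd:
  assumes Z: "sg Z" and N: "x \<in> tor Z N" "0 < N"
  shows "x \<in> tor Z n \<longleftrightarrow> oz Z x dvd n"
proof
  note o = oz_pos[OF N]
  assume "x \<in> tor Z n"
  have "nmul n x = nmul (n div oz Z x) (nmul (oz Z x) x) + nmul (n mod oz Z x) x"
    by (metis div_mult_mod_eq nmul_add nmul_mult)
  then have "nmul (n mod oz Z x) x \<in> Z"
    using \<open>x \<in> tor Z n\<close> sg_add_iff1[OF Z sg_nmul[OF Z o(2)]] by (simp add: tor_def)
  moreover have "\<not> (0 < n mod oz Z x \<and> nmul (n mod oz Z x) x \<in> Z)"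
    using not_less_Least[of "n mod oz Z x" "\<lambda>n. 0 < n \<and> nmul n x \<in> Z"] o(1) by (simp add: oz_def)
  ultimately show "oz Z x dvd n" by (simp add: dvd_eq_mod_eq_0)
next
  assume "oz Z x dvd n"
  moreover have "x \<in> tor Z (oz Z x)" using oz_pos[OF N] by (simp add: tor_def)
  ultimately show "x \<in> tor Z n" using tor_dvd[OF Z] by blast
qed

lemma tor_coprime:
  assumes Z: "sg Z" and "coprime a b" "0 < a" "x \<in> tor Z a" "x \<in> tor Z b"
  shows "x \<in> Z"
proof -
  have "oz Z x dvd a" "oz Z x dvd b" using oz_dvd[OF Z] assms by blast+
  then have "oz Z x dvd 1" using assms(2) coprime_common_divisor by blast
  then show ?thesis using oz_dvd[OF Z assms(4,3), of 1] by simp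
qed

definition wz :: "'a::ab_group_add set \<Rightarrow> 'a \<Rightarrow> real" where
  "wz Z x = 1 / real (oz Z x)"

lemma wz_nonneg: "0 \<le> wz Z x"
  by (simp add: wz_def)

lemma wz_ge: "sg Z \<Longrightarrow> x \<in> tor Z n \<Longrightarrow> 0 < n \<Longrightarrow> 1 / real n \<le> wz Z x"
  unfolding wz_def using oz_dvd[of Z x n n] oz_pos[of x Z n] dvd_imp_le[of "oz Z x" n]
  by (simp add: frac_le)

text \<open>Multiplication by \<open>c\<close> pulls \<open>tor Z a\<close> and
  \<open>tor Z b\<close> back to \<open>tor Z (a * c)\<close> and \<open>tor Z (b * c)\<close>, and
  the index of a preimage cannot grow.\<close>

lemma idx_mult:
  assumes "idx (tor Z a) (tor Z b) l"
  shows "idx (tor Z (a * c)) (tor Z (b * c)) l"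
proof -
  obtain \<phi> :: "'a \<Rightarrow> nat" where \<phi>: "\<forall>x\<in>tor Z b. \<phi> x < l"
    "\<forall>x\<in>tor Z b. \<forall>y\<in>tor Z b. \<phi> x = \<phi> y \<longrightarrow> x - y \<in> tor Z a"
    using assms unfolding idx_def by blast
  have t: "x \<in> tor Z (n * c) \<longleftrightarrow> nmul c x \<in> tor Z n" for x n
    by (simp add: tor_def nmul_mult)
  show ?thesis unfolding idx_def t
    using \<phi> by (intro exI[of _ "\<lambda>x. \<phi> (nmul c x)"]) (auto simp: t nmul_diff)
qed

text \<open>Pigeonhole on the \<open>l + 1\<close> sums over the initial segments of lengths 0 to
  \<open>l\<close> of an enumeration; the gap between two congruent ones has at most
  \<open>l\<close> members and is therefore a proper subset of \<open>W\<close>.\<close>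

lemma short_subset_sum:
  assumes ix: "idx Z D l" and Z: "sg Z" and D: "sg D" and W: "finite W" "g ` W \<subseteq> D" "l < card W"
  shows "\<exists>V\<subset>W. V \<noteq> {} \<and> sum g V \<in> Z"
proof -
  obtain e where e: "bij_betw e {..<card W} W"
    using ex_bij_betw_nat_finite[OF W(1)] by (auto simp: atLeast0LessThan)
  define s where "s k = sum g (e ` {..<k})" for k
  have inj: "inj_on e {..<card W}" and im: "e ` {..<card W} = W" using e by (auto simp: bij_betw_def)
  have eW: "e ` {..<k} \<subseteq> W" if "k \<le> l" for k
    using that W(3) im by (metis image_mono lessThan_subset_iff less_imp_le_nat order_trans)
  have "\<not> card {..l} \<le> l" by simp
  then have "\<not> (\<forall>a\<in>{..l}. \<forall>b\<in>{..l}. s a - s b \<in> Z \<longrightarrow> a = b)"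
  proof -
    have "s k \<in> D" if "k \<le> l" for k
      unfolding s_def by (rule sg_sum[OF D]) (use eW[OF that] W(2) in auto)
    then have "s ` {..l} \<subseteq> D" by auto
    then show ?thesis using idx_card[OF ix finite_atMost, of s l] \<open>\<not> card {..l} \<le> l\<close> by blast
  qed
  then obtain a b where ab: "a \<le> l" "b \<le> l" "a \<noteq> b" "s a - s b \<in> Z" by auto
  have *: "\<exists>V\<subset>W. V \<noteq> {} \<and> (sum g V = s b - s a)" if "a < b" "b \<le> l" for a b
  proof -
    let ?V = "e ` {a..<b}"
    have "b < card W" using that(2) W(3) by linarith
    then have "{a..<b} \<subseteq> {..<card W}" "b \<in> {..<card W}" "b \<notin> {a..<b}" by auto
    then have sub: "{a..<b} \<subset> {..<card W}" by blast
    have "?V \<noteq> W" using inj_on_image_eq_iff[OF inj, of "{a..<b}" "{..<card W}"] sub im by auto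
    moreover have "?V \<subseteq> W" using sub im by (metis image_mono psubset_imp_subset)
    ultimately have "?V \<subset> W" by auto
    moreover have "?V \<noteq> {}" using that by auto
    moreover have "s b = s a + sum g ?V"
    proof -
      have "{..<b} = {..<a} \<union> {a..<b}" using that by auto
      then have "e ` {..<b} = e ` {..<a} \<union> ?V" by (simp add: image_Un)
      moreover have "e ` {..<a} \<inter> ?V = {}"
      proof -
        have "e ` ({..<a} \<inter> {a..<b}) = e ` {..<a} \<inter> ?V"
          by (rule inj_on_image_Int[OF inj]) (use that W(3) in auto)
        moreover have "{..<a} \<inter> {a..<b} = {}" by auto
        ultimately show ?thesis by simp
      qed
      ultimately show ?thesis unfolding s_def by (simp add: sum.union_disjoint)
    qed
    ultimately show ?thesis by (intro exI[of _ ?V]) simp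
  qed
  from ab(3) consider "a < b" | "b < a" by linarith
  then show ?thesis
  proof cases
    case 1
    then show ?thesis using *[OF 1 ab(2)] ab(4) sg_diff_commute[OF Z] by metis
  next
    case 2
    then show ?thesis using *[OF 2 ab(1)] ab(4) by metis
  qed
qed

section \<open>Merging elements of equal order\<close>

text \<open>Replacing a minimal family \<open>W\<close> of elements of order \<open>l * n\<close> with nonzero sum killed by \<open>n\<close>
  by its sum does not decrease the cross number, because \<open>W\<close> has at most \<open>l\<close> elements.\<close>

lemma merge_class:
  fixes g :: "'i \<Rightarrow> 'a::ab_group_add"
  assumes Z: "sg Z" and n: "0 < n" and l: "2 \<le> l"
    and ix: "idx (tor Z n) (tor Z (l * n)) l"
    and u: "UF Z g I" and gN: "g ` I \<subseteq> tor Z N" "0 < N"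
    and C: "C = {i\<in>I. oz Z (g i) = l * n}"
  shows "real (card C) \<le> real l \<and> (\<forall>W\<subseteq>C. sum g W \<in> tor Z n \<longrightarrow> sum g W \<in> Z) \<or>
    (\<exists>W w. W \<subseteq> C \<and> w \<in> W \<and> sum g W \<in> tor Z n - Z \<and> card (insert w (I - W)) < card I \<and>
      (\<Sum>i\<in>I. wz Z (g i)) \<le> (\<Sum>i\<in>insert w (I - W). wz Z ((g(w := sum g W)) i)))"
proof (cases "\<forall>W\<subseteq>C. sum g W \<in> tor Z n \<longrightarrow> sum g W \<in> Z")
  case True
  have uc: "ucl Z g I" using u by (simp add: UF_def)
  have "C \<subseteq> I" by (auto simp: C)
  then have uC: "ucl Z g C" "finite C" using ucl_subset[OF uc] ucl_finite by blast+
  \<comment> \<open>If no merge is possible, zero sums modulo \<open>tor Z n\<close> within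
    \<open>C\<close> are zero sums modulo \<open>Z\<close>. So \<open>C\<close> keeps its closure in
    a quotient of order at most \<open>l\<close>, where the length bound applies.\<close>
  have "ucl (tor Z n) g C" unfolding ucl_def
  proof (intro conjI allI impI)
    fix K L assume "K \<subseteq> C" "L \<subseteq> C" "sum g K \<in> tor Z n" "sum g L \<in> tor Z n"
    then have "sum g (K \<inter> L) \<in> Z" using True ucl_Int[OF uC(1), of K L] by blast
    then show "sum g (K \<inter> L) \<in> tor Z n" using sub_tor[OF Z] by blast
  qed (rule uC(2))
  moreover have "g ` C \<subseteq> tor Z (l * n) - tor Z n"
  proof
    fix x assume "x \<in> g ` C"
    then obtain i where i: "x = g i" "i \<in> I" "oz Z x = l * n" by (auto simp: C)
    then have "x \<in> tor Z N" using gN by auto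
    moreover have "\<not> l * n dvd n"
      using n l by (auto dest: dvd_imp_le)
    ultimately show "x \<in> tor Z (l * n) - tor Z n" using oz_dvd[OF Z _ gN(2), of x] i by auto
  qed
  moreover have "bnd (tor Z n) (tor Z (l * n)) (\<lambda>_. 1) (real l)"
    using bnd_length_idx[OF sg_tor[OF Z] sg_tor[OF Z] ix] .
  moreover have "tor Z n \<subseteq> tor Z (l * n)" using tor_dvd[OF Z] by simp
  ultimately have "(\<Sum>i\<in>C. (1::real)) \<le> real l"
    using bnd_ucl[OF sg_tor[OF Z] sg_tor[OF Z], of n "l * n" "\<lambda>_. 1" "real l" g C] by simp
  then show ?thesis using True by simp
next
  case False
  let ?P = "\<lambda>W. W \<subseteq> C \<and> sum g W \<in> tor Z n - Z"
  have fin: "finite I" using u ucl_finite by (auto simp: UF_def)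
  then have finC: "finite C" by (simp add: C)
  \<comment> \<open>A merging set of least size: its minimality bounds its size by
    \<open>l\<close>.\<close>
  obtain W where W: "?P W" and min: "\<And>V. ?P V \<Longrightarrow> card W \<le> card V"
    using False by (metis DiffI ex_has_least_nat[of ?P _ card])
  have finW: "finite W" using W finC finite_subset by blast
  have oC: "oz Z (g i) = l * n" "i \<in> I" if "i \<in> C" for i using that by (auto simp: C)
  have gC: "g ` C \<subseteq> tor Z (l * n)"
  proof
    fix x assume "x \<in> g ` C"
    then obtain i where i: "x = g i" "i \<in> I" "oz Z x = l * n" by (auto simp: C)
    then have "x \<in> tor Z N" using gN by auto
    then show "x \<in> tor Z (l * n)" using oz_dvd[OF Z _ gN(2), of x] i by auto
  qed
  \<comment> \<open>A larger \<open>W\<close> has a proper part \<open>V\<close> with sum in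
    \<open>tor Z n\<close>. The sums over \<open>V\<close> and \<open>W - V\<close> cannot both lie
    in \<open>Z\<close>, so one of the two is a smaller merging set.\<close>
  have cardW: "card W \<le> l"
  proof (rule ccontr)
    assume "\<not> card W \<le> l"
    then obtain V where V: "V \<subset> W" "V \<noteq> {}" "sum g V \<in> tor Z n"
      using short_subset_sum[OF ix sg_tor[OF Z] sg_tor[OF Z] finW, of g] W gC by (auto simp: image_subset_iff)
    have cV: "card V < card W" using V finW by (simp add: psubset_card_mono)
    have VC: "V \<subseteq> C" using V W by auto
    show False
    proof (cases "sum g V \<in> Z")
      case False
      then show False using min[of V] V VC cV by auto
    next
      case True
      have split: "sum g W = sum g V + sum g (W - V)"
        using sum.subset_diff[of V W g] V finW by (simp add: add.commute)
      then have "sum g (W - V) \<notin> Z" using W True sg_add_iff1[OF Z True] by auto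
      moreover have "sum g (W - V) \<in> tor Z n"
        using split W V sg_add_iff1[OF sg_tor[OF Z] V(3)] by auto
      moreover have "card (W - V) < card W"
        using V finW by (intro psubset_card_mono) auto
      ultimately show False using min[of "W - V"] W by auto
    qed
  qed
  have "W \<noteq> {}" using W sg_zero[OF Z] by auto
  then obtain w where w: "w \<in> W" by auto
  \<comment> \<open>A single element of order \<open>l * n\<close> is not killed by
    \<open>n\<close>. Hence \<open>W\<close> has two elements and merging really shrinks the family,
    which makes the inductions on its size work.\<close>
  have "card W \<noteq> 1"
  proof
    assume "card W = 1"
    then have "W = {w}" using w by (auto simp: card_1_singleton_iff)
    then have "g w \<in> tor Z n" "w \<in> C" using W by auto
    then have "l * n dvd n"
      using oz_dvd[OF Z, of "g w" N n] oC gN by auto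
    then show False using n l by (auto dest: dvd_imp_le)
  qed
  then have card2: "2 \<le> card W" using w finW by (cases "card W" rule: nat.exhaust) (auto simp: not_less_eq_eq numeral_2_eq_2 Suc_le_eq)
  have WI: "W \<subseteq> I" using W oC by auto
  have "card (insert w (I - W)) = card I - card W + 1"
    using fin finW WI w by (simp add: card_Diff_subset)
  moreover have "card W \<le> card I" using WI fin by (simp add: card_mono)
  ultimately have lt: "card (insert w (I - W)) < card I" using card2 by linarith
  have "(\<Sum>i\<in>I. wz Z (g i)) = (\<Sum>i\<in>W. wz Z (g i)) + (\<Sum>i\<in>I - W. wz Z (g i))"
    using sum.subset_diff[OF WI fin] by (simp add: add.commute)
  also have "(\<Sum>i\<in>W. wz Z (g i)) = real (card W) / real (l * n)"
    using W oC by (simp add: wz_def subset_iff)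
  also have "\<dots> \<le> real l / real (l * n)" using cardW by (intro divide_right_mono) auto
  also have "\<dots> = 1 / real n" using l by simp
  also have "\<dots> \<le> wz Z (sum g W)" using wz_ge[OF Z _ n] W by auto
  also have "(\<Sum>i\<in>I - W. wz Z (g i)) = (\<Sum>i\<in>I - W. wz Z ((g(w := sum g W)) i))"
    using w by (intro sum.cong) auto
  also have "wz Z (sum g W) + \<dots> = (\<Sum>i\<in>insert w (I - W). wz Z ((g(w := sum g W)) i))"
    using fin w by simp
  finally have "(\<Sum>i\<in>I. wz Z (g i)) \<le> (\<Sum>i\<in>insert w (I - W). wz Z ((g(w := sum g W)) i))"
    by simp
  then show ?thesis using W w lt by blast
qed

section \<open>Climbing the torsion filtration of a primary group\<close>

text \<open>Once merging stops, at most \<open>p\<close> elements of exact order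
  \<open>p ^ Suc k\<close> remain; their cross number is at most p / p^(k+1), which is the new
  term.\<close>

lemma bnd_tor_step:
  fixes Z :: "'a::ab_group_add set"
  assumes Z: "sg Z" and p: "prime p" and ix: "idx (tor Z (p ^ k)) (tor Z (p ^ Suc k)) p"
    and b: "bnd Z (tor Z (p ^ k)) (wz Z) \<kappa>"
  shows "bnd Z (tor Z (p ^ Suc k)) (wz Z) (\<kappa> + 1 / real p ^ k)"
  unfolding bnd_def
proof (intro allI impI)
  fix I :: "nat set" and g :: "nat \<Rightarrow> 'a"
  assume "UF Z g I" "g ` I \<subseteq> tor Z (p ^ Suc k) - Z"
  then show "(\<Sum>i\<in>I. wz Z (g i)) \<le> \<kappa> + 1 / real p ^ k"
  proof (induction "card I" arbitrary: I g rule: less_induct)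
    case less
    have p2: "2 \<le> p" and p0: "0 < p ^ k" "0 < p ^ Suc k" using p prime_ge_2_nat by (auto simp: prime_gt_0_nat)
    define C where "C = {i\<in>I. oz Z (g i) = p * p ^ k}"
    have gN: "g ` I \<subseteq> tor Z (p ^ Suc k)" using less.prems by auto
    have fin: "finite I" using less.prems ucl_finite by (auto simp: UF_def)
    have notC: "g i \<in> tor Z (p ^ k)" if "i \<in> I - C" for i
    proof -
      have g: "g i \<in> tor Z (p ^ Suc k)" using gN that by auto
      have "oz Z (g i) dvd p ^ Suc k" "oz Z (g i) \<noteq> p ^ Suc k"
        using that oz_dvd[OF Z g p0(2), of "p ^ Suc k"] g by (auto simp: C_def)
      then have "oz Z (g i) dvd p ^ k"
        unfolding divides_primepow_nat[OF p] by (metis le_Suc_eq)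
      then show ?thesis using oz_dvd[OF Z g p0(2)] by simp
    qed
    consider (a) "real (card C) \<le> real p" "\<forall>W\<subseteq>C. sum g W \<in> tor Z (p ^ k) \<longrightarrow> sum g W \<in> Z"
      | (b) W w where "W \<subseteq> C" "w \<in> W" "sum g W \<in> tor Z (p ^ k) - Z" "card (insert w (I - W)) < card I"
        "(\<Sum>i\<in>I. wz Z (g i)) \<le> (\<Sum>i\<in>insert w (I - W). wz Z ((g(w := sum g W)) i))"
      using merge_class[OF Z p0(1) p2 _ less.prems(1) gN p0(2) C_def] ix by auto
    then show ?case
    proof cases
      case a
      have C: "C \<subseteq> I" by (auto simp: C_def)
      have split: "sum f I = sum f (I - C) + sum f C" for f :: "nat \<Rightarrow> 'b::comm_monoid_add"
        using sum.subset_diff[OF C fin] by blast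
      \<comment> \<open>The total and the sum outside \<open>C\<close> lie in the lower layer, hence
        so does the sum over \<open>C\<close>. As no merge is possible it is zero, and the remaining
        family has sum zero within the lower layer.\<close>
      have "sum g (I - C) \<in> tor Z (p ^ k)" using notC by (intro sg_sum[OF sg_tor[OF Z]]) auto
      moreover have "sum g I \<in> tor Z (p ^ k)" using less.prems sub_tor[OF Z] by (auto simp: UF_def)
      ultimately have "sum g C \<in> tor Z (p ^ k)"
        using split[of g] sg_add_iff1[OF sg_tor[OF Z]] by metis
      then have "sum g C \<in> Z" using a(2) by blast
      then have "sum g (I - C) \<in> Z"
        using sum_Diff_sg[OF Z fin, of g C] less.prems C by (simp add: UF_def Int_absorb1)
      then have "(\<Sum>i\<in>I - C. wz Z (g i)) \<le> \<kappa>"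
        using notC less.prems by (intro bndD[OF b UF_subset]) auto
      moreover have "(\<Sum>i\<in>C. wz Z (g i)) \<le> 1 / real p ^ k"
      proof -
        have "(\<Sum>i\<in>C. wz Z (g i)) = real (card C) / (real p * real p ^ k)"
          by (simp add: wz_def C_def)
        also have "\<dots> \<le> real p / (real p * real p ^ k)"
          using a(1) by (intro divide_right_mono) auto
        finally show ?thesis using p2 by simp
      qed
      ultimately show ?thesis using split[of "\<lambda>i. wz Z (g i)"] by simp
    next
      case b
      have WI: "W \<subseteq> I" using b(1) by (auto simp: C_def)
      have "tor Z (p ^ k) \<subseteq> tor Z (p ^ Suc k)" by (intro tor_dvd[OF Z]) simp
      then have "(g(w := sum g W)) ` insert w (I - W) \<subseteq> tor Z (p ^ Suc k) - Z"
        using b(3) less.prems(2) by auto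
      then have "(\<Sum>i\<in>insert w (I - W). wz Z ((g(w := sum g W)) i)) \<le> \<kappa> + 1 / real p ^ k"
        using less.hyps[OF b(4) UF_merge[OF less.prems(1) WI b(2)]] by blast
      then show ?thesis using b(5) by linarith
    qed
  qed
qed

text \<open>The starting level \<open>a\<close> is free: a cyclic primary part starts at the trivial
  layer, a part of rank two above its layer of type (p, p).\<close>

lemma bnd_tor_filtration:
  fixes Z :: "'a::ab_group_add set"
  assumes Z: "sg Z" and p: "prime p" and b: "bnd Z (tor Z (p ^ a)) (wz Z) \<kappa>"
    and ix: "\<And>k. a \<le> k \<Longrightarrow> k < m \<Longrightarrow> idx (tor Z (p ^ k)) (tor Z (p ^ Suc k)) p" and "a \<le> m"
  shows "bnd Z (tor Z (p ^ m)) (wz Z) (\<kappa> + (\<Sum>k=a..<m. 1 / real p ^ k))"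
  using \<open>a \<le> m\<close> ix
proof (induction m rule: dec_induct)
  case base
  then show ?case using b by simp
next
  case (step n)
  then have "bnd Z (tor Z (p ^ n)) (wz Z) (\<kappa> + (\<Sum>k=a..<n. 1 / real p ^ k))" by simp
  then have "bnd Z (tor Z (p ^ Suc n)) (wz Z) (\<kappa> + (\<Sum>k=a..<n. 1 / real p ^ k) + 1 / real p ^ n)"
    using step by (intro bnd_tor_step[OF Z p]) auto
  then show ?case using step by (simp add: algebra_simps)
qed

section \<open>Direct sums of coprime torsion parts\<close>

text \<open>When every element of \<open>tor Z r\<close> is a subset sum of the indices lying there, these indices
  absorb the \<open>r\<close>-component of any sum, so that the projections of the other indices to \<open>tor Z e\<close>
  form a unique factorization family again.\<close>

lemma project_if_all_subset_sums:
  fixes g :: "'i \<Rightarrow> 'a::ab_group_add"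
  assumes Z: "sg Z" and cop: "coprime e r" and pos: "0 < e" "0 < r"
    and u: "UF Z g I" and gI: "g ` I \<subseteq> tor Z (e * r) - Z"
    and B: "B = {i\<in>I. g i \<in> tor Z r}"
    and full: "\<And>x. x \<in> tor Z r \<Longrightarrow> \<exists>K\<subseteq>B. x - sum g K \<in> Z"
    and b: "bnd Z (tor Z e) (wz Z) \<kappa>"
  shows "(\<Sum>i\<in>I - B. wz Z (g i)) \<le> \<kappa>"
    and "(\<Sum>i\<in>I - B. wz Z (g i)) = \<kappa> \<Longrightarrow> \<forall>i\<in>I - B. g i \<in> tor Z e"
proof -
  have uc: "ucl Z g I" using u by (simp add: UF_def)
  have fin: "finite I" using uc by (rule ucl_finite)
  note sr = sg_tor[OF Z, of r] and se = sg_tor[OF Z, of e]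
  obtain c' where c': "[c' = 1] (mod e)" "[c' = 0] (mod r)"
    using binary_chinese_remainder_nat[OF cop, of 1 0] by blast
  \<comment> \<open>Multiplication by \<open>c\<close> is the projection to \<open>tor Z e\<close>
    along \<open>tor Z r\<close>. Adding \<open>e * r\<close> makes \<open>c\<close> positive, so
    that \<open>c - 1\<close> is not truncated.\<close>
  define c where "c = c' + e * r"
  have c0: "r dvd c" using c'(2) by (simp add: cong_0_iff c_def)
  have "[c = 1] (mod e)" using c'(1) by (simp add: c_def cong_def)
  then have c1: "e dvd c - 1" using cong_to_1_nat by blast
  have cS: "c = Suc (c - 1)" using pos by (simp add: c_def)
  have ce: "nmul c x \<in> tor Z e" and cr: "x - nmul c x \<in> tor Z r" if x: "x \<in> tor Z (e * r)" for x
  proof -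
    have "x \<in> tor Z (e * c)" using tor_dvd[OF Z, of "e * r" "e * c"] c0 x by auto
    then show "nmul c x \<in> tor Z e" by (simp add: tor_def nmul_mult)
    have "x \<in> tor Z (r * (c - 1))"
      using tor_dvd[OF Z, of "e * r" "r * (c - 1)"] c1 x by (auto simp: mult.commute)
    then have "nmul (c - 1) x \<in> tor Z r" by (simp add: tor_def nmul_mult)
    moreover have "x - nmul c x = - nmul (c - 1) x" by (subst cS) (simp add: nmul_Suc)
    ultimately show "x - nmul c x \<in> tor Z r" using sg_minus[OF sr] by simp
  qed
  have coset: "x \<in> tor Z r \<longleftrightarrow> nmul c x \<in> Z" if x: "x \<in> tor Z (e * r)" for x
  proof
    assume "x \<in> tor Z r"
    then have "x \<in> tor Z c" using tor_dvd[OF Z c0] by blast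
    then show "nmul c x \<in> Z" by (simp add: tor_def)
  next
    assume "nmul c x \<in> Z"
    then have "nmul c x \<in> tor Z r" using sub_tor[OF Z] by blast
    then have "(x - nmul c x) + nmul c x \<in> tor Z r" using cr[OF x] sg_add[OF sr] by blast
    then show "x \<in> tor Z r" by simp
  qed
  have gD: "sum g K \<in> tor Z (e * r)" if "K \<subseteq> I" for K
    using gI that by (intro sg_sum[OF sg_tor[OF Z]]) auto
  define h where "h = (\<lambda>i. nmul c (g i))"
  have hs: "sum h K \<in> Z \<longleftrightarrow> sum g K \<in> tor Z r" if "K \<subseteq> I" for K
    using coset[OF gD[OF that]] by (simp add: h_def nmul_sum)
  have BI: "B \<subseteq> I" by (auto simp: B)
  have lift: "\<exists>KB\<subseteq>B. sum g (K \<union> KB) \<in> Z" if K: "K \<subseteq> I - B" "sum g K \<in> tor Z r" for K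
  proof -
    obtain KB where KB: "KB \<subseteq> B" "- sum g K - sum g KB \<in> Z"
      using full[of "- sum g K"] K sg_minus[OF sr] by blast
    then have "- (sum g K + sum g KB) \<in> Z" by simp
    then have "sum g K + sum g KB \<in> Z" using sg_minus_iff[OF Z] by blast
    moreover have "sum g (K \<union> KB) = sum g K + sum g KB"
    proof (rule sum.union_disjoint)
      show "finite K" using K(1) fin by (meson Diff_subset finite_subset)
      show "finite KB" using KB(1) BI fin by (meson finite_subset)
      show "K \<inter> KB = {}" using K KB by auto
    qed
    ultimately show ?thesis using KB(1) by auto
  qed
  have "ucl Z h (I - B)" unfolding ucl_def
  proof (intro conjI allI impI)
    fix K L assume KL: "K \<subseteq> I - B" "L \<subseteq> I - B" "sum h K \<in> Z" "sum h L \<in> Z"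
    have sub: "K \<subseteq> I" "L \<subseteq> I" using KL by auto
    obtain KB LB where KB: "KB \<subseteq> B" "sum g (K \<union> KB) \<in> Z" and LB: "LB \<subseteq> B" "sum g (L \<union> LB) \<in> Z"
      using lift KL hs[OF sub(1)] hs[OF sub(2)] by metis
    have "sum g ((K \<union> KB) \<inter> (L \<union> LB)) \<in> Z"
      using KB LB sub BI by (intro ucl_Int[OF uc]) auto
    moreover have "(K \<union> KB) \<inter> (L \<union> LB) = (K \<inter> L) \<union> (KB \<inter> LB)" using KL KB LB by auto
    moreover have "sum g ((K \<inter> L) \<union> (KB \<inter> LB)) = sum g (K \<inter> L) + sum g (KB \<inter> LB)"
    proof (rule sum.union_disjoint)
      show "finite (K \<inter> L)" using sub(1) fin by (meson finite_Int finite_subset)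
      show "finite (KB \<inter> LB)" using KB(1) BI fin by (meson finite_Int finite_subset)
      show "K \<inter> L \<inter> (KB \<inter> LB) = {}" using KL KB by auto
    qed
    ultimately have "sum g (K \<inter> L) + sum g (KB \<inter> LB) \<in> tor Z r" using sub_tor[OF Z] by auto
    moreover have "sum g (KB \<inter> LB) \<in> tor Z r"
      using KB(1) by (intro sg_sum[OF sr]) (auto simp: B)
    ultimately have "sum g (K \<inter> L) \<in> tor Z r" using sg_add_iff2[OF sr] by blast
    moreover have "K \<inter> L \<subseteq> I" using sub by auto
    ultimately show "sum h (K \<inter> L) \<in> Z" using hs by blast
  qed (use fin in simp)
  moreover have "sum h (I - B) \<in> Z"
  proof -
    have "sum g I = sum g (I - B) + sum g B" using sum.subset_diff[OF BI fin] .
    moreover have "sum g B \<in> tor Z r" by (intro sg_sum[OF sr]) (auto simp: B)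
    moreover have "sum g I \<in> tor Z r" using u sub_tor[OF Z] by (auto simp: UF_def)
    ultimately have "sum g (I - B) \<in> tor Z r" using sg_add_iff2[OF sr] by metis
    then show ?thesis using hs[of "I - B"] by auto
  qed
  ultimately have uh: "UF Z h (I - B)" by (simp add: UF_def)
  have tI: "g i \<in> tor Z (e * r)" if "i \<in> I" for i using that gI by auto
  have hI: "h ` (I - B) \<subseteq> tor Z e - Z"
  proof
    fix x assume "x \<in> h ` (I - B)"
    then obtain i where i: "x = nmul c (g i)" "i \<in> I" "g i \<notin> tor Z r" by (auto simp: h_def B)
    then show "x \<in> tor Z e - Z" using ce[OF tI] coset[OF tI] by auto
  qed
  have er: "0 < e * r" using pos by simp
  have oh: "oz Z (h i) dvd oz Z (g i)" "0 < oz Z (h i)" "0 < oz Z (g i)" if "i \<in> I - B" for i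
  proof -
    have i: "g i \<in> tor Z (e * r)" using that tI by auto
    have "nmul (oz Z (g i)) (g i) \<in> Z" using oz_pos[OF i er] by simp
    then have "nmul (oz Z (g i)) (nmul c (g i)) \<in> Z"
      using sg_nmul[OF Z] by (metis nmul_mult mult.commute)
    then have "h i \<in> tor Z (oz Z (g i))" by (simp add: tor_def h_def)
    moreover have "h i \<in> tor Z e" using hI that by auto
    ultimately show "oz Z (h i) dvd oz Z (g i)" using oz_dvd[OF Z _ pos(1)] by blast
    show "0 < oz Z (h i)" using oz_pos[OF \<open>h i \<in> tor Z e\<close> pos(1)] by simp
    show "0 < oz Z (g i)" using oz_pos[OF i er] by simp
  qed
  \<comment> \<open>Projection replaces each order by a divisor, so weights can only grow. If the
    total already equals the bound, every order must survive.\<close>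
  have le: "wz Z (g i) \<le> wz Z (h i)" if "i \<in> I - B" for i
    using oh[OF that] dvd_imp_le[of "oz Z (h i)" "oz Z (g i)"] by (simp add: wz_def frac_le)
  have sh: "(\<Sum>i\<in>I - B. wz Z (h i)) \<le> \<kappa>" by (rule bndD[OF b uh hI])
  have lesum: "(\<Sum>i\<in>I - B. wz Z (g i)) \<le> (\<Sum>i\<in>I - B. wz Z (h i))"
    using le by (rule sum_mono)
  then show "(\<Sum>i\<in>I - B. wz Z (g i)) \<le> \<kappa>" using sh by linarith
  assume eq: "(\<Sum>i\<in>I - B. wz Z (g i)) = \<kappa>"
  show "\<forall>i\<in>I - B. g i \<in> tor Z e"
  proof (rule ccontr)
    assume "\<not> (\<forall>i\<in>I - B. g i \<in> tor Z e)"
    then obtain j where j: "j \<in> I - B" "g j \<notin> tor Z e" by auto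
    have hj: "h j \<in> tor Z e" using hI j by auto
    have "oz Z (h j) dvd e" using oz_dvd[OF Z hj pos(1)] hj by blast
    moreover have "\<not> oz Z (g j) dvd e" using oz_dvd[OF Z tI er, of j e] j by auto
    ultimately have "oz Z (h j) \<noteq> oz Z (g j)" by auto
    then have "oz Z (h j) < oz Z (g j)"
      using oh[OF j(1)] dvd_imp_le[of "oz Z (h j)" "oz Z (g j)"] by linarith
    then have "wz Z (g j) < wz Z (h j)" using oh[OF j(1)] by (simp add: wz_def frac_less2)
    then have "(\<Sum>i\<in>I - B. wz Z (g i)) < (\<Sum>i\<in>I - B. wz Z (h i))"
      using le j fin by (intro sum_strict_mono_ex1) auto
    then show False using eq sh by linarith
  qed
qed

lemma bnd_length_or_subset_sums:
  fixes g :: "'i \<Rightarrow> 'a::ab_group_add"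
  assumes Z: "sg Z" and b: "bnd Z (tor Z r) (\<lambda>_. 1) (real N)"
    and u: "UF Z g I" and gI: "g ` I \<inter> Z = {}" and B: "B = {i\<in>I. g i \<in> tor Z r}"
  shows "card B \<le> N" and "card B + 2 \<le> N \<or> (\<forall>x\<in>tor Z r. \<exists>K\<subseteq>B. x - sum g K \<in> Z)"
proof -
  have uB: "ucl Z g B" using u ucl_subset[of Z g I B] by (auto simp: UF_def B)
  have gB: "g ` B \<subseteq> tor Z r - Z" using gI by (auto simp: B)
  show "card B \<le> N"
    using bnd_ucl[OF Z sg_tor[OF Z] sub_tor[OF Z] b _ uB gB] by simp
  show "card B + 2 \<le> N \<or> (\<forall>x\<in>tor Z r. \<exists>K\<subseteq>B. x - sum g K \<in> Z)"
    using subset_sums_or_short[OF Z sg_tor[OF Z] sub_tor[OF Z] b uB gB] by blast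
qed

section \<open>Cross numbers in the presence of elements of mixed order\<close>

lemma sum_UN_le:
  fixes f :: "'b \<Rightarrow> real"
  assumes "finite A" "\<And>a. a \<in> A \<Longrightarrow> finite (M a)" "\<And>x. 0 \<le> f x"
  shows "sum f (\<Union>a\<in>A. M a) \<le> (\<Sum>a\<in>A. sum f (M a))"
  using assms(1,2)
proof (induction A rule: finite_induct)
  case (insert a A)
  have "sum f (M a \<union> (\<Union>a\<in>A. M a)) \<le> sum f (M a) + sum f (\<Union>a\<in>A. M a)"
    using insert assms(3) by (subst sum_Un) (auto simp: sum_nonneg)
  then show ?case using insert by simp
qed simp

text \<open>The constant 2 matches the two indices gained in
  \<open>subset_sums_or_short\<close>.\<close>

lemma sum_inverse_powers_le_2:
  assumes "2 \<le> p"
  shows "(\<Sum>k<m. 1 / real p ^ k) \<le> 2"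
proof -
  have "(\<Sum>k<m. 1 / real p ^ k) \<le> (\<Sum>k<m. (1/2) ^ k)"
  proof (rule sum_mono)
    fix k
    have "(2::real) ^ k \<le> real p ^ k" using assms by (intro power_mono) auto
    then show "1 / real p ^ k \<le> (1/2) ^ k" by (simp add: power_one_over frac_le)
  qed
  also have "\<dots> \<le> (\<Sum>k. (1/2::real) ^ k)"
    by (intro sum_le_suminf) (auto simp: summable_geometric)
  also have "\<dots> = 2" by (simp add: suminf_geometric)
  finally show ?thesis .
qed

text \<open>The elements of order \<open>p ^ Suc k * q\<close> are merged into \<open>tor Z (p ^ k * q)\<close>; once this is no
  longer possible, all elements of mixed order together have cross number at most \<open>2 / q\<close>.\<close>

lemma bnd_primary_plus_elementary:
  fixes Z :: "'a::ab_group_add set"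
  assumes Z: "sg Z" and p: "prime p" and q: "prime q" "p \<noteq> q"
    and ix: "\<And>k. k < m \<Longrightarrow> idx (tor Z (p ^ k)) (tor Z (p ^ Suc k)) p"
    and b: "bnd Z (tor Z (p ^ m)) (wz Z) \<kappa>" and N: "bnd Z (tor Z q) (\<lambda>_. 1) (real N)"
  shows "bnd Z (tor Z (p ^ m * q)) (wz Z) (\<kappa> + real N / real q)"
  unfolding bnd_def
proof (intro allI impI)
  fix I :: "nat set" and g :: "nat \<Rightarrow> 'a"
  assume "UF Z g I" "g ` I \<subseteq> tor Z (p ^ m * q) - Z"
  then show "(\<Sum>i\<in>I. wz Z (g i)) \<le> \<kappa> + real N / real q"
  proof (induction "card I" arbitrary: I g rule: less_induct)
    case less
    have p2: "2 \<le> p" and q2: "2 \<le> q" using p q prime_ge_2_nat by auto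
    have pos: "0 < p ^ k" "0 < q" "0 < p ^ k * q" for k using p2 q2 by auto
    have cop: "coprime (p ^ m) q" using primes_coprime[OF p q] by simp
    define M where "M k = {i\<in>I. oz Z (g i) = p * (p ^ k * q)}" for k
    define A where "A = {i\<in>I. g i \<in> tor Z (p ^ m)}"
    define B where "B = {i\<in>I. g i \<in> tor Z q}"
    have gN: "g ` I \<subseteq> tor Z (p ^ m * q)" using less.prems by auto
    have gZ: "g ` I \<inter> Z = {}" using less.prems by auto
    have uc: "ucl Z g I" using less.prems by (simp add: UF_def)
    have fin: "finite I" using uc by (rule ucl_finite)
    have ixM: "idx (tor Z (p ^ k * q)) (tor Z (p * (p ^ k * q))) p" if "k < m" for k
      using idx_mult[OF ix[OF that], of q] by (simp add: mult_ac)
    consider (a) "\<And>k. k < m \<Longrightarrow> real (card (M k)) \<le> real p"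
      | (b) k W w where "k < m" "W \<subseteq> M k" "w \<in> W" "sum g W \<in> tor Z (p ^ k * q) - Z" "card (insert w (I - W)) < card I"
        "(\<Sum>i\<in>I. wz Z (g i)) \<le> (\<Sum>i\<in>insert w (I - W). wz Z ((g(w := sum g W)) i))"
  proof (cases "\<forall>k. k < m \<longrightarrow> real (card (M k)) \<le> real p")
    case True
    then show thesis using that(1) by blast
  next
    case False
    then obtain k where k: "k < m" "\<not> real (card (M k)) \<le> real p" by blast
    have "\<exists>W w. W \<subseteq> M k \<and> w \<in> W \<and> sum g W \<in> tor Z (p ^ k * q) - Z \<and> card (insert w (I - W)) < card I \<and>
      (\<Sum>i\<in>I. wz Z (g i)) \<le> (\<Sum>i\<in>insert w (I - W). wz Z ((g(w := sum g W)) i))"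
      using merge_class[OF Z pos(3) p2 ixM[OF k(1)] less.prems(1) gN pos(3) M_def[of k]] k(2) by simp
    then show thesis using that(2)[OF k(1)] by blast
  qed
    then show ?case
    proof cases
      case b
      have WI: "W \<subseteq> I" using b(2) by (auto simp: M_def)
      have "p ^ k * q dvd p ^ m * q" using b(1) by (intro mult_dvd_mono le_imp_power_dvd) auto
      then have "(g(w := sum g W)) ` insert w (I - W) \<subseteq> tor Z (p ^ m * q) - Z"
        using b(4) less.prems(2) tor_dvd[OF Z, of "p ^ k * q" "p ^ m * q"] by auto
      then have "(\<Sum>i\<in>insert w (I - W). wz Z ((g(w := sum g W)) i)) \<le> \<kappa> + real N / real q"
        using less.hyps[OF b(5) UF_merge[OF less.prems(1) WI b(3)]] by blast
      then show ?thesis using b(6) by linarith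
    next
      case a
      have oB: "oz Z (g i) = q" if "i \<in> B" for i
      proof -
        have i: "g i \<in> tor Z q" "g i \<notin> Z" using that gZ by (auto simp: B_def)
        then have "oz Z (g i) dvd q" "oz Z (g i) \<noteq> 1"
          using oz_dvd[OF Z i(1) pos(2), of q] oz_dvd[OF Z i(1) pos(2), of 1] by auto
        then show ?thesis using q(1) prime_nat_iff by blast
      qed
      have sB: "(\<Sum>i\<in>B. wz Z (g i)) = real (card B) / real q" using oB by (simp add: wz_def)
      have BI: "B \<subseteq> I" by (auto simp: B_def)
      have splitB: "(\<Sum>i\<in>I. wz Z (g i)) = (\<Sum>i\<in>I - B. wz Z (g i)) + (\<Sum>i\<in>B. wz Z (g i))"
        using sum.subset_diff[OF BI fin] .
      note alt = bnd_length_or_subset_sums[OF Z N less.prems(1) gZ B_def]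
      show ?thesis
      proof (cases "card B + 2 \<le> N")
        case False
        have "(\<Sum>i\<in>I - B. wz Z (g i)) \<le> \<kappa>"
          using project_if_all_subset_sums(1)[OF Z cop pos(1,2) less.prems B_def _ b] alt(2) False by blast
        moreover have "real (card B) / real q \<le> real N / real q"
          using alt(1) by (intro divide_right_mono) auto
        ultimately show ?thesis using splitB sB by linarith
      next
        case True
        \<comment> \<open>The order divides \<open>p ^ m * q\<close>. If \<open>q\<close> does not
          divide it, the index is in \<open>A\<close>; order \<open>q\<close> itself means
          \<open>B\<close>, and order \<open>p ^ Suc k * q\<close> means \<open>M k\<close>.\<close>
        have cover: "I - B \<subseteq> A \<union> (\<Union>k<m. M k)"
        proof
          fix i assume i: "i \<in> I - B"
          have ti: "g i \<in> tor Z (p ^ m * q)" using i gN by auto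
          have "oz Z (g i) dvd p ^ m * q" using oz_dvd[OF Z ti pos(3)] ti by blast
          then obtain d e where de: "oz Z (g i) = d * e" "d dvd p ^ m" "e dvd q"
            using division_decomp by blast
          have "e = 1 \<or> e = q" using de q(1) prime_nat_iff by blast
          moreover obtain j where j: "d = p ^ j" "j \<le> m" using de divides_primepow_nat[OF p] by blast
          moreover have "g i \<in> tor Z (p ^ m)" if "e = 1"
            using oz_dvd[OF Z ti pos(3), of "p ^ m"] de that by simp
          moreover have "i \<in> (\<Union>k<m. M k)" if "e = q"
          proof (cases j)
            case 0
            then have "g i \<in> tor Z q" using oz_dvd[OF Z ti pos(3), of q] de j that by simp
            then show ?thesis using i by (auto simp: B_def)
          next
            case (Suc k)
            then have "k < m" "i \<in> M k" using i j de that by (auto simp: M_def mult_ac)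
            then show ?thesis by auto
          qed
          ultimately show "i \<in> A \<union> (\<Union>k<m. M k)" using i by (auto simp: A_def)
        qed
        have "(\<Sum>i\<in>I - B. wz Z (g i)) \<le> (\<Sum>i\<in>A \<union> (\<Union>k<m. M k). wz Z (g i))"
          using cover fin by (intro sum_mono2) (auto simp: A_def M_def wz_nonneg)
        also have "\<dots> \<le> (\<Sum>i\<in>A. wz Z (g i)) + (\<Sum>i\<in>(\<Union>k<m. M k). wz Z (g i))"
        proof -
          have "finite A" "finite (\<Union>k<m. M k)" using fin by (auto simp: A_def M_def)
          then show ?thesis by (simp add: sum_Un sum_nonneg wz_nonneg)
        qed
        also have "(\<Sum>i\<in>(\<Union>k<m. M k). wz Z (g i)) \<le> (\<Sum>k<m. \<Sum>i\<in>M k. wz Z (g i))"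
          using fin by (intro sum_UN_le) (auto simp: M_def wz_nonneg)
        also have "\<dots> \<le> (\<Sum>k<m. (1 / real q) * (1 / real p ^ k))"
        proof (rule sum_mono)
          fix k assume "k \<in> {..<m}"
          then have ck: "real (card (M k)) \<le> real p" using a by simp
          have "(\<Sum>i\<in>M k. wz Z (g i)) = real (card (M k)) / (real p * (real p ^ k * real q))"
            by (simp add: wz_def M_def)
          also have "\<dots> \<le> real p / (real p * (real p ^ k * real q))"
            using ck by (intro divide_right_mono) auto
          finally show "(\<Sum>i\<in>M k. wz Z (g i)) \<le> (1 / real q) * (1 / real p ^ k)"
            using p2 by (simp add: mult.commute)
        qed
        also have "\<dots> = (1 / real q) * (\<Sum>k<m. 1 / real p ^ k)" by (rule sum_distrib_left[symmetric])
        also have "\<dots> \<le> (1 / real q) * 2"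
          using sum_inverse_powers_le_2[OF p2] by (intro mult_left_mono) auto
        \<comment> \<open>The subfamily \<open>A\<close> may have nonzero total, so the bound for
          \<open>ucl\<close> families is used.\<close>
        also have "(\<Sum>i\<in>A. wz Z (g i)) \<le> \<kappa>"
          using less.prems ucl_subset[OF uc, of A]
          by (intro bnd_ucl[OF Z sg_tor[OF Z] sub_tor[OF Z] b wz_nonneg]) (auto simp: A_def)
        finally have "(\<Sum>i\<in>I - B. wz Z (g i)) \<le> \<kappa> + 2 / real q" by simp
        \<comment> \<open>The two elements missing from \<open>B\<close> pay for the mixed
          ones.\<close>
        moreover have "real (card B) + 2 \<le> real N" using True by linarith
        then have "real (card B) / real q + 2 / real q \<le> real N / real q"
          by (simp add: divide_right_mono flip: add_divide_distrib)
        ultimately show ?thesis using splitB sB by linarith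
      qed
    qed
  qed
qed

text \<open>Merging here removes the factor \<open>r\<close> from an order \<open>r * d\<close>, so
  merged elements never enter the \<open>r\<close>-part and the missing element \<open>x\<close>
  stays missing throughout the induction. In the end the \<open>r\<close>-part is two elements
  short, a deficit of \<open>2 / r\<close>, while the at most \<open>r\<close> elements of each
  order \<open>r * d\<close> contribute at most \<open>1 / d\<close>. Strictness for the original
  family is needed, as it excludes this case from equality.\<close>

lemma divisor_sum_bound_nonfull:
  fixes g :: "'i \<Rightarrow> 'a::ab_group_add"
  assumes Z: "sg Z" and r: "prime r" and cop: "coprime e r" and e: "0 < e"
    and ix: "idx Z (tor Z r) r" and b: "bnd Z (tor Z e) (wz Z) \<kappa>"
    and D: "(\<Sum>d | d dvd e \<and> 1 < d. 1 / real d) < 2 / real r"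
    and "UF Z g I" "g ` I \<subseteq> tor Z (e * r) - Z"
    and "x \<in> tor Z r" "\<And>K. K \<subseteq> {i\<in>I. g i \<in> tor Z r} \<Longrightarrow> x - sum g K \<notin> Z"
  shows "(\<Sum>i\<in>I. wz Z (g i)) < 1 + \<kappa>"
  using assms(8-)
proof (induction "card I" arbitrary: I g rule: less_induct)
  case less
  have r2: "2 \<le> r" using r prime_ge_2_nat by auto
  have pos: "0 < r" "0 < e * r" using r2 e by auto
  let ?D = "{d. d dvd e \<and> 1 < d}"
  define M where "M d = {i\<in>I. oz Z (g i) = r * d}" for d
  define A where "A = {i\<in>I. g i \<in> tor Z e}"
  define B where "B = {i\<in>I. g i \<in> tor Z r}"
  have gN: "g ` I \<subseteq> tor Z (e * r)" using less.prems by auto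
  have gZ: "g ` I \<inter> Z = {}" using less.prems by auto
  have uc: "ucl Z g I" using less.prems by (simp add: UF_def)
  have fin: "finite I" using uc by (rule ucl_finite)
  have dpos: "0 < d" if "d \<in> ?D" for d using that by auto
  have finD: "finite ?D" using e by (intro finite_subset[of ?D "{..e}"]) (auto dest: dvd_imp_le)
  have ixM: "idx (tor Z d) (tor Z (r * d)) r" for d
    using idx_mult[of Z 1 r r d] ix by simp
  consider (a) "\<And>d. d \<in> ?D \<Longrightarrow> real (card (M d)) \<le> real r"
    | (b) d W w where "d \<in> ?D" "W \<subseteq> M d" "w \<in> W" "sum g W \<in> tor Z d - Z" "card (insert w (I - W)) < card I"
      "(\<Sum>i\<in>I. wz Z (g i)) \<le> (\<Sum>i\<in>insert w (I - W). wz Z ((g(w := sum g W)) i))"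
  proof (cases "\<forall>d. d \<in> ?D \<longrightarrow> real (card (M d)) \<le> real r")
    case True
    then show thesis using that(1) by blast
  next
    case False
    then obtain d where d: "d \<in> ?D" "\<not> real (card (M d)) \<le> real r" by blast
    have "\<exists>W w. W \<subseteq> M d \<and> w \<in> W \<and> sum g W \<in> tor Z (d) - Z \<and> card (insert w (I - W)) < card I \<and>
      (\<Sum>i\<in>I. wz Z (g i)) \<le> (\<Sum>i\<in>insert w (I - W). wz Z ((g(w := sum g W)) i))"
      using merge_class[OF Z dpos[OF d(1)] r2 ixM less.prems(1) gN pos(2) M_def[of d]] d(2) by simp
    then show thesis using that(2)[OF d(1)] by blast
  qed
  then show ?case
  proof cases
    case b
    let ?g = "g(w := sum g W)" and ?I = "insert w (I - W)"
    have WI: "W \<subseteq> I" using b(2) by (auto simp: M_def)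
    have "d dvd e * r" using b(1) by auto
    then have "?g ` ?I \<subseteq> tor Z (e * r) - Z"
      using b(4) less.prems(2) tor_dvd[OF Z, of "d" "e * r"] by auto
    \<comment> \<open>The merged sum is nonzero and killed by \<open>d\<close>, which is coprime to
      \<open>r\<close>; so the subset sums of the new \<open>r\<close>-part are among the old
      ones.\<close>
    moreover have "x - sum ?g K \<notin> Z" if K: "K \<subseteq> {i\<in>?I. ?g i \<in> tor Z r}" for K
    proof -
      have "d dvd e" using b(1) by simp
      then have "coprime d r" using coprime_divisors[OF _ dvd_refl cop] by blast
      then have "sum g W \<notin> tor Z r" using tor_coprime[OF Z _ dpos[OF b(1)]] b(4) by blast
      then have "w \<notin> K" using K by auto
      then have "K \<subseteq> {i\<in>I. g i \<in> tor Z r}" "sum ?g K = sum g K"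
        using K by (auto intro!: sum.cong split: if_splits)
      then show ?thesis using less.prems(4) by metis
    qed
    ultimately have "(\<Sum>i\<in>?I. wz Z (?g i)) < 1 + \<kappa>"
      using less.hyps[OF b(5) UF_merge[OF less.prems(1) WI b(3)] _ less.prems(3)] by blast
    then show ?thesis using b(6) by linarith
  next
    case a
    have oB: "oz Z (g i) = r" if "i \<in> B" for i
    proof -
      have i: "g i \<in> tor Z r" "g i \<notin> Z" using that gZ by (auto simp: B_def)
      then have "oz Z (g i) dvd r" "oz Z (g i) \<noteq> 1"
        using oz_dvd[OF Z i(1) pos(1), of r] oz_dvd[OF Z i(1) pos(1), of 1] by auto
      then show ?thesis using r prime_nat_iff by blast
    qed
    have BI: "B \<subseteq> I" by (auto simp: B_def)
    have splitB: "(\<Sum>i\<in>I. wz Z (g i)) = (\<Sum>i\<in>I - B. wz Z (g i)) + (\<Sum>i\<in>B. wz Z (g i))"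
      using sum.subset_diff[OF BI fin] .
    have "card B + 2 \<le> r"
      using bnd_length_or_subset_sums(2)[OF Z bnd_length_idx[OF Z sg_tor[OF Z] ix] less.prems(1) gZ B_def]
        less.prems(3,4) unfolding B_def by blast
    then have "(\<Sum>i\<in>B. wz Z (g i)) \<le> (real r - 2) / real r"
      using oB by (simp add: wz_def divide_right_mono)
    then have sB: "(\<Sum>i\<in>B. wz Z (g i)) \<le> 1 - 2 / real r" using r2 by (simp add: diff_divide_distrib)
    have cover: "I - B \<subseteq> A \<union> (\<Union>d\<in>?D. M d)"
    proof
      fix i assume i: "i \<in> I - B"
      have ti: "g i \<in> tor Z (e * r)" using i gN by auto
      have "oz Z (g i) dvd e * r" using oz_dvd[OF Z ti pos(2)] ti by blast
      then obtain d f where df: "oz Z (g i) = d * f" "d dvd e" "f dvd r"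
        using division_decomp by blast
      have "f = 1 \<or> f = r" using df r prime_nat_iff by blast
      moreover have "g i \<in> tor Z e" if "f = 1"
        using oz_dvd[OF Z ti pos(2), of e] df that by simp
      moreover have "i \<in> (\<Union>d\<in>?D. M d)" if "f = r"
      proof -
        have "d \<noteq> 0" using df(2) e by auto
        moreover have "d \<noteq> 1"
          using oz_dvd[OF Z ti pos(2), of r] df that i by (auto simp: B_def)
        ultimately have "d \<in> ?D" "i \<in> M d" using i df that by (auto simp: M_def mult_ac)
        then show ?thesis by blast
      qed
      ultimately show "i \<in> A \<union> (\<Union>d\<in>?D. M d)" using i by (auto simp: A_def)
    qed
    have "(\<Sum>i\<in>I - B. wz Z (g i)) \<le> (\<Sum>i\<in>A \<union> (\<Union>d\<in>?D. M d). wz Z (g i))"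
      using cover fin finD by (intro sum_mono2) (auto simp: A_def M_def wz_nonneg)
    also have "\<dots> \<le> (\<Sum>i\<in>A. wz Z (g i)) + (\<Sum>i\<in>(\<Union>d\<in>?D. M d). wz Z (g i))"
    proof -
      have "finite A" "finite (\<Union>d\<in>?D. M d)" using fin finD by (auto simp: A_def M_def)
      then show ?thesis by (simp add: sum_Un sum_nonneg wz_nonneg)
    qed
    also have "(\<Sum>i\<in>(\<Union>d\<in>?D. M d). wz Z (g i)) \<le> (\<Sum>d\<in>?D. \<Sum>i\<in>M d. wz Z (g i))"
      using fin finD by (intro sum_UN_le) (auto simp: M_def wz_nonneg)
    also have "\<dots> \<le> (\<Sum>d\<in>?D. 1 / real d)"
    proof (rule sum_mono)
      fix d assume d: "d \<in> ?D"
      have "(\<Sum>i\<in>M d. wz Z (g i)) = real (card (M d)) / (real r * real d)"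
        by (simp add: wz_def M_def)
      also have "\<dots> \<le> real r / (real r * real d)"
        using a[OF d] by (intro divide_right_mono) auto
      finally show "(\<Sum>i\<in>M d. wz Z (g i)) \<le> 1 / real d"
        using r2 by simp
    qed
    also have "(\<Sum>i\<in>A. wz Z (g i)) \<le> \<kappa>"
      using less.prems ucl_subset[OF uc, of A]
      by (intro bnd_ucl[OF Z sg_tor[OF Z] sub_tor[OF Z] b wz_nonneg]) (auto simp: A_def)
    finally show ?thesis using splitB sB D by linarith
  qed
qed

text \<open>The summand 1 comes from at most \<open>r\<close> elements of order \<open>r\<close>.
  Equality excludes a missing subset sum, so the other elements attain \<open>\<kappa>\<close> after
  projection and hence already lie in \<open>tor Z e\<close>.\<close>

lemma cross_bound_plus_prime_cyclic:
  fixes g :: "'i \<Rightarrow> 'a::ab_group_add"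
  assumes Z: "sg Z" and r: "prime r" and cop: "coprime e r" and e: "0 < e"
    and ix: "idx Z (tor Z r) r" and b: "bnd Z (tor Z e) (wz Z) \<kappa>"
    and D: "(\<Sum>d | d dvd e \<and> 1 < d. 1 / real d) < 2 / real r"
    and u: "UF Z g I" and gI: "g ` I \<subseteq> tor Z (e * r) - Z"
  shows "(\<Sum>i\<in>I. wz Z (g i)) \<le> 1 + \<kappa>"
    and "(\<Sum>i\<in>I. wz Z (g i)) = 1 + \<kappa> \<Longrightarrow> \<forall>i\<in>I. g i \<in> tor Z e \<or> g i \<in> tor Z r"
proof -
  define B where "B = {i\<in>I. g i \<in> tor Z r}"
  have r0: "0 < r" using r by (simp add: prime_gt_0_nat)
  have gZ: "g ` I \<inter> Z = {}" using gI by auto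
  have fin: "finite I" using u ucl_finite by (auto simp: UF_def)
  have BI: "B \<subseteq> I" by (auto simp: B_def)
  have splitB: "(\<Sum>i\<in>I. wz Z (g i)) = (\<Sum>i\<in>I - B. wz Z (g i)) + (\<Sum>i\<in>B. wz Z (g i))"
    using sum.subset_diff[OF BI fin] .
  have oB: "oz Z (g i) = r" if "i \<in> B" for i
  proof -
    have i: "g i \<in> tor Z r" "g i \<notin> Z" using that gZ by (auto simp: B_def)
    then have "oz Z (g i) dvd r" "oz Z (g i) \<noteq> 1"
      using oz_dvd[OF Z i(1) r0, of r] oz_dvd[OF Z i(1) r0, of 1] by auto
    then show ?thesis using r prime_nat_iff by blast
  qed
  have "card B \<le> r"
    using bnd_length_or_subset_sums(1)[OF Z bnd_length_idx[OF Z sg_tor[OF Z] ix] u gZ B_def] .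
  then have "(\<Sum>i\<in>B. wz Z (g i)) \<le> real r / real r"
    using oB by (simp add: wz_def divide_right_mono)
  then have sB: "(\<Sum>i\<in>B. wz Z (g i)) \<le> 1" using r0 by simp
  show "(\<Sum>i\<in>I. wz Z (g i)) \<le> 1 + \<kappa>"
    and "(\<Sum>i\<in>I. wz Z (g i)) = 1 + \<kappa> \<Longrightarrow> \<forall>i\<in>I. g i \<in> tor Z e \<or> g i \<in> tor Z r"
  proof (atomize (full), cases "\<forall>x\<in>tor Z r. \<exists>K\<subseteq>B. x - sum g K \<in> Z")
    case True
    note P = project_if_all_subset_sums[OF Z cop e r0 u gI B_def bspec[OF True] b]
    have "\<forall>i\<in>I. g i \<in> tor Z e \<or> g i \<in> tor Z r" if "(\<Sum>i\<in>I. wz Z (g i)) = 1 + \<kappa>"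
    proof -
      have "(\<Sum>i\<in>I - B. wz Z (g i)) = \<kappa>" using that P(1) splitB sB by linarith
      then have "\<forall>i\<in>I - B. g i \<in> tor Z e" using P(2) by blast
      then show ?thesis by (auto simp: B_def)
    qed
    moreover have "(\<Sum>i\<in>I. wz Z (g i)) \<le> 1 + \<kappa>" using P(1) splitB sB by linarith
    ultimately show "(\<Sum>i\<in>I. wz Z (g i)) \<le> 1 + \<kappa> \<and>
      ((\<Sum>i\<in>I. wz Z (g i)) = 1 + \<kappa> \<longrightarrow> (\<forall>i\<in>I. g i \<in> tor Z e \<or> g i \<in> tor Z r))" by blast
  next
    case False
    then obtain x where x: "x \<in> tor Z r" "\<And>K. K \<subseteq> B \<Longrightarrow> x - sum g K \<notin> Z" by blast
    have "(\<Sum>i\<in>I. wz Z (g i)) < 1 + \<kappa>"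
      using divisor_sum_bound_nonfull[OF Z r cop e ix b D u gI x(1)] x(2) unfolding B_def by blast
    then show "(\<Sum>i\<in>I. wz Z (g i)) \<le> 1 + \<kappa> \<and>
      ((\<Sum>i\<in>I. wz Z (g i)) = 1 + \<kappa> \<longrightarrow> (\<forall>i\<in>I. g i \<in> tor Z e \<or> g i \<in> tor Z r))" by simp
  qed
qed

section \<open>Polynomial functions modulo a prime\<close>

text \<open>\<open>PW p m\<close>: functions congruent modulo \<open>p\<close> to a polynomial of degree less than \<open>m\<close>. The shift by
  one lets truncated subtraction describe the effect of difference operators.\<close>

inductive PW :: "int \<Rightarrow> nat \<Rightarrow> (int \<times> int \<Rightarrow> int) \<Rightarrow> bool" for p where
  PW_zero: "PW p m (\<lambda>_. 0)"
| PW_const: "PW p (Suc m) (\<lambda>_. c)"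
| PW_fst: "PW p m F \<Longrightarrow> PW p (Suc m) (\<lambda>z. fst z * F z)"
| PW_snd: "PW p m F \<Longrightarrow> PW p (Suc m) (\<lambda>z. snd z * F z)"
| PW_add: "PW p m F \<Longrightarrow> PW p m G \<Longrightarrow> PW p m (\<lambda>z. F z + G z)"
| PW_cong: "PW p m F \<Longrightarrow> (\<And>z. p dvd F z - G z) \<Longrightarrow> PW p m G"

lemma PW_0: "PW p 0 F \<Longrightarrow> p dvd F z"
proof -
  have "m = 0 \<Longrightarrow> \<forall>z. p dvd F z" if "PW p m F" for m F
    using that
  proof (induction rule: PW.induct)
    case (PW_cong m F G)
    then show ?case by (metis dvd_diff_commute dvd_diff_right_iff)
  qed auto
  then show "PW p 0 F \<Longrightarrow> p dvd F z" by blast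
qed

lemma PW_all_dvd: "(\<And>z. p dvd F z) \<Longrightarrow> PW p m F"
  by (rule PW_cong[OF PW_zero]) simp

lemma PW_Suc: "PW p m F \<Longrightarrow> PW p (Suc m) F"
proof (induction rule: PW.induct)
  case (PW_cong m F G)
  then show ?case by (blast intro: PW.PW_cong)
qed (intro PW.PW_zero PW.PW_const PW.PW_fst PW.PW_snd PW.PW_add; assumption)+

lemma PW_mono: "PW p m F \<Longrightarrow> m \<le> n \<Longrightarrow> PW p n F"
  by (induction n) (auto simp: le_Suc_eq intro: PW_Suc)

lemma PW_scale: "PW p m F \<Longrightarrow> PW p m (\<lambda>z. c * F z)"
proof (induction rule: PW.induct)
  case (PW_fst m F)
  then show ?case using PW.PW_fst[of p m "\<lambda>z. c * F z"] by (simp add: mult.left_commute)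
next
  case (PW_snd m F)
  then show ?case using PW.PW_snd[of p m "\<lambda>z. c * F z"] by (simp add: mult.left_commute)
next
  case (PW_add m F G)
  then show ?case using PW.PW_add[OF PW_add.IH] by (simp add: distrib_left)
next
  case (PW_cong m F G)
  show ?case
  proof (rule PW.PW_cong[OF PW_cong.IH])
    fix z show "p dvd c * F z - c * G z"
      using PW_cong.hyps(2)[of z] by (simp flip: right_diff_distrib)
  qed
qed (simp_all add: PW.PW_zero PW.PW_const PW.PW_add)

lemma PW_diff: "PW p m F \<Longrightarrow> PW p m G \<Longrightarrow> PW p m (\<lambda>z. F z - G z)"
  using PW_add[of p m F "\<lambda>z. (-1) * G z"] PW_scale[of p m G "-1"] by simp

lemma PW_shift: "PW p m F \<Longrightarrow> PW p m (\<lambda>z. F (z + w))"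
proof (induction rule: PW.induct)
  case (PW_fst m F)
  have "PW p (Suc m) (\<lambda>z. fst z * F (z + w) + fst w * F (z + w))"
    using PW_fst.IH by (intro PW.PW_add PW.PW_fst PW_scale PW_Suc)
  then show ?case by (simp add: distrib_right)
next
  case (PW_snd m F)
  have "PW p (Suc m) (\<lambda>z. snd z * F (z + w) + snd w * F (z + w))"
    using PW_snd.IH by (intro PW.PW_add PW.PW_snd PW_scale PW_Suc)
  then show ?case by (simp add: distrib_right)
next
  case (PW_cong m F G)
  then show ?case by (blast intro: PW.PW_cong)
qed (simp_all add: PW.PW_zero PW.PW_const PW.PW_add)

text \<open>Truncation is harmless: if \<open>m < k\<close>, then \<open>F\<close> already vanishes
  modulo \<open>p\<close>, and so does its product with a coordinate.\<close>

lemma PW_fst_sub: "PW p (m - k) F \<Longrightarrow> PW p (Suc m - k) (\<lambda>z. fst z * F z)"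
  and PW_snd_sub: "PW p (m - k) F \<Longrightarrow> PW p (Suc m - k) (\<lambda>z. snd z * F z)"
  using PW_fst[of p "m - k" F] PW_snd[of p "m - k" F] PW_0[of p F] PW_all_dvd[of p _ "Suc m - k"]
  by (cases "k \<le> m"; simp add: Suc_diff_le)+

lemma PW_difference: "PW p m F \<Longrightarrow> PW p (m - 1) (\<lambda>z. F (z + w) - F z)"
proof (induction rule: PW.induct)
  case (PW_fst m F)
  have "PW p (Suc m - 1) (\<lambda>z. fst z * (F (z + w) - F z) + fst w * F (z + w))"
    using PW_fst_sub[OF PW_fst.IH] PW_scale[OF PW_shift[OF PW_fst.hyps, of w], of "fst w"]
    by (intro PW.PW_add) simp_all
  then show ?case by (simp add: algebra_simps)
next
  case (PW_snd m F)
  have "PW p (Suc m - 1) (\<lambda>z. snd z * (F (z + w) - F z) + snd w * F (z + w))"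
    using PW_snd_sub[OF PW_snd.IH] PW_scale[OF PW_shift[OF PW_snd.hyps, of w], of "snd w"]
    by (intro PW.PW_add) simp_all
  then show ?case by (simp add: algebra_simps)
next
  case (PW_add m F G)
  then show ?case using PW.PW_add[OF PW_add.IH] by (simp add: algebra_simps)
next
  case (PW_cong m F G)
  show ?case
  proof (rule PW.PW_cong[OF PW_cong.IH])
    fix z show "p dvd F (z + w) - F z - (G (z + w) - G z)"
      using dvd_diff[OF PW_cong.hyps(2)[of "z + w"] PW_cong.hyps(2)[of z]] by (simp add: algebra_simps)
  qed
qed (simp_all add: PW.PW_zero PW.PW_const PW.PW_add)

lemma PW_central_difference:
  assumes "PW p m F"
  shows "PW p (m - 1) (\<lambda>z. F (z + w) - F (z - w))"
  using PW_diff[OF PW_difference[OF assms, of w] PW_difference[OF assms, of "- w"]] by simp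

text \<open>By the product rule, the second difference of a coordinate times \<open>F\<close> is the
  coordinate times that of \<open>F\<close> plus a constant times a central difference of
  \<open>F\<close>; each has the right degree.\<close>

lemma PW_second_difference: "PW p m F \<Longrightarrow> PW p (m - 2) (\<lambda>z. F (z + w) + F (z - w) - 2 * F z)"
proof (induction rule: PW.induct)
  case (PW_fst m F)
  have "PW p (Suc m - 2) (\<lambda>z. fst z * (F (z + w) + F (z - w) - 2 * F z) + fst w * (F (z + w) - F (z - w)))"
    using PW_fst_sub[OF PW_fst.IH] PW_scale[OF PW_central_difference[OF PW_fst.hyps, of w], of "fst w"]
    by (intro PW.PW_add) (simp_all add: numeral_2_eq_2)
  then show ?case by (simp add: algebra_simps)
next
  case (PW_snd m F)
  have "PW p (Suc m - 2) (\<lambda>z. snd z * (F (z + w) + F (z - w) - 2 * F z) + snd w * (F (z + w) - F (z - w)))"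
    using PW_snd_sub[OF PW_snd.IH] PW_scale[OF PW_central_difference[OF PW_snd.hyps, of w], of "snd w"]
    by (intro PW.PW_add) (simp_all add: numeral_2_eq_2)
  then show ?case by (simp add: algebra_simps)
next
  case (PW_add m F G)
  then show ?case using PW.PW_add[OF PW_add.IH] by (simp add: algebra_simps)
next
  case (PW_cong m F G)
  show ?case
  proof (rule PW.PW_cong[OF PW_cong.IH])
    fix z show "p dvd F (z + w) + F (z - w) - 2 * F z - (G (z + w) + G (z - w) - 2 * G z)"
      using dvd_diff[OF dvd_add[OF PW_cong.hyps(2)[of "z + w"] PW_cong.hyps(2)[of "z - w"]]
        dvd_mult[OF PW_cong.hyps(2)[of z], of 2]] by (simp add: algebra_simps)
  qed
qed (simp_all add: PW.PW_zero PW.PW_const PW.PW_add)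

text \<open>A central difference has only terms of odd order in the step, so its linear part
  \<open>G1, G2\<close> determines it up to three degrees below \<open>F\<close>.\<close>

lemma PW_taylor:
  "PW p m F \<Longrightarrow> \<exists>G1 G2. PW p (m - 1) G1 \<and> PW p (m - 1) G2 \<and>
     (\<forall>w. PW p (m - 3) (\<lambda>z. F (z + w) - F (z - w) - 2 * (fst w * G1 z + snd w * G2 z)))"
proof (induction rule: PW.induct)
  case (PW_zero m)
  show ?case by (intro exI[of _ "\<lambda>_. 0"]) (simp add: PW.PW_zero)
next
  case (PW_const m c)
  show ?case by (intro exI[of _ "\<lambda>_. 0"]) (simp add: PW.PW_zero)
next
  case (PW_fst m F)
  then obtain G1 G2 where G: "PW p (m - 1) G1" "PW p (m - 1) G2"
    "\<And>w. PW p (m - 3) (\<lambda>z. F (z + w) - F (z - w) - 2 * (fst w * G1 z + snd w * G2 z))" by blast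
  \<comment> \<open>The product rule for the first partial derivative of \<open>fst z * F z\<close>;
    the additional error term is a second difference of \<open>F\<close>.\<close>
  have "PW p (Suc m - 1) (\<lambda>z. fst z * G1 z + F z)"
    using PW_fst_sub[OF G(1)] PW_fst.hyps by (intro PW.PW_add) simp_all
  moreover have "PW p (Suc m - 1) (\<lambda>z. fst z * G2 z)"
    using PW_fst_sub[OF G(2)] .
  moreover have "PW p (Suc m - 3) (\<lambda>z. fst (z + w) * F (z + w) - fst (z - w) * F (z - w) -
      2 * (fst w * (fst z * G1 z + F z) + snd w * (fst z * G2 z)))" for w
  proof -
    have "PW p (Suc m - 3) (\<lambda>z. fst z * (F (z + w) - F (z - w) - 2 * (fst w * G1 z + snd w * G2 z)) +
        fst w * (F (z + w) + F (z - w) - 2 * F z))"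
      using PW_fst_sub[OF G(3)[of w]] PW_scale[OF PW_second_difference[OF PW_fst.hyps, of w], of "fst w"]
      by (intro PW.PW_add) (simp_all add: numeral_3_eq_3 numeral_2_eq_2)
    then show ?thesis by (simp add: algebra_simps)
  qed
  ultimately show ?case
    by (intro exI[of _ "\<lambda>z. fst z * G1 z + F z"] exI[of _ "\<lambda>z. fst z * G2 z"]) blast
next
  case (PW_snd m F)
  then obtain G1 G2 where G: "PW p (m - 1) G1" "PW p (m - 1) G2"
    "\<And>w. PW p (m - 3) (\<lambda>z. F (z + w) - F (z - w) - 2 * (fst w * G1 z + snd w * G2 z))" by blast
  have "PW p (Suc m - 1) (\<lambda>z. snd z * G2 z + F z)"
    using PW_snd_sub[OF G(2)] PW_snd.hyps by (intro PW.PW_add) simp_all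
  moreover have "PW p (Suc m - 1) (\<lambda>z. snd z * G1 z)"
    using PW_snd_sub[OF G(1)] .
  moreover have "PW p (Suc m - 3) (\<lambda>z. snd (z + w) * F (z + w) - snd (z - w) * F (z - w) -
      2 * (fst w * (snd z * G1 z) + snd w * (snd z * G2 z + F z)))" for w
  proof -
    have "PW p (Suc m - 3) (\<lambda>z. snd z * (F (z + w) - F (z - w) - 2 * (fst w * G1 z + snd w * G2 z)) +
        snd w * (F (z + w) + F (z - w) - 2 * F z))"
      using PW_snd_sub[OF G(3)[of w]] PW_scale[OF PW_second_difference[OF PW_snd.hyps, of w], of "snd w"]
      by (intro PW.PW_add) (simp_all add: numeral_3_eq_3 numeral_2_eq_2)
    then show ?thesis by (simp add: algebra_simps)
  qed
  ultimately show ?case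
    by (intro exI[of _ "\<lambda>z. snd z * G1 z"] exI[of _ "\<lambda>z. snd z * G2 z + F z"]) blast
next
  case (PW_add m F G)
  then obtain F1 F2 G1 G2 where FG: "PW p (m - 1) F1" "PW p (m - 1) F2"
    "\<And>w. PW p (m - 3) (\<lambda>z. F (z + w) - F (z - w) - 2 * (fst w * F1 z + snd w * F2 z))"
    "PW p (m - 1) G1" "PW p (m - 1) G2"
    "\<And>w. PW p (m - 3) (\<lambda>z. G (z + w) - G (z - w) - 2 * (fst w * G1 z + snd w * G2 z))" by blast
  have "PW p (m - 3) (\<lambda>z. F (z + w) + G (z + w) - (F (z - w) + G (z - w)) -
      2 * (fst w * (F1 z + G1 z) + snd w * (F2 z + G2 z)))" for w
    using PW.PW_add[OF FG(3)[of w] FG(6)[of w]] by (simp add: algebra_simps)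
  then show ?case
    using PW.PW_add[OF FG(1,4)] PW.PW_add[OF FG(2,5)]
    by (intro exI[of _ "\<lambda>z. F1 z + G1 z"] exI[of _ "\<lambda>z. F2 z + G2 z"]) blast
next
  case (PW_cong m F G)
  then obtain G1 G2 where G: "PW p (m - 1) G1" "PW p (m - 1) G2"
    "\<And>w. PW p (m - 3) (\<lambda>z. F (z + w) - F (z - w) - 2 * (fst w * G1 z + snd w * G2 z))" by blast
  have "PW p (m - 3) (\<lambda>z. G (z + w) - G (z - w) - 2 * (fst w * G1 z + snd w * G2 z))" for w
  proof (rule PW.PW_cong[OF G(3)[of w]])
    fix z show "p dvd F (z + w) - F (z - w) - 2 * (fst w * G1 z + snd w * G2 z) -
        (G (z + w) - G (z - w) - 2 * (fst w * G1 z + snd w * G2 z))"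
      using dvd_diff[OF PW_cong.hyps(2)[of "z + w"] PW_cong.hyps(2)[of "z - w"]] by (simp add: algebra_simps)
  qed
  then show ?case using G by blast
qed

section \<open>Periodicity modulo p and the three-term operator\<close>

definition pz :: "int \<Rightarrow> (int \<times> int) set" where
  "pz p = {z. p dvd fst z \<and> p dvd snd z}"

lemma sg_pz: "sg (pz p)"
  by (auto simp: sg_def pz_def)

lemma PW_periodic: "PW p m F \<Longrightarrow> w \<in> pz p \<Longrightarrow> p dvd F (z + w) - F z"
proof (induction arbitrary: z rule: PW.induct)
  case (PW_fst m F)
  have "fst (z + w) * F (z + w) - fst z * F z = fst z * (F (z + w) - F z) + fst w * F (z + w)"
    by (simp add: algebra_simps)
  then show ?case using PW_fst by (simp add: pz_def del: fst_add)
next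
  case (PW_snd m F)
  have "snd (z + w) * F (z + w) - snd z * F z = snd z * (F (z + w) - F z) + snd w * F (z + w)"
    by (simp add: algebra_simps)
  then show ?case using PW_snd by (simp add: pz_def del: snd_add)
next
  case (PW_add m F G)
  then show ?case using dvd_add[OF PW_add.IH(1)[of z] PW_add.IH(2)[of z]] by (simp add: add_diff_add)
next
  case (PW_cong m F G)
  have "G (z + w) - G z = (F (z + w) - F z) - (F (z + w) - G (z + w)) + (F z - G z)" by simp
  then show ?case using PW_cong.IH PW_cong.hyps(2) PW_cong.prems by (metis dvd_add dvd_diff)
qed simp_all

lemma PW_dvd_diff:
  assumes "PW p m F" "x - y \<in> pz p"
  shows "p dvd F x - F y"
  using PW_periodic[OF assms, of y] by (simp add: algebra_simps)

text \<open>The operator \<open>l (1 - T_a)(1 + T_{b+d}) + u (1 - T_b)(1 + T_{a+d}) + v (1 - T_d)(1 + T_{a+b})\<close> in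
  the translations \<open>T\<close>. Around the midpoint of \<open>0\<close> and \<open>a + b + d\<close> it is a combination of central
  differences, whose linear parts cancel if \<open>l a + u b + v d\<close> vanishes.\<close>

lemma PW_triple_operator:
  assumes F: "PW p m F" and p: "odd p"
    and rel: "p dvd l * fst a + u * fst b + v * fst d" "p dvd l * snd a + u * snd b + v * snd d"
  shows "PW p (m - 3) (\<lambda>z. (l + u + v) * F z - l * F (z + a) - u * F (z + b) - v * F (z + d)
    + l * F (z + b + d) + u * F (z + a + d) + v * F (z + a + b) - (l + u + v) * F (z + a + b + d))"
proof -
  define s where "s = a + b + d"
  \<comment> \<open>\<open>k\<close> inverts 2 modulo the odd \<open>p\<close>, so \<open>h\<close>
    is half of \<open>s\<close> up to an element of \<open>pz p\<close>, to which \<open>F\<close>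
    is insensitive.\<close>
  define k where "k = (p + 1) div 2"
  have k: "2 * k = p + 1" using p by (auto simp: k_def elim: oddE)
  define h where "h = (k * fst s, k * snd s)"
  have h2: "h + h - s \<in> pz p"
  proof -
    have "k * x + k * x - x = p * x" for x
    proof -
      have "k * x + k * x - x = (2 * k - 1) * x" by (simp add: algebra_simps)
      then show ?thesis using k by simp
    qed
    then have "fst (h + h - s) = p * fst s" "snd (h + h - s) = p * snd s"
      unfolding h_def by (simp_all only: fst_diff fst_add snd_diff snd_add fst_conv snd_conv)
    then show ?thesis unfolding pz_def by simp
  qed
  obtain G1 G2 where G: "PW p (m - 1) G1" "PW p (m - 1) G2"
    and T: "\<And>w. PW p (m - 3) (\<lambda>z. F (z + w) - F (z - w) - 2 * (fst w * G1 z + snd w * G2 z))"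
    using PW_taylor[OF F] by blast
  define E where "E w z = F (z + w) - F (z - w) - 2 * (fst w * G1 z + snd w * G2 z)" for w z
  have E: "PW p (m - 3) (E w)" for w using T[of w] unfolding E_def .
  \<comment> \<open>The steps \<open>h - a\<close>, \<open>h - b\<close>, \<open>h - d\<close> and
    \<open>h\<close> enter with weights \<open>l\<close>, \<open>u\<close>, \<open>v\<close> and
    \<open>-(l + u + v)\<close>. Their weighted sum is \<open>-(l a + u b + v d)\<close>, which
    vanishes modulo \<open>p\<close>.\<close>
  have "PW p (m - 3) (\<lambda>z. l * E (h - a) (z + h) + u * E (h - b) (z + h) + v * E (h - d) (z + h)
    - (l + u + v) * E h (z + h))"
    using E by (intro PW_diff PW_add PW_scale PW_shift)
  then show ?thesis
  proof (rule PW_cong)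
    fix z
    let ?y = "z + h"
    have c1: "p dvd F (?y + h) - F (z + a + b + d)"
      by (rule PW_dvd_diff[OF F]) (use h2 in \<open>simp add: s_def algebra_simps\<close>)
    have c2: "p dvd F (?y + (h - a)) - F (z + b + d)"
      by (rule PW_dvd_diff[OF F]) (use h2 in \<open>simp add: s_def algebra_simps\<close>)
    have c3: "p dvd F (?y + (h - b)) - F (z + a + d)"
      by (rule PW_dvd_diff[OF F]) (use h2 in \<open>simp add: s_def algebra_simps\<close>)
    have c4: "p dvd F (?y + (h - d)) - F (z + a + b)"
      by (rule PW_dvd_diff[OF F]) (use h2 in \<open>simp add: s_def algebra_simps\<close>)
    have eq: "?y - h = z" "?y - (h - a) = z + a" "?y - (h - b) = z + b" "?y - (h - d) = z + d"
      by (simp_all add: algebra_simps)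
    let ?D1 = "F (?y + h) - F (z + a + b + d)" and ?D2 = "F (?y + (h - a)) - F (z + b + d)"
      and ?D3 = "F (?y + (h - b)) - F (z + a + d)" and ?D4 = "F (?y + (h - d)) - F (z + a + b)"
    have "l * E (h - a) ?y + u * E (h - b) ?y + v * E (h - d) ?y - (l + u + v) * E h ?y -
      ((l + u + v) * F z - l * F (z + a) - u * F (z + b) - v * F (z + d)
       + l * F (z + b + d) + u * F (z + a + d) + v * F (z + a + b) - (l + u + v) * F (z + a + b + d))
      = l * ?D2 + u * ?D3 + v * ?D4 - (l + u + v) * ?D1
        + 2 * (l * fst a + u * fst b + v * fst d) * G1 ?y + 2 * (l * snd a + u * snd b + v * snd d) * G2 ?y"
      unfolding E_def eq by (simp add: algebra_simps)
    moreover have "p dvd l * ?D2 + u * ?D3 + v * ?D4 - (l + u + v) * ?D1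
        + 2 * (l * fst a + u * fst b + v * fst d) * G1 ?y + 2 * (l * snd a + u * snd b + v * snd d) * G2 ?y"
      by (intro dvd_add dvd_diff dvd_mult[OF c1] dvd_mult[OF c2] dvd_mult[OF c3] dvd_mult[OF c4]
        dvd_mult2[OF dvd_mult[OF rel(1)]] dvd_mult2[OF dvd_mult[OF rel(2)]])
    ultimately show "p dvd l * E (h - a) ?y + u * E (h - b) ?y + v * E (h - d) ?y - (l + u + v) * E h ?y -
      ((l + u + v) * F z - l * F (z + a) - u * F (z + b) - v * F (z + d)
       + l * F (z + b + d) + u * F (z + a + d) + v * F (z + a + b) - (l + u + v) * F (z + a + b + d))"
      by simp
  qed
qed

section \<open>Unique factorization over a group of type (p, p)\<close>

text \<open>A group ring element supported on subset sums, acting by translations T. With the signs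
  \<open>(-1) ^ card K\<close> it is the product of the factors 1 - T_(g i).\<close>

definition opr :: "('i set \<Rightarrow> int) \<Rightarrow> 'i set \<Rightarrow> ('i \<Rightarrow> int \<times> int) \<Rightarrow> (int \<times> int \<Rightarrow> int) \<Rightarrow> int \<times> int \<Rightarrow> int" where
  "opr \<mu> X g F = (\<lambda>z. \<Sum>K\<in>Pow X. \<mu> K * F (z + sum g K))"

lemma sum_Pow_Un:
  fixes f :: "'i set \<Rightarrow> 'b::comm_monoid_add"
  assumes "X \<inter> Y = {}"
  shows "sum f (Pow (X \<union> Y)) = (\<Sum>K\<in>Pow X. \<Sum>L\<in>Pow Y. f (K \<union> L))"
proof -
  have "(\<Sum>K\<in>Pow X. \<Sum>L\<in>Pow Y. f (K \<union> L)) = (\<Sum>(K, L)\<in>Pow X \<times> Pow Y. f (K \<union> L))"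
    by (rule sum.cartesian_product)
  also have "\<dots> = sum f (Pow (X \<union> Y))"
    by (rule sum.reindex_bij_witness[where i = "\<lambda>M. (M \<inter> X, M \<inter> Y)" and j = "\<lambda>(K, L). K \<union> L"])
      (use assms in auto)
  finally show ?thesis by simp
qed

text \<open>Translations compose additively, so the coefficients of a composition over disjoint
  index sets multiply.\<close>

lemma opr_Un:
  assumes "X \<inter> Y = {}" "finite X" "finite Y"
  shows "opr (\<lambda>K. \<mu> (K \<inter> X) * \<nu> (K \<inter> Y)) (X \<union> Y) g F = opr \<mu> X g (opr \<nu> Y g F)"
proof
  fix z
  have "opr (\<lambda>K. \<mu> (K \<inter> X) * \<nu> (K \<inter> Y)) (X \<union> Y) g F z =
    (\<Sum>K\<in>Pow X. \<Sum>L\<in>Pow Y. \<mu> ((K \<union> L) \<inter> X) * \<nu> ((K \<union> L) \<inter> Y) * F (z + sum g (K \<union> L)))"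
    unfolding opr_def by (rule sum_Pow_Un[OF assms(1)])
  also have "\<dots> = (\<Sum>K\<in>Pow X. \<Sum>L\<in>Pow Y. \<mu> K * (\<nu> L * F (z + sum g K + sum g L)))"
  proof (intro sum.cong refl)
    fix K L assume KL: "K \<in> Pow X" "L \<in> Pow Y"
    then have "(K \<union> L) \<inter> X = K" "(K \<union> L) \<inter> Y = L" using assms(1) by auto
    moreover have "sum g (K \<union> L) = sum g K + sum g L"
      by (rule sum.union_disjoint) (use KL assms in \<open>auto intro: finite_subset\<close>)
    ultimately show "\<mu> ((K \<union> L) \<inter> X) * \<nu> ((K \<union> L) \<inter> Y) * F (z + sum g (K \<union> L)) =
        \<mu> K * (\<nu> L * F (z + sum g K + sum g L))"
      by (simp add: add.assoc)
  qed
  also have "\<dots> = opr \<mu> X g (opr \<nu> Y g F) z"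
    by (simp add: opr_def sum_distrib_left)
  finally show "opr (\<lambda>K. \<mu> (K \<inter> X) * \<nu> (K \<inter> Y)) (X \<union> Y) g F z = opr \<mu> X g (opr \<nu> Y g F) z" .
qed

lemma opr_cong: "(\<And>K. K \<subseteq> X \<Longrightarrow> \<mu> K = \<nu> K) \<Longrightarrow> opr \<mu> X g F = opr \<nu> X g F"
  by (auto simp: opr_def intro!: ext sum.cong)

lemma PW_opr_difference:
  assumes "finite X"
  shows "PW p m F \<Longrightarrow> PW p (m - card X) (opr (\<lambda>K. (-1) ^ card K) X g F)"
  using assms
proof (induction X rule: finite_induct)
  case empty
  then show ?case by (simp add: opr_def)
next
  case (insert a X)
  let ?s = "\<lambda>K::'b set. (-1::int) ^ card K"
  have "opr ?s (insert a X) g F = opr (\<lambda>K. ?s (K \<inter> {a}) * ?s (K \<inter> X)) ({a} \<union> X) g F"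
  proof -
    have "?s K = ?s (K \<inter> {a}) * ?s (K \<inter> X)" if "K \<subseteq> insert a X" for K
    proof -
      have "finite K" using that insert.hyps(1) finite_subset by auto
      moreover have "K = (K \<inter> {a}) \<union> (K \<inter> X)" "(K \<inter> {a}) \<inter> (K \<inter> X) = {}" using that insert.hyps by auto
      ultimately have "card K = card (K \<inter> {a}) + card (K \<inter> X)"
        by (metis card_Un_disjoint finite_Int)
      then show ?thesis by (simp add: power_add)
    qed
    then show ?thesis by (auto intro: opr_cong)
  qed
  also have "\<dots> = opr ?s {a} g (opr ?s X g F)"
    by (rule opr_Un) (use insert.hyps in auto)
  also have "\<dots> = (\<lambda>z. - (opr ?s X g F (z + g a) - opr ?s X g F z))"
    by (auto simp: opr_def[of _ "{a}"] Pow_insert)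
  finally have "opr ?s (insert a X) g F = (\<lambda>z. (-1) * (opr ?s X g F (z + g a) - opr ?s X g F z))" by simp
  moreover have "PW p (m - card X - 1) (\<lambda>z. (-1) * (opr ?s X g F (z + g a) - opr ?s X g F z))"
    using insert by (intro PW_scale PW_difference)
  ultimately show ?case using insert.hyps by simp
qed

text \<open>\<open>Good p g X n\<close>: some combination of translations by subset sums of \<open>X\<close> lowers degrees by \<open>n\<close>,
  while the coefficients of its zero-sum subsets do not add up to zero.\<close>

definition Good :: "int \<Rightarrow> ('i \<Rightarrow> int \<times> int) \<Rightarrow> 'i set \<Rightarrow> nat \<Rightarrow> bool" where
  "Good p g X n \<longleftrightarrow> (\<exists>\<mu>. (\<forall>m F. PW p m F \<longrightarrow> PW p (m - n) (opr \<mu> X g F)) \<and>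
     \<not> p dvd (\<Sum>K\<in>Pow X. if sum g K \<in> pz p then \<mu> K else 0))"

lemma Good_empty: "1 < p \<Longrightarrow> Good p g {} 0"
  unfolding Good_def by (intro exI[of _ "\<lambda>_. 1"]) (auto simp: opr_def pz_def zdvd_not_zless)

text \<open>Composing the operators adds the drops in degree. The weights on zero-sum subsets
  multiply, because by closure a zero-sum subset of the union has zero-sum traces on
  \<open>X\<close> and \<open>Y\<close>.\<close>

lemma Good_Un:
  assumes p: "prime p" and u: "ucl (pz p) g I" and X: "X \<subseteq> I" "Y \<subseteq> I" "X \<inter> Y = {}"
    and z: "sum g X \<in> pz p" "sum g Y \<in> pz p" and G: "Good p g X n" "Good p g Y k"
  shows "Good p g (X \<union> Y) (n + k)"
proof -
  have fin: "finite X" "finite Y" using X u ucl_finite finite_subset by blast+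
  obtain \<mu> \<nu> where \<mu>: "\<And>m F. PW p m F \<Longrightarrow> PW p (m - n) (opr \<mu> X g F)"
    "\<not> p dvd (\<Sum>K\<in>Pow X. if sum g K \<in> pz p then \<mu> K else 0)"
    and \<nu>: "\<And>m F. PW p m F \<Longrightarrow> PW p (m - k) (opr \<nu> Y g F)"
    "\<not> p dvd (\<Sum>K\<in>Pow Y. if sum g K \<in> pz p then \<nu> K else 0)"
    using G unfolding Good_def by blast
  let ?m = "\<lambda>K. \<mu> (K \<inter> X) * \<nu> (K \<inter> Y)"
  have "PW p (m - (n + k)) (opr ?m (X \<union> Y) g F)" if "PW p m F" for m F
    unfolding opr_Un[OF X(3) fin] using \<mu>(1)[OF \<nu>(1)[OF that]] by (simp add: diff_diff_add add.commute)
  moreover have "(\<Sum>K\<in>Pow (X \<union> Y). if sum g K \<in> pz p then ?m K else 0) =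
    (\<Sum>K\<in>Pow X. if sum g K \<in> pz p then \<mu> K else 0) * (\<Sum>L\<in>Pow Y. if sum g L \<in> pz p then \<nu> L else 0)"
    unfolding sum_Pow_Un[OF X(3)] sum_product
  proof (intro sum.cong refl)
    fix K L assume KL: "K \<in> Pow X" "L \<in> Pow Y"
    then have K: "(K \<union> L) \<inter> X = K" "(K \<union> L) \<inter> Y = L" and sub: "K \<union> L \<subseteq> I" using X by auto
    have s: "sum g (K \<union> L) = sum g K + sum g L"
      by (rule sum.union_disjoint) (use KL X fin in \<open>auto intro: finite_subset\<close>)
    have "sum g K \<in> pz p \<and> sum g L \<in> pz p" if "sum g (K \<union> L) \<in> pz p"
      using ucl_Int[OF u sub X(1) that z(1)] ucl_Int[OF u sub X(2) that z(2)] K by simp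
    then have "sum g (K \<union> L) \<in> pz p \<longleftrightarrow> sum g K \<in> pz p \<and> sum g L \<in> pz p"
      using s sg_add[OF sg_pz, of "sum g K" p "sum g L"] by metis
    then show "(if sum g (K \<union> L) \<in> pz p then \<mu> ((K \<union> L) \<inter> X) * \<nu> ((K \<union> L) \<inter> Y) else 0) =
      (if sum g K \<in> pz p then \<mu> K else 0) * (if sum g L \<in> pz p then \<nu> L else 0)"
      using K by auto
  qed
  moreover have "\<not> p dvd \<dots>" using \<mu>(2) \<nu>(2) p prime_dvd_mult_iff by blast
  ultimately show ?thesis unfolding Good_def by (intro exI[of _ ?m]) simp
qed

lemma weight_block:
  assumes "finite B" "minz Z g B"
  shows "(\<Sum>K\<in>Pow B. if sum g K \<in> Z then \<mu> K else (0::int)) = \<mu> {} * (if 0 \<in> Z then 1 else 0) + \<mu> B"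
proof -
  have B: "B \<noteq> {}" "sum g B \<in> Z" using assms by (auto simp: minz_def)
  have "(\<Sum>K\<in>Pow B. if sum g K \<in> Z then \<mu> K else (0::int)) = (\<Sum>K\<in>{{}, B}. if sum g K \<in> Z then \<mu> K else 0)"
    by (rule sum.mono_neutral_right) (use assms minz_subset in auto)
  then show ?thesis using B by simp
qed

text \<open>Only the empty set and the whole block carry weight. Their signs add up to 2 for even
  size; for odd size they cancel, which is what forces odd blocks to be treated in pairs.\<close>

lemma Good_even_block:
  assumes "finite B" "minz (pz p) g B" "even (card B)" "2 < p"
  shows "Good p g B (card B)"
  unfolding Good_def
proof (intro exI[of _ "\<lambda>K. (-1) ^ card K"] conjI allI impI)
  show "PW p (m - card B) (opr (\<lambda>K. (-1) ^ card K) B g F)" if "PW p m F" for m F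
    using PW_opr_difference[OF assms(1) that] .
  show "\<not> p dvd (\<Sum>K\<in>Pow B. if sum g K \<in> pz p then (- 1) ^ card K else 0)"
    unfolding weight_block[OF assms(1,2)] using assms sg_zero[OF sg_pz] by (simp add: zdvd_not_zless)
qed

text \<open>Omitting the factor of one element removes the coefficient of the whole block and leaves
  weight 1, at the price of one degree.\<close>

lemma Good_block:
  assumes "finite B" "minz (pz p) g B" "2 < p"
  shows "Good p g B (card B - 1)"
proof -
  obtain a where a: "a \<in> B" using assms by (auto simp: minz_def)
  let ?m = "\<lambda>K. if a \<in> K then 0 else (-1::int) ^ card K"
  have "opr ?m B g F = opr (\<lambda>K. (-1) ^ card K) (B - {a}) g F" for F
  proof
    fix z
    show "opr ?m B g F z = opr (\<lambda>K. (-1) ^ card K) (B - {a}) g F z"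
      unfolding opr_def by (rule sum.mono_neutral_cong_right) (use assms(1) in auto)
  qed
  then have "PW p (m - (card B - 1)) (opr ?m B g F)" if "PW p m F" for m F
    using PW_opr_difference[of "B - {a}" p m F g] that assms(1) a by simp
  moreover have "\<not> p dvd (\<Sum>K\<in>Pow B. if sum g K \<in> pz p then ?m K else 0)"
    unfolding weight_block[OF assms(1,2)] using assms(3) a sg_zero[OF sg_pz] by (simp add: zdvd_not_zless)
  ultimately show ?thesis unfolding Good_def by (intro exI[of _ ?m]) simp
qed

text \<open>The triple operator lowers the degree by 3 on \<open>a\<close>, \<open>b\<close>,
  \<open>d\<close>, and the remaining elements lower it by one each. The zero-sum subsets are the
  empty set, \<open>B1\<close>, \<open>B2\<close> and their union, with weights
  \<open>l + x + v\<close>, \<open>-v\<close>, \<open>-v\<close>, \<open>l + x + v\<close> by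
  parity; so the total is \<open>2 * (l + x)\<close>.\<close>

lemma Good_odd_pair:
  assumes p: "prime p" "2 < p" and u: "ucl (pz p) g I"
    and B: "B1 \<in> blk (pz p) g I" "B2 \<in> blk (pz p) g I" "B1 \<noteq> B2" "odd (card B1)" "odd (card B2)"
    and ab: "a \<in> B1" "b \<in> B1" "a \<noteq> b" "d \<in> B2"
    and rel: "p dvd l * fst (g a) + x * fst (g b) + v * fst (g d)"
      "p dvd l * snd (g a) + x * snd (g b) + v * snd (g d)" and nz: "\<not> p dvd l + x"
  shows "Good p g (B1 \<union> B2) (card B1 + card B2)"
proof -
  define R where "R = B1 \<union> B2 - {a, b, d}"
  \<comment> \<open>The coefficients of \<open>PW_triple_operator\<close>, with the coefficient
    \<open>x\<close> in the place of \<open>u\<close>.\<close>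
  define \<beta> where "\<beta> K = (if a \<in> K then if b \<in> K then if d \<in> K then - (l + x + v) else v
      else if d \<in> K then x else - l
    else if b \<in> K then if d \<in> K then l else - x else if d \<in> K then - v else l + x + v)" for K
  have dis: "B1 \<inter> B2 = {}" using blk_disjoint[OF u B(1-3)] .
  have fin: "finite B1" "finite B2"
    using finite_subset[OF blk_sub[OF B(1)] ucl_finite[OF u]] finite_subset[OF blk_sub[OF B(2)] ucl_finite[OF u]] by auto
  have dist: "a \<noteq> d" "b \<noteq> d" using ab dis by auto
  let ?T = "{a, b, d}" and ?X = "B1 \<union> B2"
  have X: "?X = R \<union> ?T" "R \<inter> ?T = {}" "finite R" using ab fin by (auto simp: R_def)
  have cardT: "card ?T = 3" using ab dist by simp
  have cardX: "card ?X = card R + 3" using card_Un_disjoint[OF X(3) _ X(2)] X(1) cardT by simp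
  have cX: "card ?X = card B1 + card B2" using card_Un_disjoint[OF fin dis] .
  have podd: "odd p" using p prime_odd_int by blast
  let ?s = "\<lambda>K::'a set. (-1::int) ^ card K"
  have T: "PW p (m - 3) (opr \<beta> ?T g F)" if F: "PW p m F" for m F
  proof -
    have "opr \<beta> ?T g F = (\<lambda>z. (l + x + v) * F z - l * F (z + g a) - x * F (z + g b) - v * F (z + g d)
      + l * F (z + g b + g d) + x * F (z + g a + g d) + v * F (z + g a + g b)
      - (l + x + v) * F (z + g a + g b + g d))"
    proof
      fix z
      have P: "Pow ?T = {{}, {a}, {b}, {d}, {b, d}, {a, d}, {a, b}, {a, b, d}}" by blast
      have "{a} \<noteq> {b}" "{a} \<noteq> {d}" "{b} \<noteq> {d}" "{b, d} \<noteq> {a, d}" "{b, d} \<noteq> {a, b}" "{a, d} \<noteq> {a, b}"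
        "{a} \<noteq> {b, d}" "{a} \<noteq> {a, d}" "{a} \<noteq> {a, b}" "{b} \<noteq> {b, d}" "{b} \<noteq> {a, d}" "{b} \<noteq> {a, b}"
        "{d} \<noteq> {b, d}" "{d} \<noteq> {a, d}" "{d} \<noteq> {a, b}" "{a} \<noteq> ?T" "{b} \<noteq> ?T" "{d} \<noteq> ?T"
        "{b, d} \<noteq> ?T" "{a, d} \<noteq> ?T" "{a, b} \<noteq> ?T"
        using ab(3) dist by auto
      then show "opr \<beta> ?T g F z = (l + x + v) * F z - l * F (z + g a) - x * F (z + g b) - v * F (z + g d)
        + l * F (z + g b + g d) + x * F (z + g a + g d) + v * F (z + g a + g b)
        - (l + x + v) * F (z + g a + g b + g d)"
        using ab(3) dist unfolding opr_def P by (simp add: \<beta>_def add.assoc) (simp add: algebra_simps)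
    qed
    then show ?thesis using PW_triple_operator[OF F podd rel] by simp
  qed
  let ?m = "\<lambda>K. ?s (K \<inter> R) * \<beta> (K \<inter> ?T)"
  have "PW p (m - (card B1 + card B2)) (opr ?m ?X g F)" if F: "PW p m F" for m F
  proof -
    have "opr ?m ?X g F = opr ?s R g (opr \<beta> ?T g F)"
      unfolding X(1) by (rule opr_Un[OF X(2,3)]) simp
    moreover have "PW p (m - 3 - card R) \<dots>" by (rule PW_opr_difference[OF X(3) T[OF F]])
    moreover have "m - 3 - card R = m - (card B1 + card B2)" using cardX cX by simp
    ultimately show ?thesis by simp
  qed
  moreover have "(\<Sum>K\<in>Pow ?X. if sum g K \<in> pz p then ?m K else 0) = 2 * (l + x)"
  proof -
    have z: "sum g B1 \<in> pz p" "sum g B2 \<in> pz p" "minz (pz p) g B1" "minz (pz p) g B2"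
      and sub: "B1 \<subseteq> I" "B2 \<subseteq> I" using B by (auto simp: blk_def minz_def)
    have zX: "sum g ?X \<in> pz p" using ucl_Un[OF sg_pz u sub z(1,2)] .
    have ne: "B1 \<noteq> {}" "B2 \<noteq> {}" using ab by auto
    have "(\<Sum>K\<in>Pow ?X. if sum g K \<in> pz p then ?m K else 0) = (\<Sum>K\<in>{{}, B1, B2, ?X}. if sum g K \<in> pz p then ?m K else 0)"
    proof (rule sum.mono_neutral_right)
      show "\<forall>K\<in>Pow ?X - {{}, B1, B2, ?X}. (if sum g K \<in> pz p then ?m K else 0) = 0"
      proof
        fix K assume K: "K \<in> Pow ?X - {{}, B1, B2, ?X}"
        have "sum g K \<notin> pz p"
        proof
          assume zK: "sum g K \<in> pz p"
          have KI: "K \<subseteq> I" using K sub by auto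
          have "K \<inter> B1 = {} \<or> K \<inter> B1 = B1" "K \<inter> B2 = {} \<or> K \<inter> B2 = B2"
            using minz_subset[OF z(3), of "K \<inter> B1"] minz_subset[OF z(4), of "K \<inter> B2"]
              ucl_Int[OF u KI sub(1) zK z(1)] ucl_Int[OF u KI sub(2) zK z(2)] by auto
          moreover have "K = (K \<inter> B1) \<union> (K \<inter> B2)" using K by auto
          ultimately show False using K by auto
        qed
        then show "(if sum g K \<in> pz p then ?m K else 0) = 0" by simp
      qed
    qed (use fin in auto)
    also have "\<dots> = ?m {} + ?m B1 + ?m B2 + ?m ?X"
    proof -
      have "B1 \<noteq> B2" "B1 \<noteq> ?X" "B2 \<noteq> ?X" using ne dis B(3) by auto
      then show ?thesis using ne z zX sg_zero[OF sg_pz] by (simp add: add.assoc)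
    qed
    also have "?m {} = l + x + v" by (simp add: \<beta>_def)
    also have "?m B1 = - v"
    proof -
      have "B1 \<inter> R = B1 - {a, b}" "d \<notin> B1" using dis ab by (auto simp: R_def)
      moreover have "card (B1 - {a, b}) = card B1 - 2" using ab fin by (subst card_Diff_subset) auto
      moreover have "2 \<le> card B1" using ab fin card_mono[of B1 "{a, b}"] by simp
      ultimately show ?thesis using B(4) ab dist by (simp add: \<beta>_def)
    qed
    also have "?m B2 = - v"
    proof -
      have "B2 \<inter> R = B2 - {d}" "a \<notin> B2" "b \<notin> B2" using dis ab by (auto simp: R_def)
      moreover have "even (card (B2 - {d}))" using ab fin B(5) by (simp add: card_Diff_singleton)
      ultimately show ?thesis using ab dist by (simp add: \<beta>_def)
    qed
    also have "?m ?X = l + x + v"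
    proof -
      have "?X \<inter> R = R" by (auto simp: R_def)
      moreover have "odd (card R)" using cardX cX B(4,5) by presburger
      ultimately show ?thesis using ab dist by (simp add: \<beta>_def)
    qed
    finally show ?thesis by simp
  qed
  moreover have "\<not> p dvd 2 * (l + x)"
  proof
    assume "p dvd 2 * (l + x)"
    then have "p dvd 2" using p(1) nz prime_dvd_mult_iff by blast
    then show False using p(2) by (simp add: zdvd_not_zless)
  qed
  ultimately show ?thesis unfolding Good_def by (intro exI[of _ ?m]) simp
qed

text \<open>If the coefficients in \<open>Good_odd_pair\<close> cannot be chosen, the determinants of \<open>(g i, g d)\<close> for
  \<open>i\<close> in \<open>B1\<close> agree modulo \<open>p\<close> and are nonzero, while they add up to zero; so \<open>p\<close> divides
  \<open>card B1\<close>.\<close>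

lemma Good_odd_pair_if_not_dvd:
  assumes p: "prime p" "2 < p" and u: "ucl (pz p) g I" and gI: "g ` I \<inter> pz p = {}"
    and B: "B1 \<in> blk (pz p) g I" "B2 \<in> blk (pz p) g I" "B1 \<noteq> B2" "odd (card B1)" "odd (card B2)"
    and nd: "\<not> p dvd int (card B1)"
  shows "Good p g (B1 \<union> B2) (card B1 + card B2)"
proof (rule ccontr)
  assume nG: "\<not> ?thesis"
  have fin: "finite B1" "finite B2" and sub: "B1 \<subseteq> I" "B2 \<subseteq> I"
    using finite_subset[OF blk_sub[OF B(1)] ucl_finite[OF u]] finite_subset[OF blk_sub[OF B(2)] ucl_finite[OF u]]
      blk_sub[OF B(1)] blk_sub[OF B(2)] by auto
  have c3: "3 \<le> card B1" using blk_card_ge2[OF u gI B(1)] B(4) by presburger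
  have "card B2 \<noteq> 0" using B(5) by (intro notI) simp
  then obtain d where d: "d \<in> B2" by fastforce
  define D where "D i = fst (g i) * snd (g d) - snd (g i) * fst (g d)" for i
  have no: "p dvd l + x" if "a \<in> B1" "b \<in> B1" "a \<noteq> b"
    "p dvd l * fst (g a) + x * fst (g b) + v * fst (g d)"
    "p dvd l * snd (g a) + x * snd (g b) + v * snd (g d)" for a b l x v
    using Good_odd_pair[OF p u B that(1-3) d that(4,5)] nG by blast
  have Deq: "p dvd D b - D a" if "a \<in> B1" "b \<in> B1" for a b
  proof (cases "a = b")
    case False
    let ?v = "fst (g a) * snd (g b) - snd (g a) * fst (g b)"
    \<comment> \<open>Cramer's rule: the linear relation between three plane vectors, with their
      determinants as coefficients.\<close>
    have "D b * fst (g a) + (- D a) * fst (g b) + ?v * fst (g d) = 0"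
      "D b * snd (g a) + (- D a) * snd (g b) + ?v * snd (g d) = 0"
      by (simp_all add: D_def algebra_simps)
    then show ?thesis using no[OF that False, of "D b" "- D a" ?v] by simp
  qed simp
  obtain a where a: "a \<in> B1" using c3 by fastforce
  have "card (B1 - {a}) \<noteq> 0" using c3 a fin by simp
  then have "B1 - {a} \<noteq> {}" by (intro notI) simp
  then obtain b where b: "b \<in> B1" "a \<noteq> b" by blast
  have "(\<Sum>i\<in>B1. D i) = fst (sum g B1) * snd (g d) - snd (sum g B1) * fst (g d)"
    by (simp add: D_def sum_subtractf fst_sum snd_sum sum_distrib_right)
  moreover have "p dvd fst (sum g B1)" "p dvd snd (sum g B1)"
    using blk_sum[OF B(1)] by (auto simp: pz_def)
  ultimately have s1: "p dvd (\<Sum>i\<in>B1. D i)" by simp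
  have "p dvd (\<Sum>i\<in>B1. D i - D a)" using Deq[OF a] by (intro dvd_sum) auto
  then have "p dvd (\<Sum>i\<in>B1. D i) - int (card B1) * D a" by (simp add: sum_subtractf)
  then have "p dvd int (card B1) * D a" using s1 by (metis dvd_diff_right_iff)
  then have Da: "p dvd D a" using nd p(1) prime_dvd_mult_iff by blast
  have dz: "\<not> (p dvd fst (g d) \<and> p dvd snd (g d))" using gI d sub by (auto simp: pz_def)
  \<comment> \<open>Now \<open>g a\<close> is a multiple of the nonzero \<open>g d\<close> modulo
    \<open>p\<close>. This is a relation with first two coefficients 1 and 0, whose sum cannot be
    divisible by \<open>p\<close>.\<close>
  have "\<exists>v. p dvd 1 * fst (g a) + 0 * fst (g b) + v * fst (g d) \<and> p dvd 1 * snd (g a) + 0 * snd (g b) + v * snd (g d)"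
  proof (cases "p dvd fst (g d)")
    case False
    then have "coprime (fst (g d)) p" using p(1) by (simp add: prime_imp_coprime coprime_commute)
    then obtain t where "[fst (g d) * t = 1] (mod p)" using cong_solve_coprime_int by blast
    then have t: "p dvd fst (g d) * t - 1" by (simp add: cong_iff_dvd_diff)
    have "fst (g a) + (- fst (g a) * t) * fst (g d) = - fst (g a) * (fst (g d) * t - 1)"
      "snd (g a) + (- fst (g a) * t) * snd (g d) = - t * D a - snd (g a) * (fst (g d) * t - 1)"
      by (simp_all add: D_def algebra_simps)
    moreover have "p dvd - fst (g a) * (fst (g d) * t - 1)"
      "p dvd - t * D a - snd (g a) * (fst (g d) * t - 1)"
      using t Da by (auto intro!: dvd_diff)
    ultimately show ?thesis by (intro exI[of _ "- fst (g a) * t"]) simp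
  next
    case True
    then have "coprime (snd (g d)) p" using p(1) dz by (simp add: prime_imp_coprime coprime_commute)
    then obtain t where "[snd (g d) * t = 1] (mod p)" using cong_solve_coprime_int by blast
    then have t: "p dvd snd (g d) * t - 1" by (simp add: cong_iff_dvd_diff)
    have "snd (g a) + (- snd (g a) * t) * snd (g d) = - snd (g a) * (snd (g d) * t - 1)"
      "fst (g a) + (- snd (g a) * t) * fst (g d) = t * D a - fst (g a) * (snd (g d) * t - 1)"
      by (simp_all add: D_def algebra_simps)
    moreover have "p dvd - snd (g a) * (snd (g d) * t - 1)"
      "p dvd t * D a - fst (g a) * (snd (g d) * t - 1)"
      using t Da by (auto intro!: dvd_diff)
    ultimately show ?thesis by (intro exI[of _ "- snd (g a) * t"]) simp
  qed
  then obtain v where "p dvd 1 * fst (g a) + 0 * fst (g b) + v * fst (g d)"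
    "p dvd 1 * snd (g a) + 0 * snd (g b) + v * snd (g d)" by blast
  then have "p dvd 1" using no[OF a b, of 1 0 v] by simp
  then show False using p(2) by (simp add: zdvd_not_zless)
qed

text \<open>Even blocks are used alone and odd ones in pairs without loss; at most one odd block is
  left over, and it accounts for the 1 in \<open>n + 1\<close>.\<close>

lemma Good_Union_blocks:
  assumes p: "prime p" "2 < p" and u: "ucl (pz p) g I" and gI: "g ` I \<inter> pz p = {}"
    and pair: "\<And>B1 B2. B1 \<in> blk (pz p) g I \<Longrightarrow> B2 \<in> blk (pz p) g I \<Longrightarrow> B1 \<noteq> B2 \<Longrightarrow>
      odd (card B1) \<Longrightarrow> odd (card B2) \<Longrightarrow> Good p g (B1 \<union> B2) (card B1 + card B2)"
    and Bs: "Bs \<subseteq> blk (pz p) g I"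
  shows "\<exists>n. Good p g (\<Union>Bs) n \<and> card (\<Union>Bs) \<le> n + 1"
  using Bs
proof (induction "card Bs" arbitrary: Bs rule: less_induct)
  case less
  have finI: "finite I" using u by (rule ucl_finite)
  have sub: "B \<subseteq> I" if "B \<in> Bs" for B using that less.prems blk_sub[of B "pz p" g I] by auto
  then have "Bs \<subseteq> Pow I" by auto
  then have finBs: "finite Bs" using finI finite_subset by auto
  have finB: "finite B" if "B \<in> Bs" for B using sub[OF that] finI by (rule finite_subset)
  have mz: "minz (pz p) g B" if "B \<in> Bs" for B using that less.prems by (auto simp: blk_def)
  have dis: "B \<inter> C = {}" if "B \<in> Bs" "C \<in> Bs" "B \<noteq> C" for B C
    using blk_disjoint[OF u, of B C] that less.prems by auto
  have step: ?case if X: "Cs \<subseteq> Bs" "Cs \<noteq> {}" "Good p g (\<Union>Cs) (card (\<Union>Cs))" for Cs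
  proof -
    have "card (Bs - Cs) < card Bs" using X finBs by (intro psubset_card_mono) auto
    then obtain n where n: "Good p g (\<Union>(Bs - Cs)) n" "card (\<Union>(Bs - Cs)) \<le> n + 1"
      using less.hyps[of "Bs - Cs"] less.prems by auto
    have un: "\<Union>Bs = \<Union>Cs \<union> \<Union>(Bs - Cs)" using X by auto
    have d: "\<Union>Cs \<inter> \<Union>(Bs - Cs) = {}" using dis X by fast
    have zs: "sum g (\<Union>Ds) \<in> pz p" if "Ds \<subseteq> Bs" for Ds
    proof -
      have "sum g (\<Union>Ds) = (\<Sum>B\<in>Ds. sum g B)"
        using that finB dis sum.Union_disjoint[of Ds g] by (auto simp: subset_iff)
      also have "\<dots> \<in> pz p" by (rule sg_sum[OF sg_pz]) (use that mz in \<open>auto simp: minz_def\<close>)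
      finally show ?thesis .
    qed
    have "Good p g (\<Union>Bs) (card (\<Union>Cs) + n)"
      unfolding un using X n sub zs by (intro Good_Un[OF p(1) u _ _ d]) auto
    moreover have "card (\<Union>Bs) \<le> card (\<Union>Cs) + card (\<Union>(Bs - Cs))" unfolding un by (rule card_Un_le)
    ultimately show ?case using n(2) by (intro exI[of _ "card (\<Union>Cs) + n"]) simp
  qed
  consider (even) B where "B \<in> Bs" "even (card B)"
    | (two) B1 B2 where "B1 \<in> Bs" "B2 \<in> Bs" "B1 \<noteq> B2" "odd (card B1)" "odd (card B2)"
    | (one) B where "Bs = {B}" | (none) "Bs = {}"
    by (metis insertI1 subset_insertI2 subset_singleton_iff all_not_in_conv is_singletonI' is_singleton_def)
  then show ?case
  proof cases
    case even
    then show ?thesis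
      using step[of "{B}"] Good_even_block[OF finB mz _ p(2), of B] by simp
  next
    case two
    have "card (B1 \<union> B2) = card B1 + card B2"
      using two finB dis by (intro card_Un_disjoint) auto
    then show ?thesis
      using step[of "{B1, B2}"] two pair[of B1 B2] less.prems by auto
  next
    case one
    then have "Good p g B (card B - 1)" using Good_block[OF finB mz p(2), of B] by simp
    then show ?thesis using one by (intro exI[of _ "card B - 1"]) simp
  next
    case none
    then show ?thesis using Good_empty[of p g] p(2) by (intro exI[of _ 0]) simp
  qed
qed

section \<open>The indicator polynomial and the length bound 2p\<close>

lemma fermat_little_int:
  fixes x :: int
  assumes p: "prime p" and "\<not> int p dvd x"
  shows "int p dvd x ^ (p - 1) - 1"
proof -
  have p0: "0 < p" using p by (simp add: prime_gt_0_nat)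
  define y where "y = nat (x mod int p)"
  have y: "int y = x mod int p" using p0 by (simp add: y_def)
  have "\<not> p dvd y"
    using assms(2) y by (metis dvd_mod_iff dvd_refl int_dvd_int_iff)
  then have "[y ^ (p - 1) = 1] (mod p)" using fermat_theorem[OF p] by blast
  then have "[int y ^ (p - 1) = 1] (mod int p)" by (metis cong_int_iff of_nat_1 of_nat_power)
  moreover have "[int y ^ (p - 1) = x ^ (p - 1)] (mod int p)"
    unfolding y by (intro cong_pow) (simp add: cong_def)
  ultimately have "[x ^ (p - 1) = 1] (mod int p)" using cong_sym cong_trans by blast
  then show ?thesis by (simp add: cong_iff_dvd_diff)
qed

lemma PW_monom: "PW p (Suc (i + j)) (\<lambda>z. fst z ^ i * snd z ^ j)"
proof (induction i)
  case 0
  show ?case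
  proof (induction j)
    case 0
    show ?case using PW_const[of p 0 1] by simp
  next
    case (Suc j)
    then show ?case using PW_snd[OF Suc] by simp
  qed
next
  case (Suc i)
  then show ?case using PW_fst[OF Suc] by (simp add: mult.assoc)
qed

text \<open>Apply the operator to the indicator function of \<open>pz p\<close>, a polynomial of degree \<open>2 * p - 2\<close>.\<close>

lemma Good_le:
  assumes p: "prime p" and G: "Good (int p) g I n"
  shows "n \<le> 2 * p - 2"
proof (rule ccontr)
  assume n: "\<not> n \<le> 2 * p - 2"
  have p2: "2 \<le> p" using p prime_ge_2_nat by auto
  let ?p = "int p"
  obtain \<mu> where \<mu>: "\<And>m F. PW ?p m F \<Longrightarrow> PW ?p (m - n) (opr \<mu> I g F)"
    "\<not> ?p dvd (\<Sum>K\<in>Pow I. if sum g K \<in> pz ?p then \<mu> K else 0)"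
    using G unfolding Good_def by blast
  \<comment> \<open>By Fermat each factor is 1 modulo \<open>p\<close> if \<open>p\<close> divides
    the coordinate, and 0 otherwise.\<close>
  define \<delta> where "\<delta> z = (1 - fst z ^ (p - 1)) * (1 - snd z ^ (p - 1))" for z :: "int \<times> int"
  have "PW ?p (2 * p - 1) (\<lambda>z. 1 * (fst z ^ 0 * snd z ^ 0) + (-1) * (fst z ^ (p - 1) * snd z ^ 0)
    + (-1) * (fst z ^ 0 * snd z ^ (p - 1)) + 1 * (fst z ^ (p - 1) * snd z ^ (p - 1)))"
    by (intro PW_add PW_scale PW_mono[OF PW_monom]) (use p2 in auto)
  moreover have "(\<lambda>z. 1 * (fst z ^ 0 * snd z ^ 0) + (-1) * (fst z ^ (p - 1) * snd z ^ 0)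
    + (-1) * (fst z ^ 0 * snd z ^ (p - 1)) + 1 * (fst z ^ (p - 1) * snd z ^ (p - 1))) = \<delta>"
    by (auto simp: \<delta>_def algebra_simps)
  ultimately have "PW ?p (2 * p - 1) \<delta>" by simp
  then have "PW ?p (2 * p - 1 - n) (opr \<mu> I g \<delta>)" by (rule \<mu>(1))
  \<comment> \<open>Degree \<open>2 * p - 2\<close> has index \<open>2 * p - 1\<close> in
    \<open>PW\<close>; a drop by more than \<open>2 * p - 2\<close> reaches index 0, that is, the
    zero function modulo \<open>p\<close>.\<close>
  moreover have "2 * p - 1 - n = 0" using n by simp
  ultimately have "?p dvd opr \<mu> I g \<delta> 0" using PW_0 by metis
  moreover have ind: "?p dvd \<delta> z - (if z \<in> pz ?p then 1 else 0)" for z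
  proof (cases "z \<in> pz ?p")
    case True
    have "?p dvd fst z ^ (p - 1)" "?p dvd snd z ^ (p - 1)"
      using True p2 by (auto simp: pz_def intro!: dvd_power_le[of _ _ 1, simplified])
    moreover have "\<delta> z - 1 = fst z ^ (p - 1) * (snd z ^ (p - 1) - 1) - snd z ^ (p - 1)"
      by (simp add: \<delta>_def algebra_simps)
    ultimately show ?thesis using True by (simp add: dvd_diff)
  next
    case False
    then have "?p dvd 1 - fst z ^ (p - 1) \<or> ?p dvd 1 - snd z ^ (p - 1)"
      using fermat_little_int[OF p] by (auto simp: pz_def dvd_diff_commute)
    then show ?thesis using False by (auto simp: \<delta>_def)
  qed
  \<comment> \<open>At the origin the operator collects the coefficients of the zero-sum subsets, a
    sum that \<open>Good\<close> keeps nonzero.\<close>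
  have "?p dvd (\<Sum>K\<in>Pow I. \<mu> K * \<delta> (sum g K)) - (\<Sum>K\<in>Pow I. if sum g K \<in> pz ?p then \<mu> K else 0)"
  proof -
    have "(\<Sum>K\<in>Pow I. \<mu> K * \<delta> (sum g K)) - (\<Sum>K\<in>Pow I. if sum g K \<in> pz ?p then \<mu> K else 0) =
      (\<Sum>K\<in>Pow I. \<mu> K * (\<delta> (sum g K) - (if sum g K \<in> pz ?p then 1 else 0)))"
      by (simp add: sum_subtractf[symmetric] right_diff_distrib if_distrib cong: if_cong)
    moreover have "?p dvd \<dots>" by (intro dvd_sum dvd_mult ind)
    ultimately show ?thesis by (simp only:)
  qed
  moreover have "opr \<mu> I g \<delta> 0 = (\<Sum>K\<in>Pow I. \<mu> K * \<delta> (sum g K))" by (simp add: opr_def)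
  ultimately have "?p dvd (\<Sum>K\<in>Pow I. if sum g K \<in> pz ?p then \<mu> K else 0)"
    by (metis dvd_diff_right_iff)
  then show False using \<mu>(2) by blast
qed

lemma idx_pz: "0 < p \<Longrightarrow> idx (pz (int p)) UNIV (p * p)"
  unfolding idx_def
proof (intro exI[of _ "\<lambda>z. nat (fst z mod int p) * p + nat (snd z mod int p)"] conjI ballI impI)
  fix z :: "int \<times> int" assume p: "0 < p"
  have a: "nat (fst z mod int p) < p" "nat (snd z mod int p) < p" for z :: "int \<times> int"
    using p by (simp_all add: nat_less_iff)
  have "nat (fst z mod int p) * p + nat (snd z mod int p) < Suc (nat (fst z mod int p)) * p"
    using a(2)[of z] by simp
  also have "\<dots> \<le> p * p" using a(1)[of z] by (intro mult_right_mono) auto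
  finally show "nat (fst z mod int p) * p + nat (snd z mod int p) < p * p" .
  fix y :: "int \<times> int"
  assume eq: "nat (fst z mod int p) * p + nat (snd z mod int p) = nat (fst y mod int p) * p + nat (snd y mod int p)"
  have "nat (fst z mod int p) = nat (fst y mod int p)"
    using arg_cong[OF eq, of "\<lambda>x. x div p"] a p by simp
  moreover have "nat (snd z mod int p) = nat (snd y mod int p)"
    using arg_cong[OF eq, of "\<lambda>x. x mod p"] a p by simp
  ultimately have "fst z mod int p = fst y mod int p" "snd z mod int p = snd y mod int p"
    using p by (simp_all add: eq_nat_nat_iff)
  then show "z - y \<in> pz (int p)" by (simp add: pz_def mod_eq_dvd_iff)
qed

text \<open>If at most one block has size divisible by \<open>p\<close>, then of any two odd blocks
  one can play the role of \<open>B1\<close> in \<open>Good_odd_pair_if_not_dvd\<close>, and the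
  length is at most (2p - 2) + 1. Otherwise two block sizes are multiples of \<open>p\<close>; as
  the product of all sizes is at most p^2, there are exactly two blocks, both of size
  \<open>p\<close>.\<close>

lemma length_le_2p:
  fixes g :: "'i \<Rightarrow> int \<times> int"
  assumes p: "prime p" "2 < p" and U: "UF (pz (int p)) g I" and gI: "g ` I \<inter> pz (int p) = {}"
  shows "card I \<le> 2 * p"
proof -
  let ?B = "blk (pz (int p)) g I"
  have u: "ucl (pz (int p)) g I" using U by (simp add: UF_def)
  have fin: "finite I" using u by (rule ucl_finite)
  have part: "partition_on I ?B" by (rule blk_partition(1)[OF sg_pz U])
  have finB: "finite ?B" using part fin finite_elements by blast
  have pi: "prime (int p)" "2 < int p" using p by auto
  show ?thesis
  proof (cases "\<exists>B1\<in>?B. \<exists>B2\<in>?B. B1 \<noteq> B2 \<and> p dvd card B1 \<and> p dvd card B2")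
    case False
    have "Good (int p) g (B1 \<union> B2) (card B1 + card B2)"
      if B: "B1 \<in> ?B" "B2 \<in> ?B" "B1 \<noteq> B2" "odd (card B1)" "odd (card B2)" for B1 B2
    proof (cases "p dvd card B1")
      case True
      then have "\<not> int p dvd int (card B2)" using False B by (simp add: int_dvd_int_iff) blast
      then show ?thesis
        using Good_odd_pair_if_not_dvd[OF pi u gI B(2,1) _ B(5,4)] B(3) by (simp add: Un_commute add.commute)
    next
      case False
      then show ?thesis using Good_odd_pair_if_not_dvd[OF pi u gI B] by (simp add: int_dvd_int_iff)
    qed
    then obtain n where "Good (int p) g (\<Union>?B) n" "card (\<Union>?B) \<le> n + 1"
      using Good_Union_blocks[OF pi u gI _ order_refl] by blast
    then show ?thesis using Good_le[OF p(1)] part p(2) by (fastforce simp: partition_on_def)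
  next
    case True
    then obtain B1 B2 where B: "B1 \<in> ?B" "B2 \<in> ?B" "B1 \<noteq> B2" "p dvd card B1" "p dvd card B2" by blast
    have c2: "2 \<le> card B" if "B \<in> ?B" for B using blk_card_ge2[OF u gI that] .
    have le: "p \<le> card B1" "p \<le> card B2" using B c2[of B1] c2[of B2] by (auto intro!: dvd_imp_le)
    have prodle: "(\<Prod>B\<in>Bs. card B) \<le> p * p" if "Bs \<subseteq> ?B" for Bs
      by (rule prod_blocks_le[OF sg_pz _ idx_pz u _ that]) (use p in \<open>auto simp: sg_def\<close>)
    have "?B = {B1, B2}"
    proof (rule ccontr)
      assume "?B \<noteq> {B1, B2}"
      then obtain C where C: "C \<in> ?B" "C \<noteq> B1" "C \<noteq> B2" using B by blast
      have "p * p * 2 \<le> card B1 * card B2 * card C" using le c2[OF C(1)] by (intro mult_mono) auto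
      moreover have "card B1 * card B2 * card C \<le> p * p" using prodle[of "{B1, B2, C}"] B C by (simp add: mult.assoc)
      moreover have "0 < p * p" using p(2) by simp
      ultimately show False by linarith
    qed
    moreover have "card B1 * card B2 \<le> p * p" using prodle[of "{B1, B2}"] B by simp
    have "card B1 = p" "card B2 = p"
    proof -
      have "card B1 * p \<le> p * p" "p * card B2 \<le> p * p"
        using \<open>card B1 * card B2 \<le> p * p\<close> mult_le_mono2[OF le(2), of "card B1"] mult_le_mono1[OF le(1), of "card B2"]
        by linarith+
      then show "card B1 = p" "card B2 = p" using le p(2) by auto
    qed
    moreover have "\<Union>?B = I" using part by (simp add: partition_on_def)
    ultimately have "card I \<le> card B1 + card B2" by (metis Union_insert Union_empty Un_empty_right card_Un_le)
    then show ?thesis using \<open>card B1 = p\<close> \<open>card B2 = p\<close> by simp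
  qed
qed

text \<open>Additivity is required only on \<open>D\<close>: this admits a coordinate divided by
  p^(m-1), which is additive on \<open>tor Z p\<close> because the coordinate is divisible
  there.\<close>

lemma bnd_length_rank2:
  fixes f :: "'a::ab_group_add \<Rightarrow> int \<times> int"
  assumes p: "prime p" "2 < p" and D: "sg D"
    and add: "\<And>x y. x \<in> D \<Longrightarrow> y \<in> D \<Longrightarrow> f (x + y) = f x + f y"
    and Z: "\<And>x. x \<in> D \<Longrightarrow> x \<in> Z \<longleftrightarrow> f x \<in> pz (int p)"
  shows "bnd Z D (\<lambda>_. 1) (real (2 * p))"
  unfolding bnd_def
proof (intro allI impI)
  fix I :: "nat set" and g assume u: "UF Z g I" and gI: "g ` I \<subseteq> D - Z"
  have fin: "finite I" using u ucl_finite by (auto simp: UF_def)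
  have f0: "f 0 = 0" using add[of 0 0] sg_zero[OF D] by simp
  have fs: "f (sum g K) = sum (f \<circ> g) K" if "finite K" "K \<subseteq> I" for K
    using that
  proof (induction K rule: finite_induct)
    case (insert i K)
    have "g i \<in> D" using insert gI by auto
    moreover have "sum g K \<in> D" using insert gI by (intro sg_sum[OF D]) auto
    ultimately show ?case using insert add by simp
  qed (simp add: f0)
  have iff: "sum g K \<in> Z \<longleftrightarrow> sum (f \<circ> g) K \<in> pz (int p)" if "K \<subseteq> I" for K
  proof -
    have "sum g K \<in> D" using that gI by (intro sg_sum[OF D]) auto
    then show ?thesis using Z fs[of K] that fin finite_subset by metis
  qed
  have "UF (pz (int p)) (f \<circ> g) I"
    unfolding UF_def ucl_def
  proof (intro conjI allI impI)
    fix K L assume "K \<subseteq> I" "L \<subseteq> I" "sum (f \<circ> g) K \<in> pz (int p)" "sum (f \<circ> g) L \<in> pz (int p)"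
    then show "sum (f \<circ> g) (K \<inter> L) \<in> pz (int p)"
      using u iff[of K] iff[of L] iff[of "K \<inter> L"] ucl_Int[of Z g I K L] by (auto simp: UF_def)
  next
    show "sum (f \<circ> g) I \<in> pz (int p)" using u iff[of I] by (simp add: UF_def)
  qed (rule fin)
  moreover have "(f \<circ> g) ` I \<inter> pz (int p) = {}" using gI Z by auto
  ultimately have "card I \<le> 2 * p" by (rule length_le_2p[OF p])
  then show "(\<Sum>i\<in>I. 1) \<le> real (2 * p)" by simp
qed

section \<open>Families attaining the bound\<close>

definition att :: "'a::ab_group_add set \<Rightarrow> 'a set \<Rightarrow> real \<Rightarrow> bool" where
  "att Z H \<kappa> \<longleftrightarrow> (\<exists>(I::nat set) g. UF Z g I \<and> g ` I \<subseteq> H - Z \<and> (\<Sum>i\<in>I. wz Z (g i)) = \<kappa>)"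

lemma attI:
  fixes g :: "'i \<Rightarrow> 'a::ab_group_add"
  assumes "UF Z g I" "g ` I \<subseteq> H - Z" "(\<Sum>i\<in>I. wz Z (g i)) = \<kappa>"
  shows "att Z H \<kappa>"
proof -
  have "finite I" using assms ucl_finite by (auto simp: UF_def)
  then obtain f where f: "bij_betw f {..<card I} I"
    using ex_bij_betw_nat_finite[of I] by (auto simp: atLeast0LessThan)
  then have inj: "inj_on f {..<card I}" and im: "f ` {..<card I} = I" by (auto simp: bij_betw_def)
  have "UF Z (g \<circ> f) {..<card I}" using UF_reindex[OF inj, of Z g] im assms by simp
  moreover have "(g \<circ> f) ` {..<card I} \<subseteq> H - Z" using assms im by (metis image_comp)
  moreover have "(\<Sum>i<card I. wz Z ((g \<circ> f) i)) = \<kappa>"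
    using sum.reindex[OF inj, of "\<lambda>i. wz Z (g i)"] im assms(3) by simp
  ultimately show ?thesis unfolding att_def by blast
qed

lemma att_empty: "sg Z \<Longrightarrow> att Z H 0"
  by (rule attI[of Z "\<lambda>_. 0" "{}"]) (auto simp: UF_def ucl_def sg_zero)

lemma att_mono: "att Z H \<kappa> \<Longrightarrow> H \<subseteq> H' \<Longrightarrow> att Z H' \<kappa>"
  unfolding att_def by blast

lemma sum_case_sum:
  fixes g :: "'i \<Rightarrow> 'a::comm_monoid_add"
  assumes "finite K"
  shows "sum (case_sum g h) K = sum g (Inl -` K) + sum h (Inr -` K)"
proof -
  have K: "K = Inl ` (Inl -` K) \<union> Inr ` (Inr -` K)"
    by (auto simp: image_iff) (metis sumE)
  have fin: "finite (Inl -` K)" "finite (Inr -` K)" using assms by (auto intro: finite_vimageI)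
  have re: "sum (case_sum g h) (Inl ` A) = sum g A" "sum (case_sum g h) (Inr ` B) = sum h B" for A B
    by (simp_all add: sum.reindex)
  have "sum (case_sum g h) K = sum (case_sum g h) (Inl ` (Inl -` K) \<union> Inr ` (Inr -` K))"
    using K by (rule arg_cong)
  also have "\<dots> = sum (case_sum g h) (Inl ` (Inl -` K)) + sum (case_sum g h) (Inr ` (Inr -` K))"
    using fin by (intro sum.union_disjoint finite_imageI) auto
  finally show ?thesis unfolding re .
qed

text \<open>The splitting hypothesis covers both families in independent subgroups and a new block
  whose only zero sums modulo the old subgroup are trivial.\<close>

lemma UF_concat:
  fixes g :: "'i \<Rightarrow> 'a::ab_group_add" and h :: "'j \<Rightarrow> 'a"
  assumes Z: "sg Z" and fin: "finite I" "finite J"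
    and split: "\<And>K L. K \<subseteq> I \<Longrightarrow> L \<subseteq> J \<Longrightarrow> sum g K + sum h L \<in> Z \<Longrightarrow> sum g K \<in> Z \<and> sum h L \<in> Z"
    and u: "UF Z g I" "UF Z h J"
  shows "UF Z (case_sum g h) (I <+> J)"
  unfolding UF_def ucl_def
proof (intro conjI allI impI)
  fix K L assume KL: "K \<subseteq> I <+> J" "L \<subseteq> I <+> J" "sum (case_sum g h) K \<in> Z" "sum (case_sum g h) L \<in> Z"
  have finK: "finite K" "finite L" using KL fin by (meson finite_Plus finite_subset)+
  have v: "Inl -` K \<subseteq> I" "Inr -` K \<subseteq> J" "Inl -` L \<subseteq> I" "Inr -` L \<subseteq> J" using KL by auto
  have "sum g (Inl -` K) \<in> Z" "sum h (Inr -` K) \<in> Z" "sum g (Inl -` L) \<in> Z" "sum h (Inr -` L) \<in> Z"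
    using split v KL sum_case_sum[OF finK(1), of g h] sum_case_sum[OF finK(2), of g h] by auto
  then have "sum g (Inl -` K \<inter> Inl -` L) \<in> Z" "sum h (Inr -` K \<inter> Inr -` L) \<in> Z"
    using u v by (auto simp: UF_def intro: ucl_Int)
  then show "sum (case_sum g h) (K \<inter> L) \<in> Z"
    using finK sg_add[OF Z] by (simp add: sum_case_sum vimage_Int)
next
  have "Inl -` (I <+> J) = I" "Inr -` (I <+> J) = J" by auto
  then show "sum (case_sum g h) (I <+> J) \<in> Z"
    using u fin sg_add[OF Z] by (simp add: sum_case_sum UF_def)
qed (use fin in simp)

lemma sum_wz_case_sum:
  assumes "finite I" "finite J"
  shows "(\<Sum>i\<in>I <+> J. wz Z (case_sum g h i)) = (\<Sum>i\<in>I. wz Z (g i)) + (\<Sum>j\<in>J. wz Z (h j))"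
  using assms by (simp add: sum.Plus comp_def)

lemma att_direct_sum:
  fixes Z :: "'a::ab_group_add set"
  assumes Z: "sg Z" and H: "sg H" "sg H'" "Z \<subseteq> H" "Z \<subseteq> H'" "H \<inter> H' \<subseteq> Z" "H \<subseteq> D" "H' \<subseteq> D"
    and a: "att Z H \<kappa>" "att Z H' \<kappa>'"
  shows "att Z D (\<kappa> + \<kappa>')"
proof -
  obtain I :: "nat set" and g where g: "UF Z g I" "g ` I \<subseteq> H - Z" "(\<Sum>i\<in>I. wz Z (g i)) = \<kappa>"
    using a(1) unfolding att_def by blast
  obtain J :: "nat set" and h where h: "UF Z h J" "h ` J \<subseteq> H' - Z" "(\<Sum>i\<in>J. wz Z (h i)) = \<kappa>'"
    using a(2) unfolding att_def by blast
  have fin: "finite I" "finite J" using g h ucl_finite by (auto simp: UF_def)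
  have "UF Z (case_sum g h) (I <+> J)"
  proof (rule UF_concat[OF Z fin _ g(1) h(1)])
    fix K L assume KL: "K \<subseteq> I" "L \<subseteq> J" "sum g K + sum h L \<in> Z"
    have gK: "sum g K \<in> H" using KL(1) g(2) by (intro sg_sum[OF H(1)]) auto
    have hL: "sum h L \<in> H'" using KL(2) h(2) by (intro sg_sum[OF H(2)]) auto
    have "sum g K \<in> H'" using KL(3) H(4) hL sg_add_iff2[OF H(2) hL] by blast
    then have "sum g K \<in> Z" using gK H(5) by auto
    then show "sum g K \<in> Z \<and> sum h L \<in> Z" using KL(3) sg_add_iff1[OF Z] by blast
  qed
  moreover have "g i \<in> D - Z" if "i \<in> I" for i using that g(2) H(6) by auto
  moreover have "h j \<in> D - Z" if "j \<in> J" for j using that h(2) H(7) by auto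
  ultimately have "UF Z (case_sum g h) (I <+> J)" "case_sum g h ` (I <+> J) \<subseteq> D - Z" by auto
  moreover have "(\<Sum>i\<in>I <+> J. wz Z (case_sum g h i)) = \<kappa> + \<kappa>'"
    using sum_wz_case_sum[OF fin, of Z g h] g(3) h(3) by simp
  ultimately show ?thesis by (rule attI)
qed

text \<open>The new block consists of \<open>p - 1\<close> copies of \<open>y\<close> and one copy of \<open>-(p - 1) y\<close>; it is the only
  nonempty subfamily of itself with sum in \<open>H\<close>.\<close>

lemma att_extend:
  fixes Z :: "'a::ab_group_add set"
  assumes Z: "sg Z" and H: "sg H" "Z \<subseteq> H" "H \<subseteq> D" and D: "sg D" and p: "prime p"
    and y: "y \<in> D" "y \<notin> H" "nmul p y \<in> H" and a: "att Z H \<kappa>"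
    and w: "wz Z y = c" "wz Z (- nmul (p - 1) y) = c"
  shows "att Z D (\<kappa> + real p * c)"
proof -
  have p2: "2 \<le> p" using p prime_ge_2_nat by auto
  obtain I :: "nat set" and g where g: "UF Z g I" "g ` I \<subseteq> H - Z" "(\<Sum>i\<in>I. wz Z (g i)) = \<kappa>"
    using a unfolding att_def by blast
  have fin: "finite I" using g ucl_finite by (auto simp: UF_def)
  define h where "h k = (if k = 0 then - nmul (p - 1) y else y)" for k :: nat
  \<comment> \<open>Modulo \<open>H\<close> the element \<open>y\<close> has order exactly the prime
    \<open>p\<close>.\<close>
  have no: "nmul k y \<notin> H" if "0 < k" "k < p" for k
  proof
    assume "nmul k y \<in> H"
    moreover have "coprime k p"
      using that p by (metis coprime_commute nat_dvd_not_less prime_imp_coprime_nat)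
    ultimately show False
      using tor_coprime[OF H(1), of k p y] that y by (simp add: tor_def)
  qed
  have sh0: "sum h L = nmul (card L) y" if "finite L" "0 \<notin> L" for L
  proof -
    have "sum h L = (\<Sum>k\<in>L. y)" using that by (intro sum.cong) (auto simp: h_def)
    also have "\<dots> = nmul (card L) y"
      using that(1) by (induction L rule: finite_induct) (simp_all add: nmul_Suc)
    finally show ?thesis .
  qed
  have hcases: "L = {} \<or> L = {..<p}" if L: "L \<subseteq> {..<p}" "sum h L \<in> H" for L
  proof (cases "0 \<in> L")
    case False
    have finL: "finite L" using L finite_subset by blast
    have "L \<subseteq> {1..<p}" using L False by (auto simp: Suc_le_eq intro!: gr0I)
    then have "card L \<le> p - 1" using card_mono[of "{1..<p}" L] by simp
    moreover have "nmul (card L) y \<in> H" using sh0[OF finL False] L by simp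
    ultimately have "card L = 0" using no[of "card L"] p2 by fastforce
    then show ?thesis using finL by simp
  next
    case True
    have finL: "finite L" using L finite_subset by blast
    let ?L = "L - {0}"
    have sub: "?L \<subseteq> {1..<p}" using L by (auto simp: Suc_le_eq intro!: gr0I)
    then have c: "card ?L \<le> p - 1" using card_mono[of "{1..<p}" ?L] by simp
    \<comment> \<open>With index 0 present, \<open>c\<close> copies of \<open>y\<close> sum to
      \<open>-(p - 1 - c) y\<close>; so the argument is applied to the number of missing
      copies.\<close>
    have "sum h L = - nmul (p - 1) y + nmul (card ?L) y"
      using sum.remove[OF finL True, of h] sh0[of ?L] finL by (simp add: h_def)
    also have "nmul (p - 1) y = nmul (p - 1 - card ?L) y + nmul (card ?L) y"
    proof -
      have "p - 1 = (p - 1 - card ?L) + card ?L" using c by simp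
      then show ?thesis by (metis nmul_add)
    qed
    finally have "sum h L = - nmul (p - 1 - card ?L) y" by simp
    then have "nmul (p - 1 - card ?L) y \<in> H" using L(2) sg_minus_iff[OF H(1)] by simp
    then have "p - 1 - card ?L = 0" using no[of "p - 1 - card ?L"] p2 by fastforce
    then have "card ?L = card {1..<p}" using c by simp
    then have "?L = {1..<p}" using sub by (intro card_subset_eq) auto
    then have "insert 0 ?L = insert 0 {1..<p}" by simp
    moreover have "insert 0 ?L = L" "insert 0 {1..<p} = {..<p}" using True p2 by auto
    ultimately show ?thesis by simp
  qed
  have hfull: "sum h {..<p} = 0"
  proof -
    have "{..<p} = insert 0 {1..<p}" using p2 by auto
    then have "sum h {..<p} = h 0 + sum h {1..<p}" by simp
    then show ?thesis using sh0[of "{1..<p}"] by (simp add: h_def)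
  qed
  have hZ: "sum h L \<in> Z" if "L \<subseteq> {..<p}" "sum h L \<in> H" for L
    using hcases[OF that] hfull sg_zero[OF Z] by auto
  have uh: "UF Z h {..<p}" unfolding UF_def ucl_def
  proof (intro conjI allI impI)
    fix K L assume KL: "K \<subseteq> {..<p}" "L \<subseteq> {..<p}" "sum h K \<in> Z" "sum h L \<in> Z"
    then have "K = {} \<or> K = {..<p}" "L = {} \<or> L = {..<p}" using hcases H(2) by blast+
    then show "sum h (K \<inter> L) \<in> Z" using hfull sg_zero[OF Z] by auto
  qed (use hfull sg_zero[OF Z] in auto)
  have "UF Z (case_sum g h) (I <+> {..<p})"
  proof (rule UF_concat[OF Z fin _ _ g(1) uh])
    fix K L assume KL: "K \<subseteq> I" "L \<subseteq> {..<p}" "sum g K + sum h L \<in> Z"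
    have gK: "sum g K \<in> H" using KL(1) g(2) by (intro sg_sum[OF H(1)]) auto
    then have "sum h L \<in> H" using KL(3) H(2) sg_add_iff1[OF H(1) gK] by blast
    then have "sum h L \<in> Z" using hZ KL(2) by blast
    then show "sum g K \<in> Z \<and> sum h L \<in> Z" using KL(3) sg_add_iff2[OF Z] by blast
  qed simp
  moreover have "case_sum g h ` (I <+> {..<p}) \<subseteq> D - Z"
  proof -
    have "h k \<in> D - H" for k
    proof (cases "k = 0")
      case True
      have "nmul (p - 1) y \<notin> H" using no[of "p - 1"] p2 by simp
      then show ?thesis
        using True y(1) sg_minus[OF D] sg_nmul[OF D] sg_minus_iff[OF H(1)] by (simp add: h_def)
    qed (use y in \<open>simp add: h_def\<close>)
    then have "h k \<in> D - Z" for k using H(2) by blast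
    moreover have "g i \<in> D - Z" if "i \<in> I" for i using that g(2) H(3) by auto
    ultimately show ?thesis by auto
  qed
  moreover have "(\<Sum>i\<in>I <+> {..<p}. wz Z (case_sum g h i)) = \<kappa> + real p * c"
  proof -
    have "(\<Sum>k<p. wz Z (h k)) = (\<Sum>k<p. c)" using w by (intro sum.cong) (auto simp: h_def)
    then show ?thesis using sum_wz_case_sum[OF fin finite_lessThan, of Z g h p] g(3) by simp
  qed
  ultimately show ?thesis by (rule attI)
qed

text \<open>Climbing the layers killed by p^j, each step adds a block of \<open>p\<close> elements
  of order p^(j+1), worth 1/p^j. These are the terms of the upper bound.\<close>

lemma att_cyclic:
  fixes Z :: "'a::ab_group_add set"
  assumes Z: "sg Z" and H: "sg H" "Z \<subseteq> H" and p: "prime p"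
    and y: "y \<in> H" "\<And>k. nmul k y \<in> Z \<longleftrightarrow> p ^ m dvd k"
  shows "att Z H (\<Sum>k<m. 1 / real p ^ k)"
proof -
  have p2: "2 \<le> p" using p prime_ge_2_nat by auto
  have "att Z (H \<inter> tor Z (p ^ j)) (\<Sum>k<j. 1 / real p ^ k)" if "j \<le> m" for j
    using that
  proof (induction j)
    case 0
    show ?case using att_empty[OF Z] by simp
  next
    case (Suc j)
    \<comment> \<open>A multiple of the generator of exact order p^(j+1) modulo
      \<open>Z\<close>.\<close>
    define x where "x = nmul (p ^ (m - Suc j)) y"
    have xt: "nmul k x \<in> tor Z (p ^ i) \<longleftrightarrow> p ^ Suc j dvd p ^ i * k" for k i
    proof -
      have "nmul k x \<in> tor Z (p ^ i) \<longleftrightarrow> p ^ m dvd (p ^ i * k) * p ^ (m - Suc j)"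
        using y(2)[of "p ^ i * (k * p ^ (m - Suc j))"]
        by (simp add: tor_def x_def nmul_mult mult.assoc)
      moreover have "p ^ m = p ^ Suc j * p ^ (m - Suc j)" unfolding power_add[symmetric] using Suc.prems by simp
      ultimately show ?thesis using p2 by simp
    qed
    have xH: "nmul k x \<in> H" for k unfolding x_def using y(1) sg_nmul[OF H(1)] by blast
    have pd: "\<not> p dvd p - 1" using p2 by (auto dest: dvd_imp_le)
    have o: "oz Z z = p ^ Suc j" if z: "z \<in> tor Z (p ^ Suc j)" "z \<notin> tor Z (p ^ j)" for z
    proof -
      have p0: "0 < p ^ Suc j" using p2 by simp
      have "oz Z z dvd p ^ Suc j" "\<not> oz Z z dvd p ^ j" using z oz_dvd[OF Z z(1) p0] by auto
      then show ?thesis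
        unfolding divides_primepow_nat[OF p] by (auto simp: le_Suc_eq)
    qed
    have x1: "x \<in> tor Z (p ^ Suc j)" "x \<notin> tor Z (p ^ j)"
      using xt[of 1 "Suc j"] xt[of 1 j] p2 by auto
    have x2: "- nmul (p - 1) x \<in> tor Z (p ^ Suc j)" "- nmul (p - 1) x \<notin> tor Z (p ^ j)"
      using xt[of "p - 1" "Suc j"] xt[of "p - 1" j] pd p2 sg_minus_iff[OF sg_tor[OF Z]] by auto
    have x3: "nmul p x \<in> tor Z (p ^ j)" using xt[of p j] by (simp add: mult.commute)
    have "att Z (H \<inter> tor Z (p ^ Suc j)) ((\<Sum>k<j. 1 / real p ^ k) + real p * (1 / real p ^ Suc j))"
    proof (rule att_extend[OF Z _ _ _ _ p _ _ _ Suc.IH])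
      show "sg (H \<inter> tor Z (p ^ j))" "sg (H \<inter> tor Z (p ^ Suc j))"
        using H(1) sg_tor[OF Z] sg_Int by blast+
      show "Z \<subseteq> H \<inter> tor Z (p ^ j)" using H(2) sub_tor[OF Z] by blast
      show "H \<inter> tor Z (p ^ j) \<subseteq> H \<inter> tor Z (p ^ Suc j)"
        using tor_dvd[OF Z, of "p ^ j" "p ^ Suc j"] by auto
      show "x \<in> H \<inter> tor Z (p ^ Suc j)" "x \<notin> H \<inter> tor Z (p ^ j)" "nmul p x \<in> H \<inter> tor Z (p ^ j)"
        using x1 x3 xH[of 1] xH[of p] by auto
      show "j \<le> m" using Suc.prems by simp
      show "wz Z x = 1 / real p ^ Suc j" "wz Z (- nmul (p - 1) x) = 1 / real p ^ Suc j"
        using o[OF x1] o[OF x2] by (simp_all add: wz_def)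
    qed
    then show ?case using p2 by simp
  qed
  then have "att Z (H \<inter> tor Z (p ^ m)) (\<Sum>k<m. 1 / real p ^ k)" by simp
  then show ?thesis by (rule att_mono) auto
qed

section \<open>Groups presented by four residue coordinates\<close>

text \<open>With 1 included, the reciprocals sum to less than (1 + 1/(p-1))(1 + 1/(q-1)). The
  smaller of \<open>p\<close> and \<open>q\<close> is at least r + 1 and the larger at least r + 2,
  so this is at most (1 + 1/r)(1 + 1/(r+1)), which telescopes to 1 + 2/r.\<close>

lemma divisor_sum_bound:
  assumes p: "prime p" and r: "0 < r" "r < p" "r < q" "p \<noteq> q" and q': "q' = 1 \<or> q' = q \<and> prime q"
  shows "(\<Sum>d | d dvd p ^ m * q' \<and> 1 < d. 1 / real d) < 2 / real r"
proof -
  let ?A = "{..m} \<times> {1, q}" and ?f = "\<lambda>(k, e). p ^ k * e"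
  have p2: "2 \<le> p" using p prime_ge_2_nat by auto
  have q2: "2 \<le> q" using r by simp
  have sub: "{d. d dvd p ^ m * q' \<and> 1 < d} \<subseteq> ?f ` ?A - {1}"
  proof
    fix d assume "d \<in> {d. d dvd p ^ m * q' \<and> 1 < d}"
    then have d: "d dvd p ^ m * q'" "1 < d" by auto
    then obtain a b where ab: "d = a * b" "a dvd p ^ m" "b dvd q'" using division_decomp by blast
    have "b = 1 \<or> b = q" using ab(3) q' prime_nat_iff by auto
    moreover obtain k where "k \<le> m" "a = p ^ k" using ab divides_primepow_nat[OF p] by blast
    ultimately have "(k, b) \<in> ?A" "d = ?f (k, b)" using ab by auto
    then show "d \<in> ?f ` ?A - {1}" using d(2) by (metis DiffI imageI less_irrefl singletonD)
  qed
  have "(\<Sum>d | d dvd p ^ m * q' \<and> 1 < d. 1 / real d) \<le> (\<Sum>d\<in>?f ` ?A - {1}. 1 / real d)"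
    using sub by (intro sum_mono2) auto
  also have "\<dots> = (\<Sum>d\<in>?f ` ?A. 1 / real d) - 1"
  proof -
    have "1 \<in> ?f ` ?A" by (rule image_eqI[of _ _ "(0, 1)"]) auto
    then show ?thesis by (simp add: sum_diff1)
  qed
  also have "(\<Sum>d\<in>?f ` ?A. 1 / real d) \<le> (\<Sum>x\<in>?A. 1 / real (?f x))"
    using sum_image_le[of ?A "\<lambda>d. 1 / real d" ?f] by (simp add: comp_def)
  also have "\<dots> = (\<Sum>k\<le>m. \<Sum>e\<in>{1, q}. 1 / real (p ^ k * e))"
    by (simp add: sum.cartesian_product case_prod_beta)
  also have "\<dots> = (\<Sum>k\<le>m. (1 / real p ^ k) * (1 + 1 / real q))"
    using q2 by (intro sum.cong) (auto simp: distrib_left)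
  also have "\<dots> = (\<Sum>k\<le>m. (1 / real p) ^ k) * (1 + 1 / real q)"
    by (simp add: sum_distrib_right power_one_over)
  also have "(\<Sum>k\<le>m. (1 / real p) ^ k) = (\<Sum>k<Suc m. (1 / real p) ^ k)"
    by (simp add: lessThan_Suc_atMost)
  also have "\<dots> = (1 - (1 / real p) ^ Suc m) / (1 - 1 / real p)"
    using p2 by (subst geometric_sum) (auto simp: field_simps)
  finally have le: "(\<Sum>d | d dvd p ^ m * q' \<and> 1 < d. 1 / real d) \<le>
    (1 - (1 / real p) ^ Suc m) / (1 - 1 / real p) * (1 + 1 / real q) - 1" by simp
  have "(1 - (1 / real p) ^ Suc m) / (1 - 1 / real p) < 1 / (1 - 1 / real p)"
    using p2 by (intro divide_strict_right_mono) auto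
  then have "(1 - (1 / real p) ^ Suc m) / (1 - 1 / real p) * (1 + 1 / real q) < 1 / (1 - 1 / real p) * (1 + 1 / real q)"
    by (intro mult_strict_right_mono) (auto simp: add_pos_nonneg)
  also have "1 / (1 - 1 / real p) = 1 + 1 / (real p - 1)" using p2 by (simp add: field_simps)
  also have "\<dots> * (1 + 1 / real q) \<le> (1 + 1 / (real p - 1)) * (1 + 1 / (real q - 1))"
    using p2 q2 by (intro mult_left_mono add_left_mono frac_le) auto
  also have "\<dots> \<le> (1 + 1 / real r) * (1 + 1 / (real r + 1))"
  proof (cases "p < q")
    case True
    then have "real r \<le> real p - 1" "real r + 1 \<le> real q - 1" using r by linarith+
    then show ?thesis using r by (intro mult_mono add_left_mono frac_le) auto
  next
    case False
    then have "real r + 1 \<le> real p - 1" "real r \<le> real q - 1" using r by linarith+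
    then have "(1 + 1 / (real p - 1)) * (1 + 1 / (real q - 1)) \<le> (1 + 1 / (real r + 1)) * (1 + 1 / real r)"
      using r by (intro mult_mono add_left_mono frac_le) auto
    then show ?thesis by (simp add: mult.commute)
  qed
  also have "\<dots> = 2 / real r + 1"
  proof -
    have "real r \<noteq> 0" "real r + 1 \<noteq> 0" using r by linarith+
    then show ?thesis by (simp add: divide_simps)
  qed
  finally show ?thesis using le by linarith
qed

text \<open>One presentation for all groups considered. Several coordinates may be the same function
  read modulo coprime moduli, as for a cyclic group, and modulus 1 switches a coordinate off. The
  last assumption is the Chinese remainder theorem in the cyclic case.\<close>

locale coords =
  fixes \<rho> \<alpha> \<beta> \<gamma> :: "'a::ab_group_add \<Rightarrow> int" and r P Q1 Q2 :: nat
  assumes pos: "0 < r" "0 < P" "0 < Q1" "0 < Q2"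
    and add: "\<rho> (x + y) = \<rho> x + \<rho> y" "\<alpha> (x + y) = \<alpha> x + \<alpha> y"
      "\<beta> (x + y) = \<beta> x + \<beta> y" "\<gamma> (x + y) = \<gamma> x + \<gamma> y"
    and surj: "\<exists>x. int r dvd \<rho> x - a \<and> int P dvd \<alpha> x - b \<and> int Q1 dvd \<beta> x - c \<and> int Q2 dvd \<gamma> x - d"
begin

definition Z :: "'a set" where
  "Z = {x. int r dvd \<rho> x \<and> int P dvd \<alpha> x \<and> int Q1 dvd \<beta> x \<and> int Q2 dvd \<gamma> x}"

lemma zero: "\<rho> 0 = 0" "\<alpha> 0 = 0" "\<beta> 0 = 0" "\<gamma> 0 = 0"
  using add[of 0 0] by simp_all

lemma minus: "\<rho> (- x) = - \<rho> x" "\<alpha> (- x) = - \<alpha> x" "\<beta> (- x) = - \<beta> x" "\<gamma> (- x) = - \<gamma> x"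
  using add[of x "- x"] zero by simp_all

lemma diff: "\<rho> (x - y) = \<rho> x - \<rho> y" "\<alpha> (x - y) = \<alpha> x - \<alpha> y" "\<beta> (x - y) = \<beta> x - \<beta> y" "\<gamma> (x - y) = \<gamma> x - \<gamma> y"
  using add[of x "- y"] minus by simp_all

lemma nmul: "\<rho> (nmul n x) = int n * \<rho> x" "\<alpha> (nmul n x) = int n * \<alpha> x"
  "\<beta> (nmul n x) = int n * \<beta> x" "\<gamma> (nmul n x) = int n * \<gamma> x"
  by (induction n) (simp_all add: zero nmul_Suc add algebra_simps)

lemma sgZ: "sg Z"
  by (auto simp: sg_def Z_def zero add minus)

lemma tor_iff: "x \<in> tor Z n \<longleftrightarrow>
    int r dvd int n * \<rho> x \<and> int P dvd int n * \<alpha> x \<and> int Q1 dvd int n * \<beta> x \<and> int Q2 dvd int n * \<gamma> x"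
  by (simp add: tor_def Z_def nmul)

lemma coprime_dvd: "coprime a b \<Longrightarrow> int a dvd int b * x \<longleftrightarrow> int a dvd x"
  by (simp add: coprime_dvd_mult_right_iff)

lemma idx_residue:
  fixes f :: "'a \<Rightarrow> int"
  assumes "0 < l" "\<And>x y. x \<in> D \<Longrightarrow> y \<in> D \<Longrightarrow> int l dvd f x - f y \<Longrightarrow> x - y \<in> Y"
  shows "idx Y D l"
  unfolding idx_def
proof (intro exI[of _ "\<lambda>x. nat (f x mod int l)"] conjI ballI impI)
  fix x y assume xy: "x \<in> D" "y \<in> D" "nat (f x mod int l) = nat (f y mod int l)"
  then have "f x mod int l = f y mod int l" using assms(1) by (simp add: eq_nat_nat_iff)
  then show "x - y \<in> Y" using assms(2) xy by (simp add: mod_eq_dvd_iff)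
qed (use assms(1) in \<open>simp add: nat_less_iff\<close>)

text \<open>On \<open>tor Z (p ^ Suc k)\<close> the coordinate \<open>\<alpha>\<close> is divisible
  by p^(m-k-1), and the quotient modulo \<open>p\<close> separates the cosets of the lower layer.
  The other coordinates must already vanish after multiplication by p^k; this admits a second factor
  of order \<open>p\<close> from level 1 on.\<close>

lemma idx_alpha:
  assumes P: "P = p ^ m" and k: "k < m" and p: "0 < p"
    and other: "\<And>x. x \<in> tor Z (p ^ Suc k) \<Longrightarrow>
      int r dvd int (p ^ k) * \<rho> x \<and> int Q1 dvd int (p ^ k) * \<beta> x \<and> int Q2 dvd int (p ^ k) * \<gamma> x"
  shows "idx (tor Z (p ^ k)) (tor Z (p ^ Suc k)) p"
proof (rule idx_residue[OF p, of _ "\<lambda>x. \<alpha> x div int (p ^ (m - Suc k))"])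
  fix x y assume xy: "x \<in> tor Z (p ^ Suc k)" "y \<in> tor Z (p ^ Suc k)"
    and d: "int p dvd \<alpha> x div int (p ^ (m - Suc k)) - \<alpha> y div int (p ^ (m - Suc k))"
  let ?c = "int (p ^ (m - Suc k))"
  have Pm: "int P = int (p ^ Suc k) * ?c" using k unfolding P by (simp flip: of_nat_mult power_add power_Suc)
  have cx: "?c dvd \<alpha> z" if "z \<in> tor Z (p ^ Suc k)" for z
    using that p unfolding tor_iff Pm by simp
  have "x - y \<in> tor Z (p ^ Suc k)" using xy sg_diff[OF sg_tor[OF sgZ]] by blast
  then have o: "int r dvd int (p ^ k) * \<rho> (x - y)" "int Q1 dvd int (p ^ k) * \<beta> (x - y)" "int Q2 dvd int (p ^ k) * \<gamma> (x - y)"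
    using other by blast+
  have "\<alpha> x = ?c * (\<alpha> x div ?c)" "\<alpha> y = ?c * (\<alpha> y div ?c)" using cx xy by simp_all
  then have "\<alpha> (x - y) = ?c * (\<alpha> x div ?c - \<alpha> y div ?c)" by (simp add: diff right_diff_distrib)
  then have "?c * int p dvd \<alpha> (x - y)" using d by simp
  then have "int (p ^ k) * (?c * int p) dvd int (p ^ k) * \<alpha> (x - y)" by (rule mult_dvd_mono[OF dvd_refl])
  moreover have "int P = int (p ^ k) * (?c * int p)" unfolding Pm by (simp add: mult_ac)
  ultimately show "x - y \<in> tor Z (p ^ k)" using o by (simp add: tor_iff)
qed

lemma bnd_wz_prime:
  assumes q: "prime q" and b: "bnd Z (tor Z q) (\<lambda>_. 1) (real N)"
  shows "bnd Z (tor Z q) (wz Z) (real N / real q)"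
  unfolding bnd_def
proof (intro allI impI)
  fix I :: "nat set" and g assume u: "UF Z g I" and gI: "g ` I \<subseteq> tor Z q - Z"
  have "wz Z (g i) = 1 / real q" if "i \<in> I" for i
  proof -
    have i: "g i \<in> tor Z q" "g i \<notin> Z" using that gI by auto
    have q0: "0 < q" using q by (simp add: prime_gt_0_nat)
    have "oz Z (g i) dvd q" "oz Z (g i) \<noteq> 1"
      using i oz_dvd[OF sgZ i(1) q0, of q] oz_dvd[OF sgZ i(1) q0, of 1] by auto
    then show ?thesis using q prime_nat_iff by (auto simp: wz_def)
  qed
  then have "(\<Sum>i\<in>I. wz Z (g i)) = real (card I) / real q" by simp
  also have "\<dots> \<le> real N / real q" using bnd_card[OF b u gI] by (intro divide_right_mono) auto
  finally show "(\<Sum>i\<in>I. wz Z (g i)) \<le> real N / real q" .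
qed

lemma bnd_trivial: "bnd Z (tor Z (p ^ 0)) w 0"
  unfolding bnd_def
proof (intro allI impI)
  fix I :: "nat set" and g :: "nat \<Rightarrow> 'a" assume "g ` I \<subseteq> tor Z (p ^ 0) - Z"
  then have "I = {}" by auto
  then show "(\<Sum>i\<in>I. w (g i)) \<le> 0" by simp
qed

text \<open>Here and below, \<open>1 / p ^ 0 + ... + 1 / p ^ (m - 1)\<close> is the summand of \<open>K1_star\<close> for the cyclic
  group of order \<open>p ^ m\<close>.\<close>

lemma bnd_p_group:
  assumes p: "prime p" "2 < p" and m: "1 \<le> m" and P: "P = p ^ m" and Q: "Q1 = p" "Q2 = 1"
    and cr: "coprime r p"
  shows "bnd Z (tor Z (p ^ m)) (wz Z) ((\<Sum>k<m. 1 / real p ^ k) + 1)"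
proof -
  have p0: "0 < p" using p by simp
  have cp: "coprime r (p ^ k)" for k using cr by simp
  have c: "int P = int p * int (p ^ (m - 1))" using m unfolding P by (simp flip: of_nat_mult power_Suc)
  have c0: "int (p ^ (m - 1)) \<noteq> 0" using p0 by simp
  have ca: "int (p ^ (m - 1)) dvd \<alpha> x" if "x \<in> tor Z p" for x
    using that p0 unfolding tor_iff c by simp
  have "bnd Z (tor Z p) (\<lambda>_. 1) (real (2 * p))"
  proof (rule bnd_length_rank2[OF p sg_tor[OF sgZ], where f = "\<lambda>x. (\<alpha> x div int (p ^ (m - 1)), \<beta> x)"])
    fix x y assume xy: "x \<in> tor Z p" "y \<in> tor Z p"
    show "(\<alpha> (x + y) div int (p ^ (m - 1)), \<beta> (x + y)) =
      (\<alpha> x div int (p ^ (m - 1)), \<beta> x) + (\<alpha> y div int (p ^ (m - 1)), \<beta> y)"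
      using ca[OF xy(1)] by (simp add: add div_plus_div_distrib_dvd_left)
    have "int P dvd \<alpha> x \<longleftrightarrow> int p dvd \<alpha> x div int (p ^ (m - 1))"
      unfolding c using ca[OF xy(1)] c0 by (simp add: dvd_div_iff_mult)
    moreover have "int r dvd \<rho> x" using xy(1) coprime_dvd[OF cr] by (simp add: tor_iff)
    moreover have "x \<in> Z \<longleftrightarrow> int r dvd \<rho> x \<and> int P dvd \<alpha> x \<and> int p dvd \<beta> x"
      unfolding Z_def using Q by simp
    ultimately show "x \<in> Z \<longleftrightarrow> (\<alpha> x div int (p ^ (m - 1)), \<beta> x) \<in> pz (int p)"
      by (simp add: pz_def)
  qed
  \<comment> \<open>The bottom layer of type (p, p) contributes 2p/p = 2: the term for k = 0 and the
    1 of the second factor.\<close>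
  then have "bnd Z (tor Z (p ^ 1)) (wz Z) (real (2 * p) / real p)" unfolding power_one_right by (rule bnd_wz_prime[OF p(1)])
  then have "bnd Z (tor Z (p ^ m)) (wz Z) (real (2 * p) / real p + (\<Sum>k=1..<m. 1 / real p ^ k))"
  proof (rule bnd_tor_filtration[OF sgZ p(1) _ _ m])
    fix k assume k: "1 \<le> k" "k < m"
    show "idx (tor Z (p ^ k)) (tor Z (p ^ Suc k)) p"
    proof (rule idx_alpha[OF P k(2) p0])
      fix x assume "x \<in> tor Z (p ^ Suc k)"
      then have "int r dvd \<rho> x" using coprime_dvd[OF cp] unfolding tor_iff by blast
      moreover have "int p dvd int (p ^ k)" using k by (simp add: dvd_power)
      ultimately show "int r dvd int (p ^ k) * \<rho> x \<and> int Q1 dvd int (p ^ k) * \<beta> x \<and> int Q2 dvd int (p ^ k) * \<gamma> x"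
        by (simp add: Q)
    qed
  qed
  moreover have "(\<Sum>k<m. 1 / real p ^ k) = 1 + (\<Sum>k=1..<m. 1 / real p ^ k)"
  proof -
    have "{..<m} = insert 0 {1..<m}" using m by auto
    then show ?thesis by simp
  qed
  ultimately show ?thesis using p0 by (simp add: algebra_simps)
qed

text \<open>The \<open>p\<close>-part is cyclic, so every layer of its filtration has index at most
  \<open>p\<close>, starting from the trivial one; the elementary \<open>q\<close>-part is then
  added in one step.\<close>

lemma bnd_two_primes:
  assumes p: "prime p" and q: "prime q" "p \<noteq> q" and P: "P = p ^ m" and Q: "coprime Q1 p" "coprime Q2 p"
    and cr: "coprime r p" and b: "bnd Z (tor Z q) (\<lambda>_. 1) (real N)"
  shows "bnd Z (tor Z (p ^ m * q)) (wz Z) ((\<Sum>k<m. 1 / real p ^ k) + real N / real q)"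
proof -
  have p0: "0 < p" using p by (simp add: prime_gt_0_nat)
  have ix: "idx (tor Z (p ^ k)) (tor Z (p ^ Suc k)) p" if "k < m" for k
  proof (rule idx_alpha[OF P that p0])
    fix x assume x: "x \<in> tor Z (p ^ Suc k)"
    have "coprime r (p ^ Suc k)" "coprime Q1 (p ^ Suc k)" "coprime Q2 (p ^ Suc k)" using cr Q by simp_all
    then have "int r dvd \<rho> x" "int Q1 dvd \<beta> x" "int Q2 dvd \<gamma> x"
      using x coprime_dvd unfolding tor_iff by blast+
    then show "int r dvd int (p ^ k) * \<rho> x \<and> int Q1 dvd int (p ^ k) * \<beta> x \<and> int Q2 dvd int (p ^ k) * \<gamma> x"
      by simp
  qed
  have "bnd Z (tor Z (p ^ m)) (wz Z) (0 + (\<Sum>k=0..<m. 1 / real p ^ k))"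
    by (rule bnd_tor_filtration[OF sgZ p bnd_trivial]) (use ix in auto)
  then have "bnd Z (tor Z (p ^ m)) (wz Z) (\<Sum>k<m. 1 / real p ^ k)" by (simp add: atLeast0LessThan)
  then show ?thesis using bnd_primary_plus_elementary[OF sgZ p q _ _ b] ix by blast
qed

lemma idx_rho:
  assumes "coprime P r" "coprime Q1 r" "coprime Q2 r"
  shows "idx Z (tor Z r) r"
proof (rule idx_residue[OF pos(1), of _ \<rho>])
  fix x y assume xy: "x \<in> tor Z r" "y \<in> tor Z r" and d: "int r dvd \<rho> x - \<rho> y"
  have "x - y \<in> tor Z r" using xy sg_diff[OF sg_tor[OF sgZ]] by blast
  then show "x - y \<in> Z"
    using d unfolding tor_iff coprime_dvd[OF assms(1)] coprime_dvd[OF assms(2)] coprime_dvd[OF assms(3)]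
    by (simp add: Z_def diff(1))
qed

lemma att_all:
  assumes r: "prime r" and p: "prime p" "P = p ^ m" and q: "prime q" "Q1 = q"
    and n: "n = 1 \<and> Q2 = 1 \<or> n = 2 \<and> Q2 = q"
  shows "att Z UNIV (1 + ((\<Sum>k<m. 1 / real p ^ k) + real n))"
proof -
  \<comment> \<open>\<open>H1\<close> to \<open>H4\<close> leave one coordinate free each,
    \<open>H34\<close> the last two and \<open>H234\<close> the last three.\<close>
  define H1 where "H1 = {x. int P dvd \<alpha> x \<and> int Q1 dvd \<beta> x \<and> int Q2 dvd \<gamma> x}"
  define H2 where "H2 = {x. int r dvd \<rho> x \<and> int Q1 dvd \<beta> x \<and> int Q2 dvd \<gamma> x}"
  define H3 where "H3 = {x. int r dvd \<rho> x \<and> int P dvd \<alpha> x \<and> int Q2 dvd \<gamma> x}"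
  define H4 where "H4 = {x. int r dvd \<rho> x \<and> int P dvd \<alpha> x \<and> int Q1 dvd \<beta> x}"
  define H34 where "H34 = {x. int r dvd \<rho> x \<and> int P dvd \<alpha> x}"
  define H234 where "H234 = {x. int r dvd \<rho> x}"
  note defs = H1_def H2_def H3_def H4_def H34_def H234_def Z_def
  have sg: "sg H1" "sg H2" "sg H3" "sg H4" "sg H34" "sg H234"
    by (auto simp: sg_def defs zero add minus)
  have sub: "Z \<subseteq> H1" "Z \<subseteq> H2" "Z \<subseteq> H3" "Z \<subseteq> H4" "Z \<subseteq> H34" "Z \<subseteq> H234"
    by (auto simp: defs)
  have one: "int l dvd int k * f \<longleftrightarrow> l dvd k" if "int l dvd f - 1" for l k and f :: int
  proof -
    have "int k * f = int k * (f - 1) + int k" by (simp add: algebra_simps)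
    then have "int l dvd int k * f \<longleftrightarrow> int l dvd int k" using that by (simp add: dvd_add_right_iff)
    then show ?thesis by (simp add: int_dvd_int_iff)
  qed
  have a1: "att Z H1 1"
  proof -
    obtain x where x: "int r dvd \<rho> x - 1" "int P dvd \<alpha> x" "int Q1 dvd \<beta> x" "int Q2 dvd \<gamma> x"
      using surj[of 1 0 0 0] by auto
    have "att Z H1 (\<Sum>k<(1::nat). 1 / real r ^ k)"
    proof (rule att_cyclic[OF sgZ sg(1) sub(1) r, of x])
      show "x \<in> H1" by (simp add: H1_def x)
      show "nmul k x \<in> Z \<longleftrightarrow> r ^ 1 dvd k" for k
        by (auto simp: Z_def nmul x one[OF x(1)])
    qed
    then show ?thesis by simp
  qed
  have a2: "att Z H2 (\<Sum>k<m. 1 / real p ^ k)"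
  proof -
    obtain x where x: "int r dvd \<rho> x" "int P dvd \<alpha> x - 1" "int Q1 dvd \<beta> x" "int Q2 dvd \<gamma> x"
      using surj[of 0 1 0 0] by auto
    show ?thesis
    proof (rule att_cyclic[OF sgZ sg(2) sub(2) p(1), of x])
      show "x \<in> H2" by (simp add: H2_def x)
      show "nmul k x \<in> Z \<longleftrightarrow> p ^ m dvd k" for k
        unfolding p(2)[symmetric] by (auto simp: Z_def nmul x one[OF x(2)])
    qed
  qed
  have a3: "att Z H3 1"
  proof -
    obtain x where x: "int r dvd \<rho> x" "int P dvd \<alpha> x" "int Q1 dvd \<beta> x - 1" "int Q2 dvd \<gamma> x"
      using surj[of 0 0 1 0] by auto
    have "att Z H3 (\<Sum>k<(1::nat). 1 / real q ^ k)"
    proof (rule att_cyclic[OF sgZ sg(3) sub(3) q(1), of x])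
      show "x \<in> H3" by (simp add: H3_def x)
      show "nmul k x \<in> Z \<longleftrightarrow> q ^ 1 dvd k" for k
        unfolding q(2)[symmetric] by (auto simp: Z_def nmul x one[OF x(3)])
    qed
    then show ?thesis by simp
  qed
  have a34: "att Z H34 (real n)"
    using n
  proof
    assume "n = 1 \<and> Q2 = 1"
    then show ?thesis using att_mono[OF a3, of H34] by (auto simp: defs)
  next
    assume Q2: "n = 2 \<and> Q2 = q"
    obtain x where x: "int r dvd \<rho> x" "int P dvd \<alpha> x" "int Q1 dvd \<beta> x" "int Q2 dvd \<gamma> x - 1"
      using surj[of 0 0 0 1] by auto
    have "att Z H4 (\<Sum>k<(1::nat). 1 / real q ^ k)"
    proof (rule att_cyclic[OF sgZ sg(4) sub(4) q(1), of x])
      show "x \<in> H4" by (simp add: H4_def x)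
      show "nmul k x \<in> Z \<longleftrightarrow> q ^ 1 dvd k" for k
        unfolding Q2[THEN conjunct2, symmetric] by (auto simp: Z_def nmul x one[OF x(4)])
    qed
    then have "att Z H4 1" by simp
    from sgZ sg(3,4) sub(3,4) _ _ _ a3 this have "att Z H34 (1 + 1)"
      by (rule att_direct_sum) (auto simp: defs)
    then show ?thesis using Q2 by simp
  qed
  have a234: "att Z H234 ((\<Sum>k<m. 1 / real p ^ k) + real n)"
    by (rule att_direct_sum[OF sgZ sg(2,5) sub(2,5) _ _ _ a2 a34]) (auto simp: defs)
  show ?thesis
    by (rule att_direct_sum[OF sgZ sg(1,6) sub(1,6) _ _ _ a1 a234]) (auto simp: defs)
qed

end

section \<open>The exact maximum in coordinates\<close>

context coords
begin

lemma idx_beta: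
  assumes "coprime r q" "coprime P q" "Q1 = q" "Q2 = 1"
  shows "idx Z (tor Z q) q"
proof (rule idx_residue[of _ _ \<beta>])
  show "0 < q" using pos assms by simp
  fix x y assume xy: "x \<in> tor Z q" "y \<in> tor Z q" and d: "int q dvd \<beta> x - \<beta> y"
  have "x - y \<in> tor Z q" using xy sg_diff[OF sg_tor[OF sgZ]] by blast
  then have "int r dvd \<rho> (x - y)" "int P dvd \<alpha> (x - y)"
    using coprime_dvd[OF assms(1)] coprime_dvd[OF assms(2)] unfolding tor_iff by blast+
  moreover have "int Q1 dvd \<beta> (x - y)" "int Q2 dvd \<gamma> (x - y)"
    using d assms by (simp_all add: diff)
  ultimately show "x - y \<in> Z" unfolding Z_def by simp
qed

lemma bnd_length_beta_gamma:
  assumes "coprime r q" "coprime P q" "Q1 = q" "prime q" "2 < q"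
    and n: "n = 1 \<and> Q2 = 1 \<or> n = 2 \<and> Q2 = q"
  shows "bnd Z (tor Z q) (\<lambda>_. 1) (real (n * q))"
  using n
proof
  assume n: "n = 1 \<and> Q2 = 1"
  then show ?thesis
    using bnd_length_idx[OF sgZ sg_tor[OF sgZ] idx_beta[OF assms(1-3)]] by simp
next
  assume n: "n = 2 \<and> Q2 = q"
  have "bnd Z (tor Z q) (\<lambda>_. 1) (real (2 * q))"
  proof (rule bnd_length_rank2[OF assms(4,5) sg_tor[OF sgZ], where f = "\<lambda>x. (\<beta> x, \<gamma> x)"])
    fix x assume x: "x \<in> tor Z q"
    have "int r dvd \<rho> x" "int P dvd \<alpha> x"
      using x coprime_dvd[OF assms(1)] coprime_dvd[OF assms(2)] unfolding tor_iff by blast+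
    moreover have "x \<in> Z \<longleftrightarrow> int r dvd \<rho> x \<and> int P dvd \<alpha> x \<and> int q dvd \<beta> x \<and> int q dvd \<gamma> x"
      unfolding Z_def using assms(3) n by simp
    ultimately show "x \<in> Z \<longleftrightarrow> (\<beta> x, \<gamma> x) \<in> pz (int q)" by (simp add: pz_def)
  qed (simp add: add)
  then show ?thesis using n by simp
qed

text \<open>Bundles what the transfer to groups requires: \<open>\<kappa>\<close> is attained and is
  an upper bound, and in case of equality every element lies in the \<open>r\<close>-part or in the
  complement killed by \<open>e\<close>.\<close>

definition extremal :: "real \<Rightarrow> nat \<Rightarrow> bool" where
  "extremal \<kappa> e \<longleftrightarrow> 0 < e \<and> coprime e r \<and> (\<forall>x. int r dvd \<rho> x \<longrightarrow> x \<in> tor Z e) \<and> att Z UNIV \<kappa> \<and>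
     (\<forall>(I::nat set) g. UF Z g I \<longrightarrow> g ` I \<inter> Z = {} \<longrightarrow> (\<Sum>i\<in>I. wz Z (g i)) \<le> \<kappa> \<and>
       ((\<Sum>i\<in>I. wz Z (g i)) = \<kappa> \<longrightarrow> (\<forall>i\<in>I. g i \<in> tor Z e \<or> g i \<in> tor Z r)))"

lemma extremalI:
  assumes r: "prime r" and e: "coprime e r" "0 < e" and cop: "coprime P r" "coprime Q1 r" "coprime Q2 r"
    and b: "bnd Z (tor Z e) (wz Z) \<kappa>" and D: "(\<Sum>d | d dvd e \<and> 1 < d. 1 / real d) < 2 / real r"
    and att: "att Z UNIV (1 + \<kappa>)" and dv: "P dvd e" "Q1 dvd e" "Q2 dvd e"
  shows "extremal (1 + \<kappa>) e"
proof -
  have dvi: "int P dvd int e" "int Q1 dvd int e" "int Q2 dvd int e" using dv by (simp_all add: int_dvd_int_iff)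
  have te: "x \<in> tor Z e" if "int r dvd \<rho> x" for x using that dvi by (simp add: tor_iff)
  have all: "x \<in> tor Z (e * r)" for x using dvi by (simp add: tor_iff)
  have "(\<Sum>i\<in>I. wz Z (g i)) \<le> 1 + \<kappa> \<and>
       ((\<Sum>i\<in>I. wz Z (g i)) = 1 + \<kappa> \<longrightarrow> (\<forall>i\<in>I. g i \<in> tor Z e \<or> g i \<in> tor Z r))"
    if u: "UF Z g I" "g ` I \<inter> Z = {}" for I :: "nat set" and g
  proof -
    have "g ` I \<subseteq> tor Z (e * r) - Z" using all u(2) by auto
    note R = cross_bound_plus_prime_cyclic[OF sgZ r e idx_rho[OF cop] b D u(1) this]
    show ?thesis using R by blast
  qed
  then show ?thesis unfolding extremal_def using e te att by blast
qed

lemma extremal_p_group: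
  assumes r: "prime r" and p: "prime p" "r < p" and m: "1 \<le> m" and P: "P = p ^ m" and Q: "Q1 = p" "Q2 = 1"
  shows "extremal (1 + ((\<Sum>k<m. 1 / real p ^ k) + 1)) (p ^ m)"
proof -
  have r2: "2 \<le> r" using r prime_ge_2_nat by auto
  have cr: "coprime r p" using primes_coprime[OF r p(1)] p(2) by simp
  have "att Z UNIV (1 + ((\<Sum>k<m. 1 / real p ^ k) + real 1))"
    by (rule att_all[OF r p(1) P p(1) Q(1)]) (use Q in simp)
  \<comment> \<open>There is no second prime here; \<open>p + 1\<close> takes the place of
    \<open>q\<close> in the estimate.\<close>
  moreover have "(\<Sum>d | d dvd p ^ m \<and> 1 < d. 1 / real d) < 2 / real r"
    using divisor_sum_bound[OF p(1), of r "p + 1" 1 m] p(2) r2 by simp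
  moreover have "p dvd p ^ m" using m by (simp add: dvd_power)
  ultimately show ?thesis
    using bnd_p_group[OF p(1) _ m P Q cr] cr p r2 P Q
    by (intro extremalI[OF r]) (auto simp: coprime_commute)
qed

lemma extremal_two_primes:
  assumes r: "prime r" and p: "prime p" "r < p" and q: "prime q" "r < q" "p \<noteq> q"
    and P: "P = p ^ m" and Q: "Q1 = q" and n: "n = 1 \<and> Q2 = 1 \<or> n = 2 \<and> Q2 = q"
  shows "extremal (1 + ((\<Sum>k<m. 1 / real p ^ k) + real n)) (p ^ m * q)"
proof -
  have r2: "2 \<le> r" using r prime_ge_2_nat by auto
  have c: "coprime r p" "coprime r q" "coprime q p"
    using primes_coprime[OF r p(1)] primes_coprime[OF r q(1)] primes_coprime[OF q(1) p(1)] p q by auto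
  have c': "coprime P q" "coprime Q2 p" using c n P by (auto simp: coprime_commute)
  have b: "bnd Z (tor Z q) (\<lambda>_. 1) (real (n * q))"
    using q r2 by (intro bnd_length_beta_gamma[OF c(2) c'(1) Q q(1) _ n]) simp
  have "real (n * q) / real q = real n" using q r2 by simp
  then have "bnd Z (tor Z (p ^ m * q)) (wz Z) ((\<Sum>k<m. 1 / real p ^ k) + real n)"
    using bnd_two_primes[OF p(1) q(1,3) P _ c'(2) c(1) b] Q c by simp
  moreover have "att Z UNIV (1 + ((\<Sum>k<m. 1 / real p ^ k) + real n))"
    by (rule att_all[OF r p(1) P q(1) Q n])
  moreover have "(\<Sum>d | d dvd p ^ m * q \<and> 1 < d. 1 / real d) < 2 / real r"
    using divisor_sum_bound[OF p(1), of r q q m] p q r2 by simp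
  moreover have "coprime P r" "coprime Q1 r" "coprime Q2 r" "P dvd p ^ m * q" "Q1 dvd p ^ m * q" "Q2 dvd p ^ m * q"
    using c n P Q by (auto simp: coprime_commute)
  ultimately show ?thesis
    using c p q r2 by (intro extremalI[OF r]) (auto simp: coprime_commute)
qed

end

section \<open>Lists and index families\<close>

text \<open>The elements of the carrier are viewed as representatives in an ambient additive group, on which
  \<open>\<pi>\<close> is reduction; for \<open>Cyc n\<close> these are the integers and reduction modulo \<open>n\<close>.\<close>

definition rep :: "'a::ab_group_add monoid \<Rightarrow> ('a \<Rightarrow> 'a) \<Rightarrow> bool" where
  "rep G \<pi> \<longleftrightarrow> comm_group G \<and> finite (carrier G) \<and> (\<forall>x. \<pi> x \<in> carrier G) \<and>
     (\<forall>x y. \<pi> (x + y) = \<pi> x \<otimes>\<^bsub>G\<^esub> \<pi> y) \<and> (\<forall>x\<in>carrier G. \<pi> x = x)"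

text \<open>The position at which \<open>nths S I\<close> stores the entry \<open>S ! i\<close>, for
  \<open>i\<close> in \<open>I\<close>.\<close>

definition rank :: "nat set \<Rightarrow> nat \<Rightarrow> nat" where
  "rank I i = card {j \<in> I. j < i}"

lemma rank_less: "finite I \<Longrightarrow> i \<in> I \<Longrightarrow> j \<in> I \<Longrightarrow> i < j \<Longrightarrow> rank I i < rank I j"
  unfolding rank_def by (intro psubset_card_mono) auto

lemma rank_inj: "finite I \<Longrightarrow> inj_on (rank I) I"
  by (intro inj_onI) (metis linorder_neqE_nat nat_neq_iff rank_less)

lemma rank_image:
  assumes "finite I" shows "rank I ` I = {..<card I}"
proof (rule card_subset_eq)
  show "rank I ` I \<subseteq> {..<card I}"
  proof
    fix x assume "x \<in> rank I ` I"
    then obtain i where i: "i \<in> I" "x = rank I i" by auto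
    have "{j \<in> I. j < i} \<subset> I" using i by auto
    then show "x \<in> {..<card I}" using assms i by (simp add: rank_def psubset_card_mono)
  qed
  show "card (rank I ` I) = card {..<card I}" using rank_inj[OF assms] by (simp add: card_image)
qed simp

lemma length_nths_card: "I \<subseteq> {..<length S} \<Longrightarrow> length (nths S I) = card I"
proof -
  assume "I \<subseteq> {..<length S}"
  then have "{i. i < length S \<and> i \<in> I} = I" by auto
  then show ?thesis by (simp add: length_nths)
qed

lemma nths_nths_rank: "nths (nths S I) J = nths S {i \<in> I. rank I i \<in> J}"
  unfolding nths_nths rank_def by (rule arg_cong[of _ _ "nths S"]) auto

lemma nths_single: "k < length S \<Longrightarrow> nths S {k} = [S ! k]"
proof (induction S arbitrary: k)
  case (Cons x S)
  then show ?case by (cases k) (simp_all add: nths_Cons)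
qed simp

lemma nth_nths_rank:
  assumes I: "I \<subseteq> {..<length S}" "i \<in> I"
  shows "nths S I ! rank I i = S ! i"
proof -
  have fin: "finite I" using I finite_subset by blast
  have "rank I i \<in> {..<card I}" using rank_image[OF fin] I(2) by blast
  then have "[nths S I ! rank I i] = nths (nths S I) {rank I i}"
    using nths_single[of "rank I i" "nths S I"] length_nths_card[OF I(1)] by simp
  also have "\<dots> = nths S {k \<in> I. rank I k \<in> {rank I i}}" by (rule nths_nths_rank)
  also have "{k \<in> I. rank I k \<in> {rank I i}} = {i}"
    using rank_inj[OF fin] I(2) by (auto dest: inj_onD)
  also have "nths S {i} = [S ! i]" using I by (intro nths_single) auto
  finally show ?thesis by simp
qed

lemma UF_cong_mod:
  fixes g h :: "'i \<Rightarrow> 'a::ab_group_add"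
  assumes Z: "sg Z" and gh: "\<And>i. i \<in> I \<Longrightarrow> g i - h i \<in> Z" and u: "UF Z g I"
  shows "UF Z h I"
proof -
  have *: "sum h K \<in> Z \<longleftrightarrow> sum g K \<in> Z" if "K \<subseteq> I" for K
  proof -
    have "(\<Sum>i\<in>K. g i - h i) \<in> Z" using gh that by (intro sg_sum[OF Z]) auto
    then have d: "sum g K - sum h K \<in> Z" by (simp add: sum_subtractf)
    have "sum g K = (sum g K - sum h K) + sum h K" by simp
    then show ?thesis using sg_add_iff1[OF Z d] by metis
  qed
  show ?thesis unfolding UF_def ucl_def
  proof (intro conjI allI impI)
    show "finite I" using u ucl_finite by (auto simp: UF_def)
    show "sum h I \<in> Z" using u * by (simp add: UF_def)
    fix K L assume KL: "K \<subseteq> I" "L \<subseteq> I" "sum h K \<in> Z" "sum h L \<in> Z"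
    then have "sum g (K \<inter> L) \<in> Z" using u * by (auto simp: UF_def intro: ucl_Int)
    moreover have "K \<inter> L \<subseteq> I" using KL by auto
    ultimately show "sum h (K \<inter> L) \<in> Z" using * by blast
  qed
qed

lemma UF_nths:
  assumes Z: "sg Z" and I: "I \<subseteq> {..<length S}"
  shows "UF Z (nth (nths S I)) {..<length (nths S I)} \<longleftrightarrow> UF Z (nth S) I"
proof -
  have fin: "finite I" using I finite_subset by blast
  have "UF Z (nth (nths S I)) {..<length (nths S I)} \<longleftrightarrow> UF Z (nth (nths S I) \<circ> rank I) I"
    using UF_reindex[OF rank_inj[OF fin], of Z "nth (nths S I)"] rank_image[OF fin] length_nths_card[OF I] by simp
  also have "\<dots> \<longleftrightarrow> UF Z (nth S) I"
    using UF_cong_mod[OF Z, of I "nth (nths S I) \<circ> rank I" "nth S"]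
      UF_cong_mod[OF Z, of I "nth S" "nth (nths S I) \<circ> rank I"] nth_nths_rank[OF I] sg_zero[OF Z] by auto
  finally show ?thesis .
qed

lemma sum_list_nths:
  fixes S :: "'a::comm_monoid_add list"
  assumes "I \<subseteq> {..<length S}"
  shows "sum_list (nths S I) = (\<Sum>i\<in>I. S ! i)"
proof -
  have fin: "finite I" using assms finite_subset by blast
  have "sum_list (nths S I) = (\<Sum>j<card I. nths S I ! j)"
    by (simp add: sum_list_sum_nth length_nths_card[OF assms] atLeast0LessThan)
  also have "\<dots> = (\<Sum>j\<in>rank I ` I. nths S I ! j)" by (simp add: rank_image[OF fin])
  also have "\<dots> = (\<Sum>i\<in>I. S ! i)"
    using rank_inj[OF fin] nth_nths_rank[OF assms] by (simp add: sum.reindex)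
  finally show ?thesis .
qed

section \<open>Transfer between a finite abelian group and its ambient group\<close>

locale presented =
  fixes G :: "'a::ab_group_add monoid" and \<pi> :: "'a \<Rightarrow> 'a" and Z :: "'a set"
  assumes rep: "rep G \<pi>" and Zdef: "Z = {x. \<pi> x = \<one>\<^bsub>G\<^esub>}"
begin

sublocale comm_group G
  using rep by (simp add: rep_def)

lemma fin: "finite (carrier G)"
  and closed: "\<pi> x \<in> carrier G"
  and hom: "\<pi> (x + y) = \<pi> x \<otimes>\<^bsub>G\<^esub> \<pi> y"
  and id: "x \<in> carrier G \<Longrightarrow> \<pi> x = x"
  using rep by (auto simp: rep_def)

lemma pi_zero: "\<pi> 0 = \<one>\<^bsub>G\<^esub>"
  using hom[of 0 0] closed[of 0] by (simp add: r_cancel_one')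

lemma sgZ: "sg Z"
proof -
  have "\<pi> (- x) = \<one>\<^bsub>G\<^esub>" if "\<pi> x = \<one>\<^bsub>G\<^esub>" for x
    using hom[of x "- x"] that closed[of "- x"] by (simp add: pi_zero)
  then show ?thesis by (auto simp: sg_def Zdef pi_zero hom)
qed

lemma pi_diff: "\<pi> x - x \<in> Z"
proof -
  have "\<pi> ((\<pi> x - x) + x) = \<pi> x" using id[OF closed] by simp
  then have "\<pi> (\<pi> x - x) \<otimes>\<^bsub>G\<^esub> \<pi> x = \<pi> x" unfolding hom[of "\<pi> x - x" x] .
  then show ?thesis using closed by (simp add: Zdef l_cancel_one)
qed

lemma pi_finprod: "finite A \<Longrightarrow> (\<And>i. i \<in> A \<Longrightarrow> f i \<in> carrier G) \<Longrightarrow> finprod G f A = \<pi> (sum f A)"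
proof (induction A rule: finite_induct)
  case (insert i A)
  then have "finprod G f (insert i A) = f i \<otimes>\<^bsub>G\<^esub> finprod G f A" by (intro finprod_insert) auto
  then show ?case using insert id[of "f i"] by (simp add: hom)
qed (simp add: pi_zero)

lemma pi_pow: "x \<in> carrier G \<Longrightarrow> x [^]\<^bsub>G\<^esub> (n::nat) = \<pi> (nmul n x)"
proof (induction n)
  case (Suc n)
  then have "x [^]\<^bsub>G\<^esub> Suc n = \<pi> (nmul n x) \<otimes>\<^bsub>G\<^esub> \<pi> x" by (simp add: id)
  also have "\<dots> = \<pi> (nmul n x + x)" by (simp add: hom)
  finally show ?case by (simp add: nmul_Suc add.commute)
qed (simp add: pi_zero)

lemma tor_order: "x \<in> tor Z (Coset.order G)" and order_pos: "0 < Coset.order G"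
proof -
  show "0 < Coset.order G" using order_gt_0_iff_finite fin by simp
  have "\<pi> x [^]\<^bsub>G\<^esub> Coset.order G = \<one>\<^bsub>G\<^esub>" using pow_order_eq_1 closed by simp
  then have "nmul (Coset.order G) (\<pi> x) \<in> Z" using pi_pow[OF closed] by (simp add: Zdef)
  moreover have "nmul (Coset.order G) (\<pi> x) - nmul (Coset.order G) x \<in> Z"
    using sg_nmul[OF sgZ pi_diff] by (simp add: nmul_diff)
  ultimately have "nmul (Coset.order G) (\<pi> x) - (nmul (Coset.order G) (\<pi> x) - nmul (Coset.order G) x) \<in> Z"
    by (rule sg_diff[OF sgZ])
  then show "x \<in> tor Z (Coset.order G)" by (simp add: tor_def)
qed

lemma ord_eq: "x \<in> carrier G \<Longrightarrow> ord x = oz Z x"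
proof -
  assume x: "x \<in> carrier G"
  have "ord x dvd n \<longleftrightarrow> oz Z x dvd n" for n
    using pow_eq_id[OF x, of n] pi_pow[OF x, of n] oz_dvd[OF sgZ tor_order order_pos, of x n]
    by (simp add: Zdef tor_def)
  then show ?thesis by (meson dvd_antisym dvd_refl)
qed

lemma zero_sum_nths:
  assumes "set S \<subseteq> carrier G" "I \<subseteq> {..<length S}"
  shows "zero_sum G (nths S I) \<longleftrightarrow> sum (nth S) I \<in> Z"
proof -
  have "set (nths S I) \<subseteq> carrier G" using assms(1) set_nths_subset[of S I] by (rule order_trans[rotated])
  then have "seq_sum G (nths S I) = \<pi> (\<Sum>i<length (nths S I). nths S I ! i)"
    unfolding seq_sum_def by (intro pi_finprod) (auto dest: nth_mem)
  also have "(\<Sum>i<length (nths S I). nths S I ! i) = sum_list (nths S I)"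
    by (simp add: sum_list_sum_nth atLeast0LessThan)
  also have "\<dots> = (\<Sum>i\<in>I. S ! i)" by (rule sum_list_nths[OF assms(2)])
  finally show ?thesis by (simp add: zero_sum_def Zdef)
qed

lemma minimal_zero_sum_nths:
  assumes S: "set S \<subseteq> carrier G" and I: "I \<subseteq> {..<length S}" "I \<noteq> {}"
  shows "minimal_zero_sum G (nths S I) \<longleftrightarrow> minz Z (nth S) I"
proof -
  have fin: "finite I" using I finite_subset by blast
  note inj = rank_inj[OF fin] and im = rank_image[OF fin]
  define R where "R J = {i \<in> I. rank I i \<in> J}" for J
  have RI: "R J \<subseteq> {..<length S}" for J using I by (auto simp: R_def)
  have "(\<forall>J. J \<noteq> {} \<and> J \<subset> {..<card I} \<longrightarrow> \<not> zero_sum G (nths (nths S I) J)) \<longleftrightarrow>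
    (\<forall>K. K \<noteq> {} \<longrightarrow> K \<subset> I \<longrightarrow> sum (nth S) K \<notin> Z)" (is "?L \<longleftrightarrow> ?R")
  proof
    assume L: ?L
    show ?R
    proof (intro allI impI)
      fix K assume K: "K \<noteq> {}" "K \<subset> I"
      have "rank I ` K \<noteq> rank I ` I" using inj_on_image_eq_iff[OF inj, of K I] K(2) by auto
      then have "rank I ` K \<subset> rank I ` I" using K(2) by blast
      then have "rank I ` K \<subset> {..<card I}" using im by simp
      then have "\<not> zero_sum G (nths (nths S I) (rank I ` K))"
        using L[rule_format, of "rank I ` K"] K(1) by simp
      moreover have "{i \<in> I. rank I i \<in> rank I ` K} = K" using inj K by (auto dest: inj_onD)
      ultimately show "sum (nth S) K \<notin> Z"
        using zero_sum_nths[OF S, of K] K I by (simp add: nths_nths_rank subset_trans psubset_imp_subset)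
    qed
  next
    assume Rr: ?R
    show ?L
    proof (intro allI impI)
      fix J assume J: "J \<noteq> {} \<and> J \<subset> {..<card I}"
      have "J \<subset> rank I ` I" using J im by simp
      then have "R J \<noteq> {}" "R J \<subset> I" using J by (auto simp: R_def)
      then have "sum (nth S) (R J) \<notin> Z" using Rr by blast
      then show "\<not> zero_sum G (nths (nths S I) J)"
        using zero_sum_nths[OF S RI] by (simp add: nths_nths_rank R_def)
    qed
  qed
  then show ?thesis
    using I(2) zero_sum_nths[OF S I(1)] length_nths_card[OF I(1)] by (simp add: minimal_zero_sum_def minz_def)
qed

lemma UFIM_iff:
  assumes "X \<subseteq> carrier G"
  shows "UFIM G X S \<longleftrightarrow> set S \<subseteq> X \<and> UF Z (nth S) {..<length S}"
proof (cases "set S \<subseteq> X")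
  case True
  then have S: "set S \<subseteq> carrier G" using assms by blast
  have "zero_sum G S \<longleftrightarrow> sum (nth S) {..<length S} \<in> Z"
    using zero_sum_nths[OF S, of "{..<length S}"] by simp
  moreover have "irreducible_factorization G S P \<longleftrightarrow> partition_on {..<length S} P \<and> (\<forall>B\<in>P. minz Z (nth S) B)" for P
  proof -
    have "minimal_zero_sum G (nths S B) \<longleftrightarrow> minz Z (nth S) B"
      if "partition_on {..<length S} P" "B \<in> P" for B
      using that by (intro minimal_zero_sum_nths[OF S]) (auto simp: partition_on_def)
    then show ?thesis unfolding irreducible_factorization_def by blast
  qed
  ultimately show ?thesis
    using True UF_iff_unique_partition[OF sgZ, of "{..<length S}" "nth S"] by (simp add: UFIM_def)
qed (auto simp: UFIM_def)

lemma cross_number_eq: "set S \<subseteq> carrier G \<Longrightarrow> cross_number G S = (\<Sum>i<length S. wz Z (S ! i))"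
proof -
  assume S: "set S \<subseteq> carrier G"
  have "cross_number G S = (\<Sum>i<length S. 1 / real (ord (S ! i)))"
    by (simp add: cross_number_def sum_list_sum_nth atLeast0LessThan)
  also have "\<dots> = (\<Sum>i<length S. wz Z (S ! i))"
    using S ord_eq by (intro sum.cong) (auto simp: wz_def subset_iff)
  finally show ?thesis .
qed

lemma carrier_Z: "x \<in> carrier G \<Longrightarrow> x \<in> Z \<longleftrightarrow> x = \<one>\<^bsub>G\<^esub>"
  by (simp add: Zdef id)

lemma wz_pi: "wz Z (\<pi> x) = wz Z x"
proof -
  have "nmul n (\<pi> x) \<in> Z \<longleftrightarrow> nmul n x \<in> Z" for n
  proof -
    have "nmul n (\<pi> x) - nmul n x \<in> Z" using sg_nmul[OF sgZ pi_diff] by (simp add: nmul_diff)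
    moreover have "nmul n (\<pi> x) = (nmul n (\<pi> x) - nmul n x) + nmul n x" by simp
    ultimately show ?thesis using sg_add_iff1[OF sgZ] by metis
  qed
  then show ?thesis by (simp add: wz_def oz_def)
qed

text \<open>\<open>K1\<close> is a \<open>Max\<close>, so finiteness has to be known first. The
  length bound with index the group order leaves finitely many lists.\<close>

lemma UFIM_bounded: "finite {S. UFIM G (carrier G - {\<one>\<^bsub>G\<^esub>}) S}"
proof -
  obtain f :: "'a \<Rightarrow> nat" where f: "inj_on f (carrier G)" "f ` carrier G = {0..<card (carrier G)}"
    using ex_bij_betw_finite_nat[OF fin] by (auto simp: bij_betw_def)
  have "idx Z UNIV (card (carrier G))"
    unfolding idx_def
  proof (intro exI[of _ "f \<circ> \<pi>"] conjI ballI impI)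
    fix x show "(f \<circ> \<pi>) x < card (carrier G)" using f(2) closed[of x] by auto
  next
    fix x y assume "(f \<circ> \<pi>) x = (f \<circ> \<pi>) y"
    then have "\<pi> x = \<pi> y" using f(1) closed by (auto dest: inj_onD)
    moreover have "x - y = (\<pi> y - y) - (\<pi> x - x) + (\<pi> x - \<pi> y)" by simp
    ultimately show "x - y \<in> Z" using sg_diff[OF sgZ pi_diff pi_diff] by (metis diff_self add.right_neutral)
  qed
  then have b: "bnd Z UNIV (\<lambda>_. 1) (real (card (carrier G)))"
    by (intro bnd_length_idx[OF sgZ]) (auto simp: sg_def)
  have "length S \<le> card (carrier G)" if "UFIM G (carrier G - {\<one>\<^bsub>G\<^esub>}) S" for S
  proof -
    have S: "set S \<subseteq> carrier G - {\<one>\<^bsub>G\<^esub>}" "UF Z (nth S) {..<length S}" using that UFIM_iff by auto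
    have "nth S ` {..<length S} \<subseteq> UNIV - Z"
    proof
      fix x assume "x \<in> nth S ` {..<length S}"
      then have "x \<in> set S" by auto
      then show "x \<in> UNIV - Z" using S(1) carrier_Z by blast
    qed
    then show ?thesis using bnd_card[OF b S(2)] by simp
  qed
  then have "{S. UFIM G (carrier G - {\<one>\<^bsub>G\<^esub>}) S} \<subseteq> {S. set S \<subseteq> carrier G \<and> length S \<le> card (carrier G)}"
    by (auto simp: UFIM_def)
  then show ?thesis using finite_lists_length_le[OF fin] finite_subset by blast
qed

lemma K1_eqI:
  assumes att: "att Z UNIV \<kappa>"
    and ub: "\<And>(I::nat set) g. UF Z g I \<Longrightarrow> g ` I \<inter> Z = {} \<Longrightarrow> (\<Sum>i\<in>I. wz Z (g i)) \<le> \<kappa>"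
  shows "K1 G = \<kappa>"
  unfolding K1_def
proof (rule Max_eqI)
  let ?X = "carrier G - {\<one>\<^bsub>G\<^esub>}"
  show "finite {cross_number G S |S. UFIM G ?X S}"
    using UFIM_bounded by (simp add: setcompr_eq_image)
  show "y \<le> \<kappa>" if y: "y \<in> {cross_number G S |S. UFIM G ?X S}" for y
  proof -
    obtain S where S: "y = cross_number G S" "UFIM G ?X S" using y by blast
    have S': "set S \<subseteq> ?X" "UF Z (nth S) {..<length S}" using S(2) UFIM_iff by auto
    have "nth S ` {..<length S} \<inter> Z = {}"
    proof -
      have "x \<notin> Z" if "x \<in> set S" for x using that S'(1) carrier_Z by blast
      then show ?thesis by auto
    qed
    moreover have "set S \<subseteq> carrier G" using S'(1) by auto
    ultimately show ?thesis using ub[OF S'(2)] S(1) cross_number_eq[of S] by simp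
  qed
  obtain I :: "nat set" and g where g: "UF Z g I" "g ` I \<subseteq> UNIV - Z" "(\<Sum>i\<in>I. wz Z (g i)) = \<kappa>"
    using att unfolding att_def by blast
  have finI: "finite I" using g ucl_finite by (auto simp: UF_def)
  then obtain f where f: "bij_betw f {..<card I} I"
    using ex_bij_betw_nat_finite[of I] by (auto simp: atLeast0LessThan)
  then have inj: "inj_on f {..<card I}" and im: "f ` {..<card I} = I" by (auto simp: bij_betw_def)
  \<comment> \<open>The extremal family lives in the ambient group; its reductions form a list over
    the carrier with the same zero sums and orders.\<close>
  define S where "S = map (\<pi> \<circ> g \<circ> f) [0..<card I]"
  have len: "length S = card I" by (simp add: S_def)
  have nth: "S ! i = \<pi> (g (f i))" if "i < card I" for i using that by (simp add: S_def)
  have "UF Z (g \<circ> f) {..<card I}" using UF_reindex[OF inj, of Z g] im g(1) by simp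
  then have "UF Z (nth S) {..<length S}"
    unfolding len
  proof (rule UF_cong_mod[OF sgZ, rotated])
    fix i assume "i \<in> {..<card I}"
    then have "S ! i - (g \<circ> f) i \<in> Z" using nth pi_diff by simp
    then show "(g \<circ> f) i - S ! i \<in> Z" using sg_diff_commute[OF sgZ] by blast
  qed
  moreover have S: "set S \<subseteq> ?X"
  proof
    fix x assume "x \<in> set S"
    then obtain i where i: "i < card I" "x = \<pi> (g (f i))" by (auto simp: S_def)
    then have "f i \<in> I" using im by auto
    then have "g (f i) \<notin> Z" using g(2) by auto
    then show "x \<in> ?X" using i closed by (simp add: Zdef)
  qed
  ultimately have "UFIM G ?X S" using UFIM_iff[of ?X S] by simp
  moreover have "cross_number G S = \<kappa>"
  proof -
    have "cross_number G S = (\<Sum>i<card I. wz Z (S ! i))" using cross_number_eq[of S] S len by auto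
    also have "\<dots> = (\<Sum>i<card I. wz Z (g (f i)))" by (intro sum.cong) (auto simp: nth wz_pi)
    also have "\<dots> = (\<Sum>i\<in>I. wz Z (g i))" using sum.reindex[OF inj, of "\<lambda>i. wz Z (g i)"] im by simp
    finally show ?thesis using g(3) by simp
  qed
  ultimately show "\<kappa> \<in> {cross_number G S |S. UFIM G ?X S}" by blast
qed

lemma UFIM_nths:
  assumes S: "UFIM G (carrier G - {\<one>\<^bsub>G\<^esub>}) S" and I: "I \<subseteq> {..<length S}" "sum (nth S) I \<in> Z"
    and X: "X \<subseteq> carrier G" "\<And>i. i \<in> I \<Longrightarrow> S ! i \<in> X"
  shows "UFIM G X (nths S I)"
proof -
  have "UF Z (nth S) {..<length S}" using S UFIM_iff[of "carrier G - {\<one>\<^bsub>G\<^esub>}"] by auto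
  then have "UF Z (nth S) I" using I by (rule UF_subset)
  then have "UF Z (nth (nths S I)) {..<length (nths S I)}" using UF_nths[OF sgZ I(1)] by simp
  moreover have "set (nths S I) \<subseteq> X" using X(2) by (auto simp: set_nths)
  ultimately show ?thesis using UFIM_iff[OF X(1)] by simp
qed

end

section \<open>Primary decompositions\<close>

definition pval :: "(nat \<times> nat) list \<Rightarrow> real" where
  "pval ps = (\<Sum>(p, e)\<leftarrow>ps. (real p ^ e - 1) / (real p ^ e - real p ^ (e - 1)))"

lemma pval_Nil [simp]: "pval [] = 0"
  by (simp add: pval_def)

lemma pval_append: "pval (ps @ qs) = pval ps + pval qs"
  by (simp add: pval_def)

lemma geometric_pval:
  assumes "2 \<le> p" "1 \<le> e"
  shows "(real p ^ e - 1) / (real p ^ e - real p ^ (e - 1)) = (\<Sum>k<e. 1 / real p ^ k)"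
proof -
  obtain d where d: "e = Suc d" using assms(2) by (cases e) auto
  have p: "real p \<noteq> 0" "real p \<noteq> 1" "real p - 1 \<noteq> 0" using assms(1) by linarith+
  have "(\<Sum>k<e. 1 / real p ^ k) = (\<Sum>k<e. (1 / real p) ^ k)" by (simp add: power_one_over)
  also have "\<dots> = ((1 / real p) ^ e - 1) / (1 / real p - 1)"
    using p by (intro geometric_sum) (simp add: field_simps)
  also have "\<dots> = (real p ^ e - 1) / (real p ^ d * (real p - 1))"
    unfolding d using p by (simp add: divide_simps) (simp add: algebra_simps)
  also have "real p ^ d * (real p - 1) = real p ^ e - real p ^ (e - 1)" unfolding d by (simp add: algebra_simps)
  finally show ?thesis by simp
qed

lemma pval_prime_power: "prime p \<Longrightarrow> 1 \<le> e \<Longrightarrow> pval [(p, e)] = (\<Sum>k<e. 1 / real p ^ k)"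
  using geometric_pval[of p e] prime_ge_2_nat[of p] by (simp add: pval_def)

text \<open>\<open>expo ps p k\<close> is the exponent of \<open>p\<close> in the number of elements killed by \<open>p ^ k\<close>.\<close>

definition expo :: "(nat \<times> nat) list \<Rightarrow> nat \<Rightarrow> nat \<Rightarrow> nat" where
  "expo ps p k = (\<Sum>(p', e)\<leftarrow>ps. if p' = p then min k e else 0)"

lemma prod_gcd_eq_expo:
  assumes "prime p" "\<forall>(p', e)\<in>set ps. prime p'"
  shows "(\<Prod>(p', e)\<leftarrow>ps. gcd (p ^ k) (p' ^ e)) = p ^ expo ps p k"
  using assms(2)
proof (induction ps)
  case (Cons x ps)
  obtain p' e where x: "x = (p', e)" by (cases x)
  have "gcd (p ^ k) (p' ^ e) = p ^ (if p' = p then min k e else 0)"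
  proof (cases "p' = p")
    case True
    then show ?thesis
      by (cases "k \<le> e") (auto simp: min_def le_imp_power_dvd gcd_proj1_iff gcd_proj2_iff)
  next
    case False
    then have "coprime (p ^ k) (p' ^ e)" using Cons.prems x assms(1) primes_coprime[of p p'] by simp
    then show ?thesis using False by simp
  qed
  then show ?case using Cons x by (simp add: expo_def power_add)
qed (simp add: expo_def)

text \<open>The increment of \<open>expo ps p\<close> from \<open>k\<close> to \<open>Suc k\<close>
  counts the entries with prime \<open>p\<close> and exponent above \<open>k\<close>, and each of
  these contributes 1/p^k.\<close>

lemma pval_eq_expo:
  assumes "finite A" "\<forall>(p, e)\<in>set ps. prime p \<and> 1 \<le> e \<and> p \<in> A \<and> e \<le> N"
  shows "pval ps = (\<Sum>p\<in>A. \<Sum>k<N. (real (expo ps p (Suc k)) - real (expo ps p k)) / real p ^ k)"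
  using assms(2)
proof (induction ps)
  case (Cons x ps)
  obtain q e where x: "x = (q, e)" by (cases x)
  have q: "prime q" "1 \<le> e" "q \<in> A" "e \<le> N" using Cons.prems x by auto
  let ?m = "\<lambda>p k. real (if q = p then min k e else 0)"
  have "(\<Sum>p\<in>A. \<Sum>k<N. (?m p (Suc k) - ?m p k) / real p ^ k) =
    (\<Sum>p\<in>A. if q = p then \<Sum>k<N. (real (min (Suc k) e) - real (min k e)) / real p ^ k else 0)"
    by (intro sum.cong refl) auto
  also have "\<dots> = (\<Sum>k<N. (real (min (Suc k) e) - real (min k e)) / real q ^ k)"
    using assms(1) q(3) by simp
  also have "\<dots> = (\<Sum>k<e. (real (min (Suc k) e) - real (min k e)) / real q ^ k)"
    using q(4) by (intro sum.mono_neutral_right) auto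
  also have "\<dots> = (\<Sum>k<e. 1 / real q ^ k)" by (intro sum.cong refl) auto
  also have "\<dots> = pval [x]" using pval_prime_power[OF q(1,2)] x by simp
  finally have 1: "pval [x] = (\<Sum>p\<in>A. \<Sum>k<N. (?m p (Suc k) - ?m p k) / real p ^ k)" by simp
  have "pval (x # ps) = pval [x] + pval ps" using pval_append[of "[x]" ps] by simp
  also have "\<dots> = (\<Sum>p\<in>A. \<Sum>k<N. (?m p (Suc k) - ?m p k) / real p ^ k +
      (real (expo ps p (Suc k)) - real (expo ps p k)) / real p ^ k)"
    using Cons 1 by (simp add: sum.distrib)
  also have "\<dots> = (\<Sum>p\<in>A. \<Sum>k<N. (real (expo (x # ps) p (Suc k)) - real (expo (x # ps) p k)) / real p ^ k)"
    unfolding add_divide_distrib[symmetric] x expo_def by (intro sum.cong refl) (auto simp: algebra_simps)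
  finally show ?case .
qed (simp add: expo_def)

text \<open>The solutions are the multiples of \<open>N\<close> divided by
  \<open>gcd n N\<close>.\<close>

lemma card_multiples:
  assumes "0 < (N::nat)"
  shows "card {y \<in> {0..<int N}. int N dvd int n * y} = gcd n N"
proof -
  define d where "d = gcd n N"
  have d0: "0 < d" using assms by (simp add: d_def)
  obtain M where M: "N = d * M" using d_def by (metis dvdE gcd_dvd2)
  obtain n' where n': "n = d * n'" using d_def by (metis dvdE gcd_dvd1)
  have M0: "0 < M" using assms M by auto
  have "gcd (d * n') (d * M) = d" using n' M by (metis d_def)
  then have "d * gcd n' M = d" using gcd_mult_distrib_nat by simp
  then have cop: "coprime (int M) (int n')" using d0 by (simp add: coprime_iff_gcd_eq_1 gcd.commute)
  have "int N dvd int n * y \<longleftrightarrow> int M dvd y" for y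
  proof -
    have "int N dvd int n * y \<longleftrightarrow> int d * int M dvd int d * (int n' * y)" by (simp add: M n' mult.assoc)
    also have "\<dots> \<longleftrightarrow> int M dvd y" using d0 cop by (simp add: coprime_dvd_mult_right_iff)
    finally show ?thesis .
  qed
  then have "{y \<in> {0..<int N}. int N dvd int n * y} = (\<lambda>j. int j * int M) ` {..<d}"
  proof (intro equalityI subsetI)
    fix y assume "y \<in> {y \<in> {0..<int N}. int N dvd int n * y}"
    then have y: "0 \<le> y" "y < int N" "int M dvd y" using \<open>\<And>y. int N dvd int n * y \<longleftrightarrow> int M dvd y\<close> by auto
    then obtain j where j: "y = int M * j" by auto
    have "0 \<le> j" using y(1) j M0 by (simp add: zero_le_mult_iff)
    moreover have "int M * j < int M * int d" using y(2) j M by (simp add: mult.commute)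
    then have "j < int d" using M0 by simp
    ultimately have "y = int (nat j) * int M" "nat j < d" using j by auto
    then show "y \<in> (\<lambda>j. int j * int M) ` {..<d}" by blast
  next
    fix y assume "y \<in> (\<lambda>j. int j * int M) ` {..<d}"
    then obtain j where j: "j < d" "y = int j * int M" by auto
    have "int j * int M < int d * int M" using j M0 by (intro mult_strict_right_mono) auto
    then show "y \<in> {y \<in> {0..<int N}. int N dvd int n * y}"
      using \<open>\<And>y. int N dvd int n * y \<longleftrightarrow> int M dvd y\<close> j M by simp
  qed
  moreover have "inj_on (\<lambda>j. int j * int M) {..<d}" using M0 by (auto intro: inj_onI)
  ultimately show ?thesis by (simp add: card_image d_def)
qed

section \<open>Counting torsion elements to compare decompositions\<close>

definition pgroup :: "(nat \<times> nat) list \<Rightarrow> (nat \<Rightarrow> int) monoid" where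
  "pgroup ps = product_group {..<length ps} (\<lambda>i. integer_mod_group (fst (ps ! i) ^ snd (ps ! i)))"

lemma group_pgroup: "group (pgroup ps)"
  by (simp add: pgroup_def)

lemma card_torsion_pgroup:
  assumes ps: "\<forall>(p, e)\<in>set ps. prime p"
  shows "card {x \<in> carrier (pgroup ps). x [^]\<^bsub>pgroup ps\<^esub> (n::nat) = \<one>\<^bsub>pgroup ps\<^esub>} =
    (\<Prod>(p, e)\<leftarrow>ps. gcd n (p ^ e))"
proof -
  let ?I = "{..<length ps}" and ?N = "\<lambda>i. fst (ps ! i) ^ snd (ps ! i)"
  let ?G = "\<lambda>i. integer_mod_group (?N i)"
  have N0: "0 < ?N i" if "i \<in> ?I" for i
  proof -
    have "ps ! i \<in> set ps" using that by simp
    then have "prime (fst (ps ! i))" using ps by (auto simp: case_prod_beta)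
    then show ?thesis by (simp add: prime_gt_0_nat)
  qed
  have C: "carrier (?G i) = {0..<int (?N i)}" if "i \<in> ?I" for i
    unfolding carrier_integer_mod_group using N0[OF that] by (intro if_not_P) linarith
  have pow: "x [^]\<^bsub>pgroup ps\<^esub> n = (\<lambda>i\<in>?I. (int n * x i) mod int (?N i))" if x: "x \<in> carrier (pgroup ps)" for x
  proof -
    have "x [^]\<^bsub>pgroup ps\<^esub> n = (\<lambda>i\<in>?I. x i [^]\<^bsub>?G i\<^esub> n)"
      unfolding pgroup_def by (induction n) (auto intro!: ext)
    then show ?thesis by simp
  qed
  have "{x \<in> carrier (pgroup ps). x [^]\<^bsub>pgroup ps\<^esub> n = \<one>\<^bsub>pgroup ps\<^esub>} =
    (\<Pi>\<^sub>E i\<in>?I. {y \<in> {0..<int (?N i)}. int (?N i) dvd int n * y})"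
  proof (intro equalityI subsetI)
    fix x assume "x \<in> {x \<in> carrier (pgroup ps). x [^]\<^bsub>pgroup ps\<^esub> n = \<one>\<^bsub>pgroup ps\<^esub>}"
    then have x: "x \<in> carrier (pgroup ps)" "(\<lambda>i\<in>?I. (int n * x i) mod int (?N i)) = (\<lambda>i\<in>?I. 0)"
      using pow by (auto simp: pgroup_def)
    have "int (?N i) dvd int n * x i" if "i \<in> ?I" for i
      using fun_cong[OF x(2), of i] that by (simp add: dvd_eq_mod_eq_0)
    moreover have "x i \<in> {0..<int (?N i)}" if "i \<in> ?I" for i
      using x(1) that unfolding C[OF that, symmetric] by (simp add: pgroup_def PiE_iff)
    ultimately show "x \<in> (\<Pi>\<^sub>E i\<in>?I. {y \<in> {0..<int (?N i)}. int (?N i) dvd int n * y})"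
      using x(1) by (auto simp: pgroup_def PiE_iff)
  next
    fix x assume x: "x \<in> (\<Pi>\<^sub>E i\<in>?I. {y \<in> {0..<int (?N i)}. int (?N i) dvd int n * y})"
    then have "x \<in> carrier (pgroup ps)"
      using C by (auto simp: pgroup_def PiE_iff)
    moreover have "(\<lambda>i\<in>?I. (int n * x i) mod int (?N i)) = (\<lambda>i\<in>?I. 0)"
      using x by (auto simp: PiE_iff intro!: restrict_ext)
    ultimately show "x \<in> {x \<in> carrier (pgroup ps). x [^]\<^bsub>pgroup ps\<^esub> n = \<one>\<^bsub>pgroup ps\<^esub>}"
      using pow by (simp add: pgroup_def)
  qed
  then have "card {x \<in> carrier (pgroup ps). x [^]\<^bsub>pgroup ps\<^esub> n = \<one>\<^bsub>pgroup ps\<^esub>} =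
    (\<Prod>i\<in>?I. card {y \<in> {0..<int (?N i)}. int (?N i) dvd int n * y})"
    by (simp add: card_PiE)
  also have "\<dots> = (\<Prod>i\<in>?I. gcd n (?N i))" by (intro prod.cong refl card_multiples N0)
  also have "\<dots> = (\<Prod>(p, e)\<leftarrow>ps. gcd n (p ^ e))"
    by (simp add: prod.list_conv_set_nth atLeast0LessThan case_prod_beta)
  finally show ?thesis .
qed

lemma iso_card_torsion:
  assumes "group G" "group H" "G \<cong> H"
  shows "card {x \<in> carrier G. x [^]\<^bsub>G\<^esub> (n::nat) = \<one>\<^bsub>G\<^esub>} = card {x \<in> carrier H. x [^]\<^bsub>H\<^esub> n = \<one>\<^bsub>H\<^esub>}"
proof -
  obtain h where h: "h \<in> iso G H" using assms(3) by (auto simp: is_iso_def)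
  interpret group_hom G H h
    using assms(1,2) h by (simp add: group_hom_def group_hom_axioms_def iso_def)
  have bij: "inj_on h (carrier G)" "h ` carrier G = carrier H" using h by (auto simp: iso_def bij_betw_def)
  have eq: "h x [^]\<^bsub>H\<^esub> n = \<one>\<^bsub>H\<^esub> \<longleftrightarrow> x [^]\<^bsub>G\<^esub> n = \<one>\<^bsub>G\<^esub>" if "x \<in> carrier G" for x
  proof -
    have "h x [^]\<^bsub>H\<^esub> n = h (x [^]\<^bsub>G\<^esub> n)" using that by (simp add: hom_nat_pow)
    then show ?thesis
      using inj_on_eq_iff[OF bij(1), of "x [^]\<^bsub>G\<^esub> n" "\<one>\<^bsub>G\<^esub>"] that by simp
  qed
  have "{x \<in> carrier H. x [^]\<^bsub>H\<^esub> n = \<one>\<^bsub>H\<^esub>} = h ` {x \<in> carrier G. x [^]\<^bsub>G\<^esub> n = \<one>\<^bsub>G\<^esub>}"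
    using eq by (auto simp: bij(2)[symmetric])
  moreover have "inj_on h {x \<in> carrier G. x [^]\<^bsub>G\<^esub> n = \<one>\<^bsub>G\<^esub>}" using bij(1) by (rule inj_on_subset) auto
  ultimately show ?thesis by (simp add: card_image)
qed

text \<open>\<open>K1_star\<close> is a \<open>THE\<close>, so only its value must be independent of
  the decomposition. The number of elements killed by p^k is invariant under isomorphism and
  determines \<open>expo\<close>, which determines the value.\<close>

lemma pval_unique:
  assumes G: "group G" and P: "primary_decomposition G ps" "primary_decomposition G qs"
  shows "pval ps = pval qs"
proof -
  have pr: "\<forall>(p, e)\<in>set ps. prime p" "\<forall>(p, e)\<in>set qs. prime p"
    using P by (auto simp: primary_decomposition_def)
  have iso: "G \<cong> pgroup ps" "G \<cong> pgroup qs"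
    using P by (simp_all add: primary_decomposition_def pgroup_def)
  have "(\<Prod>(p, e)\<leftarrow>ps. gcd n (p ^ e)) = (\<Prod>(p, e)\<leftarrow>qs. gcd n (p ^ e))" for n
    using iso_card_torsion[OF G group_pgroup iso(1), of n] iso_card_torsion[OF G group_pgroup iso(2), of n]
      card_torsion_pgroup[OF pr(1), of n] card_torsion_pgroup[OF pr(2), of n] by simp
  then have pe: "p ^ expo ps p k = p ^ expo qs p k" if "prime p" for p k
    using prod_gcd_eq_expo[OF that pr(1), of k] prod_gcd_eq_expo[OF that pr(2), of k] by simp
  have ex: "expo ps p k = expo qs p k" if "prime p" for p k
    using pe[OF that, of k] that prime_ge_2_nat[OF that] by simp
  define A where "A = fst ` set ps \<union> fst ` set qs"
  define N where "N = sum_list (map snd ps) + sum_list (map snd qs)"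
  have fin: "finite A" by (simp add: A_def)
  have prA: "prime p" if "p \<in> A" for p using that pr by (auto simp: A_def)
  have le: "e \<le> N" if "(p, e) \<in> set ps \<or> (p, e) \<in> set qs" for p e
  proof -
    have "e \<in> set (map snd ps) \<or> e \<in> set (map snd qs)" using that by force
    then have "e \<le> sum_list (map snd ps) \<or> e \<le> sum_list (map snd qs)"
      using member_le_sum_list by blast
    then show ?thesis unfolding N_def by linarith
  qed
  have "\<forall>x\<in>set ps. prime (fst x) \<and> 1 \<le> snd x" "\<forall>x\<in>set qs. prime (fst x) \<and> 1 \<le> snd x"
    using P by (simp_all add: primary_decomposition_def case_prod_beta)
  moreover have "fst x \<in> A \<and> snd x \<le> N" if "x \<in> set ps \<or> x \<in> set qs" for x
    using that le[of "fst x" "snd x"] by (auto simp: A_def)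
  ultimately have "\<forall>(p, e)\<in>set ps. prime p \<and> 1 \<le> e \<and> p \<in> A \<and> e \<le> N"
      "\<forall>(p, e)\<in>set qs. prime p \<and> 1 \<le> e \<and> p \<in> A \<and> e \<le> N"
    by (simp_all add: case_prod_beta)
  then show ?thesis
    using pval_eq_expo[OF fin, of ps N] pval_eq_expo[OF fin, of qs N] ex prA by simp
qed

lemma K1_star_eq: "group G \<Longrightarrow> primary_decomposition G ps \<Longrightarrow> K1_star G = pval ps"
  unfolding K1_star_def pval_def[symmetric] by (rule the_equality) (use pval_unique in blast)+

section \<open>Decompositions of products of cyclic groups\<close>

lemma primary_decomposition_Cyc:
  assumes "prime p" "1 \<le> e" shows "primary_decomposition (Cyc (p ^ e)) [(p, e)]"
proof -
  let ?C = "Cyc (p ^ e)" and ?h = "\<lambda>x. \<lambda>i\<in>{..<Suc 0}. x"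
  have "?h \<in> iso ?C (pgroup [(p, e)])"
  proof (rule isoI)
    show "?h \<in> hom ?C (pgroup [(p, e)])"
      by (rule homI) (auto simp: pgroup_def fun_eq_iff)
    show "bij_betw ?h (carrier ?C) (carrier (pgroup [(p, e)]))"
      by (rule bij_betwI[of _ _ _ "\<lambda>f. f 0"]) (auto simp: pgroup_def PiE_iff extensional_def fun_eq_iff)
  qed
  then have "?C \<cong> pgroup [(p, e)]" by (rule is_isoI)
  then show ?thesis using assms by (simp add: primary_decomposition_def pgroup_def)
qed

lemma iso_pgroup_append:
  "pgroup ps \<times>\<times> pgroup qs \<cong> pgroup (ps @ qs)"
proof -
  let ?n = "length ps" and ?m = "length qs"
  let ?h = "\<lambda>(x, y). \<lambda>i\<in>{..<?n + ?m}. if i < ?n then x i else y (i - ?n)"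
  let ?k = "\<lambda>z. (\<lambda>i\<in>{..<?n}. z i, \<lambda>i\<in>{..<?m}. z (?n + i))"
  have "?h \<in> iso (pgroup ps \<times>\<times> pgroup qs) (pgroup (ps @ qs))"
  proof (rule isoI)
    show hom: "?h \<in> hom (pgroup ps \<times>\<times> pgroup qs) (pgroup (ps @ qs))"
    proof (rule homI)
      fix a assume "a \<in> carrier (pgroup ps \<times>\<times> pgroup qs)"
      then obtain x y where a: "a = (x, y)" "x \<in> carrier (pgroup ps)" "y \<in> carrier (pgroup qs)" by auto
      have "i - ?n < ?m" if "i < ?n + ?m" "\<not> i < ?n" for i using that by linarith
      then show "?h a \<in> carrier (pgroup (ps @ qs))"
        using a by (simp add: pgroup_def PiE_iff nth_append)
    next
      fix a b
      assume "a \<in> carrier (pgroup ps \<times>\<times> pgroup qs)" "b \<in> carrier (pgroup ps \<times>\<times> pgroup qs)"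
      obtain x y x' y' where ab: "a = (x, y)" "b = (x', y')" by (metis surj_pair)
      have "i - ?n < ?m" if "i < ?n + ?m" "\<not> i < ?n" for i using that by linarith
      then show "?h (a \<otimes>\<^bsub>pgroup ps \<times>\<times> pgroup qs\<^esub> b) = ?h a \<otimes>\<^bsub>pgroup (ps @ qs)\<^esub> ?h b"
        unfolding ab pgroup_def by (intro ext) (simp add: nth_append)
    qed
    show "bij_betw ?h (carrier (pgroup ps \<times>\<times> pgroup qs)) (carrier (pgroup (ps @ qs)))"
    proof (rule bij_betwI[of _ _ _ ?k])
      show "?h \<in> carrier (pgroup ps \<times>\<times> pgroup qs) \<rightarrow> carrier (pgroup (ps @ qs))"
        using hom by (auto simp: hom_def)
      show "?k \<in> carrier (pgroup (ps @ qs)) \<rightarrow> carrier (pgroup ps \<times>\<times> pgroup qs)"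
      proof
        fix z assume z: "z \<in> carrier (pgroup (ps @ qs))"
        have "z i \<in> carrier (integer_mod_group (fst ((ps @ qs) ! i) ^ snd ((ps @ qs) ! i)))"
          if "i < ?n + ?m" for i
          using z that by (simp add: pgroup_def PiE_iff)
        note zi = this
        have "z i \<in> carrier (integer_mod_group (fst (ps ! i) ^ snd (ps ! i)))" if "i < ?n" for i
          using zi[of i] that by (simp add: nth_append)
        moreover have "z (?n + i) \<in> carrier (integer_mod_group (fst (qs ! i) ^ snd (qs ! i)))" if "i < ?m" for i
          using zi[of "?n + i"] that by (simp add: nth_append)
        ultimately show "?k z \<in> carrier (pgroup ps \<times>\<times> pgroup qs)"
          by (auto simp: pgroup_def)
      qed
    next
      fix a assume "a \<in> carrier (pgroup ps \<times>\<times> pgroup qs)"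
      then obtain x y where a: "a = (x, y)" "x \<in> extensional {..<?n}" "y \<in> extensional {..<?m}"
        by (auto simp: pgroup_def PiE_def)
      have "(\<lambda>i\<in>{..<?n}. ?h (x, y) i) = x"
        by (rule extensionalityI[of _ "{..<?n}"]) (use a in auto)
      moreover have "(\<lambda>i\<in>{..<?m}. ?h (x, y) (?n + i)) = y"
        by (rule extensionalityI[of _ "{..<?m}"]) (use a in auto)
      ultimately show "?k (?h a) = a" unfolding a(1) by simp
    next
      fix z assume "z \<in> carrier (pgroup (ps @ qs))"
      then have "z \<in> extensional {..<?n + ?m}" by (auto simp: pgroup_def PiE_def)
      then show "?h (?k z) = z"
        by (intro extensionalityI[of _ "{..<?n + ?m}"]) auto
    qed
  qed
  then show ?thesis by (rule is_isoI)
qed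

lemma primary_decomposition_iso:
  "G \<cong> H \<Longrightarrow> primary_decomposition H ps \<Longrightarrow> primary_decomposition G ps"
  unfolding primary_decomposition_def using iso_trans by blast

lemma primary_decomposition_DirProd:
  assumes "group A" "primary_decomposition A ps" "primary_decomposition B qs"
  shows "primary_decomposition (A \<times>\<times> B) (ps @ qs)"
proof -
  have "A \<cong> pgroup ps" "B \<cong> pgroup qs" using assms by (simp_all add: primary_decomposition_def pgroup_def)
  then have "A \<times>\<times> B \<cong> pgroup ps \<times>\<times> pgroup qs" by (rule group.DirProd_iso_trans[OF assms(1)])
  then have "A \<times>\<times> B \<cong> pgroup (ps @ qs)" using iso_pgroup_append iso_trans by blast
  then show ?thesis using assms by (auto simp: primary_decomposition_def pgroup_def)
qed

lemma Cyc_mult_iso: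
  assumes "coprime m n" "0 < m" "0 < n"
  shows "Cyc (m * n) \<cong> Cyc m \<times>\<times> Cyc n"
proof -
  let ?h = "\<lambda>x::int. (x mod int m, x mod int n)"
  have "?h \<in> iso (Cyc (m * n)) (Cyc m \<times>\<times> Cyc n)"
  proof (rule isoI)
    show "?h \<in> hom (Cyc (m * n)) (Cyc m \<times>\<times> Cyc n)"
      using assms by (intro homI) (auto simp: carrier_integer_mod_group mod_mod_cancel mod_simps)
    have inj: "inj_on ?h (carrier (Cyc (m * n)))"
    proof (rule inj_onI)
      fix x y assume xy: "x \<in> carrier (Cyc (m * n))" "y \<in> carrier (Cyc (m * n))" "?h x = ?h y"
      then have "int m dvd x - y" "int n dvd x - y" by (auto simp: mod_eq_dvd_iff)
      then have "int m * int n dvd x - y" using assms(1) by (intro divides_mult) auto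
      then have "x mod int (m * n) = y mod int (m * n)" by (simp add: mod_eq_dvd_iff)
      then show "x = y" using xy assms by (simp add: carrier_integer_mod_group)
    qed
    have "?h ` carrier (Cyc (m * n)) = carrier (Cyc m \<times>\<times> Cyc n)"
    proof (rule card_subset_eq)
      show "finite (carrier (Cyc m \<times>\<times> Cyc n))" using assms by (simp add: carrier_integer_mod_group)
      show "?h ` carrier (Cyc (m * n)) \<subseteq> carrier (Cyc m \<times>\<times> Cyc n)"
        using assms by (auto simp: carrier_integer_mod_group)
      show "card (?h ` carrier (Cyc (m * n))) = card (carrier (Cyc m \<times>\<times> Cyc n))"
        unfolding card_image[OF inj] using assms
        by (simp add: carrier_integer_mod_group card_cartesian_product nat_mult_distrib)
    qed
    then show "bij_betw ?h (carrier (Cyc (m * n))) (carrier (Cyc m \<times>\<times> Cyc n))"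
      using inj by (simp add: bij_betw_def)
  qed
  then show ?thesis by (rule is_isoI)
qed

lemma primary_decomposition_Cyc_mult:
  assumes "coprime m n" "0 < m" "0 < n"
    and "primary_decomposition (Cyc m) ps" "primary_decomposition (Cyc n) qs"
  shows "primary_decomposition (Cyc (m * n)) (ps @ qs)"
  using primary_decomposition_iso[OF Cyc_mult_iso[OF assms(1-3)]]
    primary_decomposition_DirProd[OF _ assms(4,5)] by simp

section \<open>The groups of the theorem\<close>

lemma rep_Cyc: "0 < n \<Longrightarrow> rep (Cyc n) (\<lambda>x. x mod int n)"
  unfolding rep_def by (auto simp: carrier_integer_mod_group mod_simps)

lemma rep_DirProd:
  assumes "rep A \<pi>" "rep B \<pi>'"
  shows "rep (A \<times>\<times> B) (map_prod \<pi> \<pi>')"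
proof -
  interpret A: comm_group A using assms by (simp add: rep_def)
  interpret B: comm_group B using assms by (simp add: rep_def)
  have "comm_group (A \<times>\<times> B)"
    by (rule group.group_comm_groupI[OF DirProd_group[OF A.is_group B.is_group]])
      (auto simp: A.m_comm B.m_comm)
  then show ?thesis using assms unfolding rep_def by (auto simp: map_prod_def)
qed

lemma K1_coords:
  assumes co: "coords \<rho> \<alpha> \<beta> \<gamma> r P Q1 Q2" and rep: "rep G \<pi>"
    and ker: "\<And>x. \<pi> x = \<one>\<^bsub>G\<^esub> \<longleftrightarrow> int r dvd \<rho> x \<and> int P dvd \<alpha> x \<and> int Q1 dvd \<beta> x \<and> int Q2 dvd \<gamma> x"
    and ext: "coords.extremal \<rho> \<alpha> \<beta> \<gamma> r P Q1 Q2 \<kappa> e"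
  shows "K1 G = \<kappa>"
proof -
  interpret coords \<rho> \<alpha> \<beta> \<gamma> r P Q1 Q2 by (rule co)
  interpret pr: presented G \<pi> Z
    by (unfold_locales) (use rep ker in \<open>auto simp: Z_def\<close>)
  show ?thesis using ext unfolding extremal_def by (intro pr.K1_eqI) auto
qed

lemma fst_nmul: "fst (nmul n x) = nmul n (fst x)"
  and snd_nmul: "snd (nmul n x) = nmul n (snd x)"
  by (simp_all add: nmul_def fst_sum snd_sum)

text \<open>In an extremal family every element lies in \<open>tor Z r\<close> or in
  \<open>tor Z e\<close>. The two partial sums add up to zero and lie in torsion parts of coprime
  exponents, so each vanishes, and both subfamilies inherit unique factorization.\<close>

lemma extremal_UFIMs_split_coords:
  fixes B :: "'b::ab_group_add monoid" and \<alpha> \<beta> \<gamma> :: "int \<times> 'b \<Rightarrow> int"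
  assumes co: "coords fst \<alpha> \<beta> \<gamma> r P Q1 Q2" and rep: "rep B \<pi>"
    and ker: "\<And>x y. \<pi> y = \<one>\<^bsub>B\<^esub> \<longleftrightarrow> int P dvd \<alpha> (x, y) \<and> int Q1 dvd \<beta> (x, y) \<and> int Q2 dvd \<gamma> (x, y)"
    and ext: "coords.extremal fst \<alpha> \<beta> \<gamma> r P Q1 Q2 \<kappa> e"
  shows "extremal_UFIMs_split (Cyc r) B"
proof -
  interpret coords fst \<alpha> \<beta> \<gamma> r P Q1 Q2 by (rule co)
  let ?A = "Cyc r" and ?pi = "map_prod (\<lambda>x. x mod int r) \<pi>"
  let ?G = "?A \<times>\<times> B"
  have repG: "rep ?G ?pi" by (rule rep_DirProd[OF rep_Cyc[OF pos(1)] rep])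
  have kerG: "?pi x = \<one>\<^bsub>?G\<^esub> \<longleftrightarrow> int r dvd fst x \<and> int P dvd \<alpha> x \<and> int Q1 dvd \<beta> x \<and> int Q2 dvd \<gamma> x" for x
    using ker[of "snd x" "fst x"] by (cases x) (simp add: dvd_eq_mod_eq_0)
  interpret pr: presented ?G ?pi Z
    by (unfold_locales) (use repG kerG in \<open>auto simp: Z_def\<close>)
  have Zpair: "(a, b) \<in> Z \<longleftrightarrow> int r dvd a \<and> \<pi> b = \<one>\<^bsub>B\<^esub>" for a b
    using ker[of b a] by (simp add: Z_def)
  have e: "0 < e" "coprime e r" and te: "\<And>x. int r dvd fst x \<Longrightarrow> x \<in> tor Z e"
    and ub: "\<And>(I::nat set) g. UF Z g I \<Longrightarrow> g ` I \<inter> Z = {} \<Longrightarrow> (\<Sum>i\<in>I. wz Z (g i)) = \<kappa> \<Longrightarrow>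
      \<forall>i\<in>I. g i \<in> tor Z e \<or> g i \<in> tor Z r"
    using ext unfolding extremal_def by blast+
  have K: "K1 ?G = \<kappa>" by (rule K1_coords[OF co repG kerG ext])
  have torr: "b = \<one>\<^bsub>B\<^esub>" if "(a, b) \<in> carrier ?G" "(a, b) \<in> tor Z r" for a b
  proof -
    have nm: "nmul n (c, b) = (nmul n c, nmul n b)" for n c
      by (simp add: prod_eq_iff fst_nmul snd_nmul)
    \<comment> \<open>With first component 0 the element is killed by \<open>e\<close> as well,
      hence by 1.\<close>
    have "(0, b) \<in> tor Z r" using that(2) by (simp add: tor_def nm Zpair)
    moreover have "(0, b) \<in> tor Z e" using te by simp
    ultimately have "(0, b) \<in> Z" using tor_coprime[OF sgZ e(2,1)] by blast
    then have "\<pi> b = \<one>\<^bsub>B\<^esub>" by (simp add: Zpair)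
    then show ?thesis using that(1) rep by (simp add: rep_def)
  qed
  have tore: "a = 0" if "(a, b) \<in> carrier ?G" "(a, b) \<in> tor Z e" for a b
  proof -
    have "int r dvd int e * a" using that(2) by (simp add: tor_iff)
    then have "int r dvd a" using coprime_dvd[of r e a] e(2) by (simp add: coprime_commute)
    moreover have "0 \<le> a" "a < int r" using that(1) pos(1) by (simp_all add: carrier_integer_mod_group)
    ultimately show ?thesis using zdvd_not_zless[of a "int r"] by force
  qed
  show ?thesis unfolding extremal_UFIMs_split_def
  proof (intro allI impI)
    fix S assume "UFIM ?G (carrier ?G - {\<one>\<^bsub>?G\<^esub>}) S \<and> cross_number ?G S = K1 ?G"
    then have S: "UFIM ?G (carrier ?G - {\<one>\<^bsub>?G\<^esub>}) S" and cr: "cross_number ?G S = \<kappa>" using K by auto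
    have S': "set S \<subseteq> carrier ?G - {\<one>\<^bsub>?G\<^esub>}" "UF Z (nth S) {..<length S}"
      using S pr.UFIM_iff[of "carrier ?G - {\<one>\<^bsub>?G\<^esub>}"] by blast+
    have car: "S ! i \<in> carrier ?G - {\<one>\<^bsub>?G\<^esub>}" if "i < length S" for i using S'(1) that nth_mem by blast
    have "nth S ` {..<length S} \<inter> Z = {}"
    proof -
      have "S ! i \<notin> Z" if "i < length S" for i using car[OF that] pr.carrier_Z by blast
      then show ?thesis by auto
    qed
    moreover have "(\<Sum>i<length S. wz Z (S ! i)) = \<kappa>"
    proof -
      have "set S \<subseteq> carrier ?G" using S'(1) by blast
      then show ?thesis using cr pr.cross_number_eq[of S] by simp
    qed
    ultimately have cases: "\<forall>i\<in>{..<length S}. S ! i \<in> tor Z e \<or> S ! i \<in> tor Z r"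
      using ub[OF S'(2)] by blast
    define I where "I = {i \<in> {..<length S}. S ! i \<in> tor Z r}"
    let ?J = "{..<length S} - I"
    have IS: "I \<subseteq> {..<length S}" by (auto simp: I_def)
    have sI: "sum (nth S) I \<in> tor Z r" by (rule sg_sum[OF sg_tor[OF sgZ]]) (auto simp: I_def)
    have Je: "S ! i \<in> tor Z e" if "i \<in> ?J" for i using that cases by (auto simp: I_def)
    have sJ: "sum (nth S) ?J \<in> tor Z e" by (rule sg_sum[OF sg_tor[OF sgZ]]) (rule Je)
    have tot: "sum (nth S) {..<length S} = sum (nth S) ?J + sum (nth S) I"
      by (rule sum.subset_diff[OF IS]) simp
    have totZ: "sum (nth S) {..<length S} \<in> Z" using S'(2) by (simp add: UF_def)
    then have "sum (nth S) ?J + sum (nth S) I \<in> tor Z e" using tot sub_tor[OF sgZ] by auto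
    then have "sum (nth S) I \<in> tor Z e" using sg_add_iff1[OF sg_tor[OF sgZ] sJ] by blast
    then have zI: "sum (nth S) I \<in> Z" using tor_coprime[OF sgZ e(2,1)] sI by blast
    then have zJ: "sum (nth S) ?J \<in> Z" using totZ tot sg_add_iff2[OF sgZ] by metis
    have "UFIM ?G (carrier ?A \<times> {\<one>\<^bsub>B\<^esub>} - {\<one>\<^bsub>?G\<^esub>}) (nths S I)"
    proof (rule pr.UFIM_nths[OF S IS zI])
      have "\<one>\<^bsub>B\<^esub> \<in> carrier B" using rep by (metis rep_def comm_group_def group.is_monoid comm_group.axioms(2) monoid.one_closed)
      then show "carrier ?A \<times> {\<one>\<^bsub>B\<^esub>} - {\<one>\<^bsub>?G\<^esub>} \<subseteq> carrier ?G" by auto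
      fix i assume i: "i \<in> I"
      obtain a b where ab: "S ! i = (a, b)" by (cases "S ! i")
      show "S ! i \<in> carrier ?A \<times> {\<one>\<^bsub>B\<^esub>} - {\<one>\<^bsub>?G\<^esub>}"
        using car[of i] i torr[of a b] ab by (auto simp: I_def)
    qed
    moreover have "UFIM ?G ({\<one>\<^bsub>?A\<^esub>} \<times> carrier B - {\<one>\<^bsub>?G\<^esub>}) (nths S ?J)"
    proof (rule pr.UFIM_nths[OF S _ zJ])
      show "{\<one>\<^bsub>?A\<^esub>} \<times> carrier B - {\<one>\<^bsub>?G\<^esub>} \<subseteq> carrier ?G" by auto
      fix i assume i: "i \<in> ?J"
      obtain a b where ab: "S ! i = (a, b)" by (cases "S ! i")
      show "S ! i \<in> {\<one>\<^bsub>?A\<^esub>} \<times> carrier B - {\<one>\<^bsub>?G\<^esub>}"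
        using car[of i] i tore[of a b] Je[OF i] ab by auto
    qed auto
    ultimately show "\<exists>I\<subseteq>{..<length S}.
        UFIM ?G (carrier ?A \<times> {\<one>\<^bsub>B\<^esub>} - {\<one>\<^bsub>?G\<^esub>}) (nths S I) \<and>
        UFIM ?G ({\<one>\<^bsub>?A\<^esub>} \<times> carrier B - {\<one>\<^bsub>?G\<^esub>}) (nths S ({..<length S} - I))"
      using IS by blast
  qed
qed

section \<open>The five families of groups\<close>

lemma crt_two:
  assumes "coprime m n"
  shows "\<exists>x::int. int m dvd x - a \<and> int n dvd x - b"
  using binary_chinese_remainder_int[of "int m" "int n" a b] assms by (simp add: cong_iff_dvd_diff)

lemma crt_three:
  assumes "coprime k m" "coprime k n" "coprime m n"
  shows "\<exists>x::int. int k dvd x - a \<and> int m dvd x - b \<and> int n dvd x - c"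
proof -
  obtain y where y: "int m dvd y - b" "int n dvd y - c" using crt_two[OF assms(3)] by blast
  obtain x where x: "int k dvd x - a" "int (m * n) dvd x - y" using crt_two[of k "m * n" a y] assms by auto
  have "int m dvd x - y" "int n dvd x - y" using x(2) by (auto elim: dvd_mult_left dvd_mult_right)
  then have "int m dvd (x - y) + (y - b)" "int n dvd (x - y) + (y - c)"
    using dvd_add y by blast+
  then show ?thesis using x(1) by (intro exI[of _ x]) simp
qed

lemma dvd_mult_coprime_iff: "coprime m n \<Longrightarrow> int (m * n) dvd x \<longleftrightarrow> int m dvd x \<and> int n dvd x"
  using divides_mult[of "int m" x "int n"] by (auto elim: dvd_mult_left dvd_mult_right)

lemma primary_decomposition_Cyc_prime: "prime p \<Longrightarrow> primary_decomposition (Cyc p) [(p, 1)]"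
  using primary_decomposition_Cyc[of p 1] by simp

text \<open>Two coordinate systems are set up, because the value of \<open>K1\<close> concerns one
  cyclic group, where all coordinates are the identity, and the splitting concerns a product with
  C_r.\<close>

lemma split_cyclic_plus_elementary:
  assumes r: "prime r" and p: "prime p" "r < p" and q: "prime q" "r < q" "p \<noteq> q" and m: "1 \<le> m"
  shows "K1 (Cyc (r * p ^ m * q)) = K1_star (Cyc (r * p ^ m * q))"
    and "extremal_UFIMs_split (Cyc r) (Cyc (p ^ m * q))"
proof -
  have pos: "0 < r" "0 < p ^ m" "0 < q" using r p q by (auto simp: prime_gt_0_nat)
  have c: "coprime r (p ^ m)" "coprime r q" "coprime (p ^ m) q" "coprime (r * p ^ m) q"
    using primes_coprime[OF r p(1)] primes_coprime[OF r q(1)] primes_coprime[OF p(1) q(1)] p q by auto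
  let ?z = "\<lambda>_. 0::int"
  have co1: "coords (\<lambda>x. x) (\<lambda>x. x) (\<lambda>x. x) ?z r (p ^ m) q 1"
  proof
    show "\<exists>x. int r dvd x - a \<and> int (p ^ m) dvd x - b \<and> int q dvd x - c \<and> int 1 dvd 0 - d" for a b c d
      using crt_three[OF c(1-3)] by auto
  qed (use pos in simp_all)
  have "K1 (Cyc (r * p ^ m * q)) = 1 + ((\<Sum>k<m. 1 / real p ^ k) + real 1)"
  proof (rule K1_coords[OF co1 rep_Cyc])
    show "0 < r * p ^ m * q" using pos by simp
    show "x mod int (r * p ^ m * q) = \<one>\<^bsub>Cyc (r * p ^ m * q)\<^esub> \<longleftrightarrow>
      int r dvd x \<and> int (p ^ m) dvd x \<and> int q dvd x \<and> int 1 dvd 0" for x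
      using dvd_mult_coprime_iff[OF c(4), of x] dvd_mult_coprime_iff[OF c(1), of x]
      unfolding one_integer_mod_group dvd_eq_mod_eq_0[symmetric] by simp
    show "coords.extremal (\<lambda>x. x) (\<lambda>x. x) (\<lambda>x. x) ?z r (p ^ m) q 1
        (1 + ((\<Sum>k<m. 1 / real p ^ k) + real 1)) (p ^ m * q)"
      by (rule coords.extremal_two_primes[OF co1 r p q]) simp_all
  qed
  moreover have "primary_decomposition (Cyc (r * p ^ m * q)) (([(r, 1)] @ [(p, m)]) @ [(q, 1)])"
    using pos c r p q m by (intro primary_decomposition_Cyc_mult primary_decomposition_Cyc_prime primary_decomposition_Cyc) auto
  then have "K1_star (Cyc (r * p ^ m * q)) = pval (([(r, 1)] @ [(p, m)]) @ [(q, 1)])"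
    by (rule K1_star_eq[OF group_integer_mod_group])
  ultimately show "K1 (Cyc (r * p ^ m * q)) = K1_star (Cyc (r * p ^ m * q))"
    using r p q m by (simp only: pval_append pval_prime_power) simp
  have co2: "coords fst snd snd ?z r (p ^ m) q 1"
  proof
    show "\<exists>x. int r dvd fst x - a \<and> int (p ^ m) dvd snd x - b \<and> int q dvd snd x - c \<and> int 1 dvd 0 - d" for a b c d :: int
    proof -
      obtain y where "int (p ^ m) dvd y - b \<and> int q dvd y - c" using crt_two[OF c(3)] by blast
      then show ?thesis by (intro exI[of _ "(a, y)"]) simp
    qed
  qed (use pos in simp_all)
  show "extremal_UFIMs_split (Cyc r) (Cyc (p ^ m * q))"
  proof (rule extremal_UFIMs_split_coords[OF co2 rep_Cyc])
    show "0 < p ^ m * q" using pos by simp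
    show "y mod int (p ^ m * q) = \<one>\<^bsub>Cyc (p ^ m * q)\<^esub> \<longleftrightarrow>
      int (p ^ m) dvd snd (x, y) \<and> int q dvd snd (x, y) \<and> int 1 dvd 0" for x y :: int
      using dvd_mult_coprime_iff[OF c(3), of y]
      unfolding one_integer_mod_group dvd_eq_mod_eq_0[symmetric] by simp
    show "coords.extremal fst snd snd ?z r (p ^ m) q 1 (1 + ((\<Sum>k<m. 1 / real p ^ k) + real 1)) (p ^ m * q)"
      by (rule coords.extremal_two_primes[OF co2 r p q]) simp_all
  qed
qed

lemma split_p_group:
  assumes r: "prime r" and p: "prime p" "r < p" and m: "1 \<le> m"
  shows "K1 (Cyc r \<times>\<times> Cyc (p ^ m) \<times>\<times> Cyc p) = K1_star (Cyc r \<times>\<times> Cyc (p ^ m) \<times>\<times> Cyc p)"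
    and "extremal_UFIMs_split (Cyc r) (Cyc (p ^ m) \<times>\<times> Cyc p)"
proof -
  have pos: "0 < r" "0 < p ^ m" "0 < p" using r p by (auto simp: prime_gt_0_nat)
  let ?z = "\<lambda>_. 0::int" and ?\<alpha> = "\<lambda>x::int \<times> int \<times> int. fst (snd x)" and ?\<beta> = "\<lambda>x::int \<times> int \<times> int. snd (snd x)"
  have co: "coords fst ?\<alpha> ?\<beta> ?z r (p ^ m) p 1"
  proof
    show "\<exists>x. int r dvd fst x - a \<and> int (p ^ m) dvd ?\<alpha> x - b \<and> int p dvd ?\<beta> x - c \<and> int 1 dvd 0 - d" for a b c d :: int
      by (intro exI[of _ "(a, b, c)"]) simp
  qed (use pos in simp_all)
  let ?B = "Cyc (p ^ m) \<times>\<times> Cyc p" and ?v = "1 + ((\<Sum>k<m. 1 / real p ^ k) + 1)"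
  have repB: "rep ?B (map_prod (\<lambda>x. x mod int (p ^ m)) (\<lambda>x. x mod int p))"
    using pos by (intro rep_DirProd rep_Cyc)
  have ex: "coords.extremal fst ?\<alpha> ?\<beta> ?z r (p ^ m) p 1 ?v (p ^ m)"
    by (rule coords.extremal_p_group[OF co r p m]) simp_all
  have "K1 (Cyc r \<times>\<times> ?B) = ?v"
    by (rule K1_coords[OF co rep_DirProd[OF rep_Cyc[OF pos(1)] repB] _ ex])
      (auto simp: dvd_eq_mod_eq_0 map_prod_def split: prod.split)
  moreover have "primary_decomposition (Cyc r \<times>\<times> ?B) ([(r, 1)] @ ([(p, m)] @ [(p, 1)]))"
    using r p m by (intro primary_decomposition_DirProd primary_decomposition_Cyc_prime primary_decomposition_Cyc) auto
  then have "K1_star (Cyc r \<times>\<times> ?B) = pval ([(r, 1)] @ ([(p, m)] @ [(p, 1)]))"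
    by (intro K1_star_eq DirProd_group group_integer_mod_group)
  ultimately show "K1 (Cyc r \<times>\<times> ?B) = K1_star (Cyc r \<times>\<times> ?B)"
    using r p m by (simp only: pval_append pval_prime_power) simp
  show "extremal_UFIMs_split (Cyc r) ?B"
    by (rule extremal_UFIMs_split_coords[OF co repB _ ex])
      (auto simp: dvd_eq_mod_eq_0 map_prod_def split: prod.split)
qed

text \<open>Both orders of the factors are treated, as cases (4) and (5) write the cyclic part on
  different sides.\<close>

lemma split_cyclic_plus_square:
  assumes r: "prime r" and p: "prime p" "r < p" and q: "prime q" "r < q" "p \<noteq> q" and m: "1 \<le> m"
  shows "K1 (Cyc r \<times>\<times> Cyc (p ^ m) \<times>\<times> Cyc q \<times>\<times> Cyc q) = K1_star (Cyc r \<times>\<times> Cyc (p ^ m) \<times>\<times> Cyc q \<times>\<times> Cyc q)"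
    and "extremal_UFIMs_split (Cyc r) (Cyc (p ^ m) \<times>\<times> Cyc q \<times>\<times> Cyc q)"
    and "K1 (Cyc r \<times>\<times> (Cyc q \<times>\<times> Cyc q) \<times>\<times> Cyc (p ^ m)) = K1_star (Cyc r \<times>\<times> (Cyc q \<times>\<times> Cyc q) \<times>\<times> Cyc (p ^ m))"
    and "extremal_UFIMs_split (Cyc r) ((Cyc q \<times>\<times> Cyc q) \<times>\<times> Cyc (p ^ m))"
proof -
  have pos: "0 < r" "0 < p ^ m" "0 < q" using r p q by (auto simp: prime_gt_0_nat)
  let ?v = "1 + ((\<Sum>k<m. 1 / real p ^ k) + real 2)"
  let ?\<alpha> = "\<lambda>x::int \<times> int \<times> int \<times> int. fst (snd x)" and ?\<beta> = "\<lambda>x::int \<times> int \<times> int \<times> int. fst (snd (snd x))"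
    and ?\<gamma> = "\<lambda>x::int \<times> int \<times> int \<times> int. snd (snd (snd x))"
  have co: "coords fst ?\<alpha> ?\<beta> ?\<gamma> r (p ^ m) q q"
  proof
    show "\<exists>x. int r dvd fst x - a \<and> int (p ^ m) dvd ?\<alpha> x - b \<and> int q dvd ?\<beta> x - c \<and> int q dvd ?\<gamma> x - d" for a b c d :: int
      by (intro exI[of _ "(a, b, c, d)"]) simp
  qed (use pos in simp_all)
  let ?B = "Cyc (p ^ m) \<times>\<times> Cyc q \<times>\<times> Cyc q"
  have repB: "rep ?B (map_prod (\<lambda>x. x mod int (p ^ m)) (map_prod (\<lambda>x. x mod int q) (\<lambda>x. x mod int q)))"
    using pos by (intro rep_DirProd rep_Cyc)
  have ex: "coords.extremal fst ?\<alpha> ?\<beta> ?\<gamma> r (p ^ m) q q ?v (p ^ m * q)"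
    by (rule coords.extremal_two_primes[OF co r p q]) simp_all
  have "K1 (Cyc r \<times>\<times> ?B) = ?v"
    by (rule K1_coords[OF co rep_DirProd[OF rep_Cyc[OF pos(1)] repB] _ ex])
      (auto simp: dvd_eq_mod_eq_0 map_prod_def split: prod.split)
  moreover have "primary_decomposition (Cyc r \<times>\<times> ?B) ([(r, 1)] @ ([(p, m)] @ ([(q, 1)] @ [(q, 1)])))"
    using r p q m by (intro primary_decomposition_DirProd primary_decomposition_Cyc_prime primary_decomposition_Cyc) auto
  then have "K1_star (Cyc r \<times>\<times> ?B) = pval ([(r, 1)] @ ([(p, m)] @ ([(q, 1)] @ [(q, 1)])))"
    by (intro K1_star_eq DirProd_group group_integer_mod_group)
  then have "K1_star (Cyc r \<times>\<times> ?B) = ?v"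
    using r p q m by (simp only: pval_append pval_prime_power) simp
  ultimately show "K1 (Cyc r \<times>\<times> ?B) = K1_star (Cyc r \<times>\<times> ?B)" by simp
  show "extremal_UFIMs_split (Cyc r) ?B"
    by (rule extremal_UFIMs_split_coords[OF co repB _ ex])
      (auto simp: dvd_eq_mod_eq_0 map_prod_def split: prod.split)
  let ?\<alpha>' = "\<lambda>x::int \<times> (int \<times> int) \<times> int. snd (snd x)" and ?\<beta>' = "\<lambda>x::int \<times> (int \<times> int) \<times> int. fst (fst (snd x))"
    and ?\<gamma>' = "\<lambda>x::int \<times> (int \<times> int) \<times> int. snd (fst (snd x))"
  have co': "coords fst ?\<alpha>' ?\<beta>' ?\<gamma>' r (p ^ m) q q"
  proof
    show "\<exists>x. int r dvd fst x - a \<and> int (p ^ m) dvd ?\<alpha>' x - b \<and> int q dvd ?\<beta>' x - c \<and> int q dvd ?\<gamma>' x - d" for a b c d :: int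
      by (intro exI[of _ "(a, (c, d), b)"]) simp
  qed (use pos in simp_all)
  let ?B' = "(Cyc q \<times>\<times> Cyc q) \<times>\<times> Cyc (p ^ m)"
  have repB': "rep ?B' (map_prod (map_prod (\<lambda>x. x mod int q) (\<lambda>x. x mod int q)) (\<lambda>x. x mod int (p ^ m)))"
    using pos by (intro rep_DirProd rep_Cyc)
  have ex': "coords.extremal fst ?\<alpha>' ?\<beta>' ?\<gamma>' r (p ^ m) q q ?v (p ^ m * q)"
    by (rule coords.extremal_two_primes[OF co' r p q]) simp_all
  have "K1 (Cyc r \<times>\<times> ?B') = ?v"
    by (rule K1_coords[OF co' rep_DirProd[OF rep_Cyc[OF pos(1)] repB'] _ ex'])
      (auto simp: dvd_eq_mod_eq_0 map_prod_def split: prod.split)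
  moreover have "primary_decomposition (Cyc r \<times>\<times> ?B') ([(r, 1)] @ (([(q, 1)] @ [(q, 1)]) @ [(p, m)]))"
    using r p q m by (intro primary_decomposition_DirProd DirProd_group primary_decomposition_Cyc_prime primary_decomposition_Cyc) auto
  then have "K1_star (Cyc r \<times>\<times> ?B') = pval ([(r, 1)] @ (([(q, 1)] @ [(q, 1)]) @ [(p, m)]))"
    by (intro K1_star_eq DirProd_group group_integer_mod_group)
  then have "K1_star (Cyc r \<times>\<times> ?B') = ?v"
    using r p q m by (simp only: pval_append pval_prime_power) simp
  ultimately show "K1 (Cyc r \<times>\<times> ?B') = K1_star (Cyc r \<times>\<times> ?B')" by simp
  show "extremal_UFIMs_split (Cyc r) ?B'"
    by (rule extremal_UFIMs_split_coords[OF co' repB' _ ex'])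
      (auto simp: dvd_eq_mod_eq_0 map_prod_def split: prod.split)
qed

theorem corollary9:
  fixes c :: real and m r p q :: nat
  assumes "c > 1" and "m \<ge> 1" and "r \<in> {2, 3}"
    and "prime p" and "prime q" and "r < p" and "p < q" and "real q \<le> c * real p"
  shows
    "(((1 / real r + (real p ^ m - 1) / (real p ^ (m + 1) - real p ^ m) + 1 / real p
          \<ge> log 2 (real r * real p ^ (m + 1)) / real p) \<longrightarrow>
        K1 (Cyc r \<times>\<times> Cyc (p ^ m) \<times>\<times> Cyc p) = K1_star (Cyc r \<times>\<times> Cyc (p ^ m) \<times>\<times> Cyc p)) \<and>
      ((1 / real r + (real p ^ m - 1) / (real p ^ (m + 1) - real p ^ m) + 1 / real p
          > log 2 (real r * real p ^ (m + 1)) / real p) \<longrightarrow>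
        extremal_UFIMs_split (Cyc r) (Cyc (p ^ m) \<times>\<times> Cyc p))) \<and>
     (((1 / real r + (real p ^ m - 1) / (real p ^ (m + 1) - real p ^ m) + 1 / (c * real p)
          \<ge> log 2 (real r * c * real p ^ (m + 1)) / real p) \<longrightarrow>
        K1 (Cyc (r * p ^ m * q)) = K1_star (Cyc (r * p ^ m * q))) \<and>
      ((1 / real r + (real p ^ m - 1) / (real p ^ (m + 1) - real p ^ m) + 1 / (c * real p)
          > log 2 (real r * c * real p ^ (m + 1)) / real p) \<longrightarrow>
        extremal_UFIMs_split (Cyc r) (Cyc (p ^ m * q)))) \<and>
     (((1 / real r + 1 / real p + ((c * real p) ^ m - 1) / ((c * real p) ^ (m + 1) - (c * real p) ^ m)
          \<ge> log 2 (real r * c ^ m * real p ^ (m + 1)) / real p) \<longrightarrow>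
        K1 (Cyc (r * p * q ^ m)) = K1_star (Cyc (r * p * q ^ m))) \<and>
      ((1 / real r + 1 / real p + ((c * real p) ^ m - 1) / ((c * real p) ^ (m + 1) - (c * real p) ^ m)
          > log 2 (real r * c ^ m * real p ^ (m + 1)) / real p) \<longrightarrow>
        extremal_UFIMs_split (Cyc r) (Cyc (p * q ^ m)))) \<and>
     (((1 / real r + (real p ^ m - 1) / (real p ^ (m + 1) - real p ^ m) + 2 / (c * real p)
          \<ge> log 2 (real r * c ^ 2 * real p ^ (m + 2)) / real p) \<longrightarrow>
        K1 (Cyc r \<times>\<times> Cyc (p ^ m) \<times>\<times> Cyc q \<times>\<times> Cyc q) = K1_star (Cyc r \<times>\<times> Cyc (p ^ m) \<times>\<times> Cyc q \<times>\<times> Cyc q)) \<and>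
      ((1 / real r + (real p ^ m - 1) / (real p ^ (m + 1) - real p ^ m) + 2 / (c * real p)
          > log 2 (real r * c ^ 2 * real p ^ (m + 2)) / real p) \<longrightarrow>
        extremal_UFIMs_split (Cyc r) (Cyc (p ^ m) \<times>\<times> Cyc q \<times>\<times> Cyc q))) \<and>
     (((1 / real r + 2 / real p + ((c * real p) ^ m - 1) / ((c * real p) ^ (m + 1) - (c * real p) ^ m)
          \<ge> log 2 (real r * c ^ m * real p ^ (m + 2)) / real p) \<longrightarrow>
        K1 (Cyc r \<times>\<times> (Cyc p \<times>\<times> Cyc p) \<times>\<times> Cyc (q ^ m)) = K1_star (Cyc r \<times>\<times> (Cyc p \<times>\<times> Cyc p) \<times>\<times> Cyc (q ^ m))) \<and>
      ((1 / real r + 2 / real p + ((c * real p) ^ m - 1) / ((c * real p) ^ (m + 1) - (c * real p) ^ m)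
          > log 2 (real r * c ^ m * real p ^ (m + 2)) / real p) \<longrightarrow>
        extremal_UFIMs_split (Cyc r) ((Cyc p \<times>\<times> Cyc p) \<times>\<times> Cyc (q ^ m))))"
proof -
  have r: "prime r" using assms(3) by auto
  have rq: "r < q" and pq: "p \<noteq> q" "q \<noteq> p" using assms by auto
  \<comment> \<open>In cases (3) and (5) \<open>q\<close> carries the exponent; they are instances
    with \<open>p\<close> and \<open>q\<close> exchanged, and case (3) also needs its factors
    reordered.\<close>
  have comm: "r * p * q ^ m = r * q ^ m * p" "p * q ^ m = q ^ m * p" by simp_all
  note p = assms(4,6) and q = assms(5) rq and m = assms(2)
  show ?thesis
    unfolding comm
    using split_p_group[OF r p m] split_cyclic_plus_elementary[OF r p q pq(1) m]
      split_cyclic_plus_elementary[OF r q p pq(2) m] split_cyclic_plus_square[OF r p q pq(1) m]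
      split_cyclic_plus_square[OF r q p pq(2) m]
    by blast
qed

end
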